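(* Let $q\ge 4$ be a prime power with $q\neq 5$, let $G=\mathrm{PSL}_2(q)$, let $H<G$ be a proper subgroup, and let $G$ act by right multiplication on $\Omega$, the set of right cosets of $H$ in $G$. The action is binary if and only if one of the following occurs: (1) $H=\{1\}$ and the action is regular; (2) $q=2^a$ for some integer $a$ and $H$ is a Sylow $2$-subgroup of $G$; (3) $q=2^a$ for some odd integer $a$ and $|H|=3$.
   Context: Let a finite group $G$ act on a finite set $\Omega$ on the right. For $n$-tuples $I=(I_1,\dots,I_n)$, $J=(J_1,\dots,J_n)\in\Omega^n$ and $r\le n$, say that $I$ and $J$ are $r$-related if for every choice of indices $1\le k_1<\cdots<k_r\le n$ there exists $g\in G$ with $I_{k_i}^g=J_{k_i}$ for all $i$. The relational complexity $\mathrm{RC}(G,\Omega)$ is the smallest integer $k\ge 2$ such that, for all $n\ge k$, any $I,J\in\Omega^n$ that are $k$-related are $n$-related (i.e. there exists $g\in G$ with $I^g=J$). The action is binary if $\mathrm{RC}(G,\Omega)=2$. *)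

theory Defs
  imports "HOL-Analysis.Analysis" "HOL-Algebra.Algebra" "HOL-Number_Theory.Prime_Powers"
begin

section \<open>Right actions and relational complexity\<close>

locale right_action = group G for G (structure) +
  fixes \<Omega> :: "'x set" and act :: "'x \<Rightarrow> 'a \<Rightarrow> 'x"
  assumes act_closed: "x \<in> \<Omega> \<Longrightarrow> g \<in> carrier G \<Longrightarrow> act x g \<in> \<Omega>"
    and act_one: "x \<in> \<Omega> \<Longrightarrow> act x \<one> = x"
    and act_mult: "x \<in> \<Omega> \<Longrightarrow> g \<in> carrier G \<Longrightarrow> h \<in> carrier G
      \<Longrightarrow> act x (g \<otimes> h) = act (act x g) h"

definition tuples :: "'x set \<Rightarrow> nat \<Rightarrow> 'x list set" where
  "tuples \<Omega> n = {xs. length xs = n \<and> set xs \<subseteq> \<Omega>}"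

text \<open>The strictly increasing lists \<open>ks\<close> of length \<open>r\<close> are the choices
  of indices \<open>k\<^sub>1 < \<dots> < k\<^sub>r\<close>, counted from \<open>0\<close>.\<close>

definition r_related ::
    "('a, 'm) monoid_scheme \<Rightarrow> ('x \<Rightarrow> 'a \<Rightarrow> 'x) \<Rightarrow> nat \<Rightarrow> 'x list \<Rightarrow> 'x list \<Rightarrow> bool" where
  "r_related G act r I J \<longleftrightarrow>
     (\<forall>ks. sorted_wrt (<) ks \<and> length ks = r \<and> set ks \<subseteq> {..<length I} \<longrightarrow>
        (\<exists>g\<in>carrier G. \<forall>k\<in>set ks. act (I ! k) g = J ! k))"

text \<open>For a finite \<open>\<Omega>\<close> some \<open>k\<close> has the property below
  (\<open>relational_complexity_exists\<close>), so \<open>LEAST\<close> is a genuine minimum.\<close>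

definition relational_complexity ::
    "('a, 'm) monoid_scheme \<Rightarrow> 'x set \<Rightarrow> ('x \<Rightarrow> 'a \<Rightarrow> 'x) \<Rightarrow> nat" where
  "relational_complexity G \<Omega> act =
     (LEAST k. k \<ge> 2 \<and>
        (\<forall>n\<ge>k. \<forall>I\<in>tuples \<Omega> n. \<forall>J\<in>tuples \<Omega> n.
           r_related G act k I J \<longrightarrow> r_related G act n I J))"

definition binary_action ::
    "('a, 'm) monoid_scheme \<Rightarrow> 'x set \<Rightarrow> ('x \<Rightarrow> 'a \<Rightarrow> 'x) \<Rightarrow> bool" where
  "binary_action G \<Omega> act \<longleftrightarrow> relational_complexity G \<Omega> act = 2"

definition regular_action ::
    "('a, 'm) monoid_scheme \<Rightarrow> 'x set \<Rightarrow> ('x \<Rightarrow> 'a \<Rightarrow> 'x) \<Rightarrow> bool" where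
  "regular_action G \<Omega> act \<longleftrightarrow>
     \<Omega> \<noteq> {} \<and> (\<forall>x\<in>\<Omega>. \<forall>y\<in>\<Omega>. \<exists>!g. g \<in> carrier G \<and> act x g = y)"

lemma r_related_full:
  assumes "length I = n" "length J = n"
  shows "r_related G act n I J \<longleftrightarrow> (\<exists>g\<in>carrier G. map (\<lambda>x. act x g) I = J)"
proof -
  have *: "set ks = {..<n}" if "sorted_wrt (<) ks" "length ks = n" "set ks \<subseteq> {..<n}" for ks
  proof (rule card_subset_eq)
    show "card (set ks) = card {..<n}"
      using that strict_sorted_iff[of ks] by (simp add: distinct_card)
  qed (use that in auto)
  have **: "sorted_wrt (<) [0..<n]" "length [0..<n] = n" "set [0..<n] \<subseteq> {..<n}"
    by auto
  have "r_related G act n I J \<longleftrightarrow> (\<exists>g\<in>carrier G. \<forall>k<n. act (I ! k) g = J ! k)"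
    (is "?L \<longleftrightarrow> ?R")
  proof
    assume ?L
    then have "\<exists>g\<in>carrier G. \<forall>k\<in>set [0..<n]. act (I ! k) g = J ! k"
      unfolding r_related_def using ** assms(1) by blast
    then show ?R unfolding set_upt atLeast0LessThan Ball_def lessThan_iff .
  next
    assume ?R
    then show ?L unfolding r_related_def using * assms(1) by fastforce
  qed
  then show ?thesis using assms by (auto simp: list_eq_iff_nth_eq)
qed

lemma r_relatedD:
  assumes "r_related G act r I J" "K \<subseteq> {..<length I}" "card K = r"
  shows "\<exists>g\<in>carrier G. \<forall>k\<in>K. act (I ! k) g = J ! k"
proof -
  have f: "finite K" using assms(2) finite_subset by blast
  then show ?thesis
    using assms unfolding r_related_def
    by (metis sorted_list_of_set.length_sorted_key_list_of_set sorted_list_of_set.set_sorted_key_list_of_set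
        sorted_list_of_set.strict_sorted_key_list_of_set)
qed

lemma relational_complexity_exists:
  assumes "finite \<Omega>"
  shows "\<exists>k\<ge>2. \<forall>n\<ge>k. \<forall>I\<in>tuples \<Omega> n. \<forall>J\<in>tuples \<Omega> n.
    r_related G act k I J \<longrightarrow> r_related G act n I J"
proof (intro exI conjI allI impI ballI)
  define k where "k = card (\<Omega> \<times> \<Omega>) + 2"
  show "2 \<le> k" by (simp add: k_def)
  fix n I J
  assume n: "n \<ge> k" and I: "I \<in> tuples \<Omega> n" and J: "J \<in> tuples \<Omega> n"
    and rel: "r_related G act k I J"
  define p where "p i = (I ! i, J ! i)" for i
  have pim: "p ` {..<n} \<subseteq> \<Omega> \<times> \<Omega>"
    using I J by (force simp: p_def tuples_def)
  obtain K0 where K0: "K0 \<subseteq> {..<n}" "inj_on p K0" "p ` K0 = p ` {..<n}"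
    by (metis subset_image_inj subset_refl)
  have "card K0 = card (p ` {..<n})"
    using K0 by (metis card_image)
  also have "\<dots> \<le> card (\<Omega> \<times> \<Omega>)"
    using pim assms by (intro card_mono) auto
  finally have "card K0 \<le> k" by (simp add: k_def)
  then obtain K where K: "K0 \<subseteq> K" "K \<subseteq> {..<n}" "card K = k"
    using K0(1) n exists_subset_between[of K0 k "{..<n}"] by auto
  have "length I = n" using I by (simp add: tuples_def)
  then obtain g where g: "g \<in> carrier G" "\<forall>i\<in>K. act (I ! i) g = J ! i"
    using r_relatedD[OF rel, of K] K(2,3) by blast
  have "act (I ! i) g = J ! i" if "i < n" for i
  proof -
    have "p i \<in> p ` K0" unfolding K0(3) using that by simp
    then obtain j where j: "j \<in> K0" "p j = p i" by (metis imageE)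
    then have "act (I ! j) g = J ! j" using g K by blast
    then show ?thesis using j(2) by (simp add: p_def)
  qed
  then show "r_related G act n I J"
    unfolding r_related_def \<open>length I = n\<close> by (intro allI impI bexI[OF _ g(1)]) auto
qed

lemma (in group) right_coset_action:
  assumes "subgroup H G"
  shows "right_action G (rcosets H) (\<lambda>C g. C #> g)"
proof
  have H: "H \<subseteq> carrier G" by (rule subgroup.subset[OF assms])
  fix C g h assume C: "C \<in> rcosets H"
  have sub: "C \<subseteq> carrier G"
    using C H by (auto simp: RCOSETS_def r_coset_def)
  show "C #> \<one> = C" by (rule coset_mult_one[OF sub])
  assume g: "g \<in> carrier G"
  show "C #> g \<in> rcosets H"
    using C g H by (auto simp: RCOSETS_def coset_mult_assoc)
  assume h: "h \<in> carrier G"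
  show "C #> (g \<otimes> h) = C #> g #> h"
    using coset_mult_assoc[OF sub g h] by simp
qed


section \<open>Sylow subgroups and the centre\<close>

definition sylow_subgroup :: "nat \<Rightarrow> ('a, 'm) monoid_scheme \<Rightarrow> 'a set \<Rightarrow> bool" where
  "sylow_subgroup p G P \<longleftrightarrow> subgroup P G \<and> card P = p ^ multiplicity p (order G)"

definition center :: "('a, 'm) monoid_scheme \<Rightarrow> 'a set" where
  "center G = {z \<in> carrier G. \<forall>g\<in>carrier G. g \<otimes>\<^bsub>G\<^esub> z = z \<otimes>\<^bsub>G\<^esub> g}"

lemma (in group) center_normal: "center G \<lhd> G"
proof -
  have "subgroup (center G) G"
  proof (rule subgroupI)
    fix a assume a: "a \<in> center G"
    then have ac: "a \<in> carrier G" by (simp add: center_def)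
    have "g \<otimes> inv a = inv a \<otimes> g" if "g \<in> carrier G" for g
    proof -
      have "g \<otimes> a = a \<otimes> g" using a that by (simp add: center_def)
      then have "g = a \<otimes> g \<otimes> inv a" using ac that by (metis inv_solve_right m_closed)
      then show ?thesis using ac that by (metis inv_closed inv_solve_left m_assoc m_closed)
    qed
    then show "inv a \<in> center G" using ac by (simp add: center_def)
  next
    fix a b assume ab: "a \<in> center G" "b \<in> center G"
    then have c: "a \<in> carrier G" "b \<in> carrier G" by (simp_all add: center_def)
    have "g \<otimes> (a \<otimes> b) = (a \<otimes> b) \<otimes> g" if g: "g \<in> carrier G" for g
    proof -
      have "g \<otimes> a = a \<otimes> g" "g \<otimes> b = b \<otimes> g" using ab g by (simp_all add: center_def)
      then show ?thesis using c g by (metis m_assoc)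
    qed
    then show "a \<otimes> b \<in> center G" using c by (simp add: center_def)
  qed (auto simp: center_def)
  moreover have "x \<otimes> h \<otimes> inv x \<in> center G" if "x \<in> carrier G" "h \<in> center G" for x h
  proof -
    have h: "h \<in> carrier G" "x \<otimes> h = h \<otimes> x" using that by (simp_all add: center_def)
    then have "x \<otimes> h \<otimes> inv x = h" using that(1) by (simp add: m_assoc)
    then show ?thesis using that(2) by simp
  qed
  ultimately show ?thesis by (simp add: normal_inv_iff)
qed


section \<open>The groups \<open>SL\<^sub>2\<close> and \<open>PSL\<^sub>2\<close> over a field\<close>

definition SL2 :: "('k::field ^ 2 ^ 2) monoid" where
  "SL2 = \<lparr>carrier = {A. det A = 1}, monoid.mult = (**), one = mat 1\<rparr>"

definition PSL2 :: "('k::field ^ 2 ^ 2) set monoid" where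
  "PSL2 = SL2 Mod (center SL2)"

lemma group_SL2: "group (SL2 :: ('k::field ^ 2 ^ 2) monoid)"
proof (rule groupI)
  fix A :: "'k ^ 2 ^ 2" assume "A \<in> carrier SL2"
  then have d: "det A = 1" by (simp add: SL2_def)
  then obtain B where B: "B ** A = mat 1"
    by (metis invertible_def invertible_det_nz one_neq_zero)
  from arg_cong[OF B, of det] have "det B = 1" using d by (simp add: det_mul)
  then show "\<exists>B\<in>carrier SL2. B \<otimes>\<^bsub>SL2\<^esub> A = \<one>\<^bsub>SL2\<^esub>"
    using B by (auto simp: SL2_def)
qed (simp_all add: SL2_def det_mul matrix_mul_assoc)

lemma group_PSL2: "group (PSL2 :: ('k::field ^ 2 ^ 2) set monoid)"
  unfolding PSL2_def
  by (rule normal.factorgroup_is_group[OF group.center_normal[OF group_SL2]])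

end

theory Submission
  imports Defs
begin

text \<open>
  The elements moving a tuple of points \<open>H x\<^sub>i\<close> to a tuple \<open>H y\<^sub>i\<close> form the intersection of the
  sets \<open>x\<^sub>i\<inverse> H y\<^sub>i\<close>. So the action on the cosets of \<open>H\<close> is binary iff the family of all \<open>a H b\<close> has
  the Helly property: pairwise intersecting members have a common element. This property passes to
  intersections \<open>K\<close> of conjugates of \<open>H\<close>. If \<open>K\<close> is minimal among the nontrivial ones, then its
  conjugates meet trivially, and \<open>a \<in> K\<close>, \<open>b\<close> and \<open>a b\<close> conjugate into \<open>K\<close> imply \<open>b \<in> K\<close>. In
  \<open>SL\<^sub>2\<close> an element of trace \<open>t \<noteq> \<plusminus>2\<close> is determined up to conjugacy by \<open>t\<close>, so for generic \<open>t\<close> the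
  group \<open>K\<close> contains all \<open>b\<close> with \<open>tr b = tr (a b) = t\<close>. These form a conic, their quotients are
  pairwise distinct, and the square of the order of \<open>K\<close> exceeds \<open>2 |SL\<^sub>2|\<close>, which is impossible
  for a group with conjugates meeting in the centre. In odd characteristic the
  remaining elements produce generic ones; in characteristic two there remain the Sylow
  2-subgroups and, if \<open>x\<^sup>2 + x + 1\<close> has no root, the subgroups of order three, and \<open>H\<close> itself is
  recovered from these minimal intersections.
\<close>

section \<open>Binary actions and the Helly property\<close>

text \<open>The argument runs in SL2, where traces are defined. Every intersection of conjugates of
  a full preimage contains the centre, so "nontrivial" means different from the centre. Passing from
  \<open>H\<close> to a minimal \<open>K\<close> serves twice: conjugates of \<open>K\<close>
  meeting in the centre turn the Helly property into a closure rule, and they bound |K|^2 by 2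
  |SL2|. Generic traces exclude 0 and -1 besides 2 and -2: for a conic whose matrices have trace t,
  the parameter is k = t / (t + 2), which vanishes at t = 0, and t + 2 times the constant of the
  conic is (t - 2) (t + 1). The count puts about q^2 elements into \<open>K\<close>, while |K|^2 is
  at most about 2 q^3, so only small q escape. For q = 5 the count fails, and PSL2(5) is isomorphic
  to PSL2(4), whose Sylow 2-subgroups give binary actions outside the list. For q = 4 the conic has
  two more points than in the worst case, which suffices. In characteristic two the minimal
  subgroups do not yet determine \<open>H\<close>, which could be much larger: an involution in
  \<open>H\<close> is exploited through a subgroup normalised by all \<open>upper c\<close>, and
  without involutions a trace other than 0 and 1 yields either an involution or too many
  elements.\<close>

definition translates :: "('a, 'm) monoid_scheme \<Rightarrow> 'a set \<Rightarrow> 'a set set" where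
  "translates G H =
     {(\<lambda>h. a \<otimes>\<^bsub>G\<^esub> h \<otimes>\<^bsub>G\<^esub> b) ` H | a b. a \<in> carrier G \<and> b \<in> carrier G}"

definition helly :: "('a, 'm) monoid_scheme \<Rightarrow> 'a set \<Rightarrow> bool" where
  "helly G H \<longleftrightarrow>
     (\<forall>C\<subseteq>translates G H. (\<forall>A\<in>C. \<forall>B\<in>C. A \<inter> B \<noteq> {}) \<longrightarrow> (\<exists>x\<in>carrier G. \<forall>A\<in>C. x \<in> A))"

definition conjg :: "('a, 'm) monoid_scheme \<Rightarrow> 'a \<Rightarrow> 'a set \<Rightarrow> 'a set" where
  "conjg G g H = (\<lambda>h. g \<otimes>\<^bsub>G\<^esub> h \<otimes>\<^bsub>G\<^esub> inv\<^bsub>G\<^esub> g) ` H"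

text \<open>The index set is nonempty because the empty intersection would be the whole type, not a
  subgroup.\<close>

definition caps :: "('a, 'm) monoid_scheme \<Rightarrow> 'a set \<Rightarrow> 'a set set" where
  "caps G H = {\<Inter>g\<in>S. conjg G g H | S. S \<subseteq> carrier G \<and> S \<noteq> {}}"

text \<open>\<open>Z\<close> plays the part of the trivial subgroup. In SL2 it is the centre, which
  no intersection of conjugates of a full preimage can avoid.\<close>

definition mincap :: "('a, 'm) monoid_scheme \<Rightarrow> 'a set \<Rightarrow> 'a set \<Rightarrow> 'a set \<Rightarrow> bool" where
  "mincap G Z H K \<longleftrightarrow>
     K \<in> caps G H \<and> K \<noteq> Z \<and> (\<forall>L\<in>caps G H. L \<subseteq> K \<longrightarrow> L = Z \<or> L = K)"

lemma hellyD:
  assumes "helly G H" "C \<subseteq> translates G H" "\<forall>A\<in>C. \<forall>B\<in>C. A \<inter> B \<noteq> {}"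
  shows "\<exists>x\<in>carrier G. \<forall>A\<in>C. x \<in> A"
  using assms unfolding helly_def by blast

lemma translatesE:
  assumes "A \<in> translates G H"
  obtains a b where "a \<in> carrier G" "b \<in> carrier G" "A = (\<lambda>h. a \<otimes>\<^bsub>G\<^esub> h \<otimes>\<^bsub>G\<^esub> b) ` H"
  using assms by (auto simp: translates_def)

lemma translatesI:
  "a \<in> carrier G \<Longrightarrow> b \<in> carrier G \<Longrightarrow> (\<lambda>h. a \<otimes>\<^bsub>G\<^esub> h \<otimes>\<^bsub>G\<^esub> b) ` H \<in> translates G H"
  by (auto simp: translates_def)

section \<open>Translates, conjugates and intersections of conjugates\<close>

context group
begin

lemma inv_cancel_assoc:
  assumes "a \<in> carrier G" "x \<in> carrier G"
  shows "inv a \<otimes> (a \<otimes> x) = x" "a \<otimes> (inv a \<otimes> x) = x"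
  using assms by (simp_all add: m_assoc[symmetric])

lemmas group_norm = m_assoc inv_mult_group inv_cancel_assoc

lemma mem_translate:
  assumes "H \<subseteq> carrier G" "a \<in> carrier G" "b \<in> carrier G"
  shows "x \<in> (\<lambda>h. a \<otimes> h \<otimes> b) ` H \<longleftrightarrow> x \<in> carrier G \<and> inv a \<otimes> x \<otimes> inv b \<in> H"
proof
  assume "x \<in> (\<lambda>h. a \<otimes> h \<otimes> b) ` H"
  then obtain h where h: "h \<in> H" "x = a \<otimes> h \<otimes> b" by auto
  then have "h \<in> carrier G" using assms by auto
  then have "inv a \<otimes> x \<otimes> inv b = h" using h assms
    by (simp add: group_norm)
  then show "x \<in> carrier G \<and> inv a \<otimes> x \<otimes> inv b \<in> H" using h assms by auto
next
  assume r: "x \<in> carrier G \<and> inv a \<otimes> x \<otimes> inv b \<in> H"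
  have "x = a \<otimes> (inv a \<otimes> x \<otimes> inv b) \<otimes> b"
    using r assms by (simp add: group_norm)
  then show "x \<in> (\<lambda>h. a \<otimes> h \<otimes> b) ` H" using r by blast
qed

lemma mem_conjg:
  assumes "H \<subseteq> carrier G" "g \<in> carrier G"
  shows "x \<in> conjg G g H \<longleftrightarrow> x \<in> carrier G \<and> inv g \<otimes> x \<otimes> g \<in> H"
  using mem_translate[OF assms inv_closed[OF assms(2)], of x] assms by (simp add: conjg_def)

lemma conjg_translate: "g \<in> carrier G \<Longrightarrow> conjg G g H \<in> translates G H"
  unfolding conjg_def translates_def by blast

lemma translates_subset: "H \<subseteq> carrier G \<Longrightarrow> A \<in> translates G H \<Longrightarrow> A \<subseteq> carrier G"
  unfolding translates_def by auto

lemma left_translate: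
  assumes "H \<subseteq> carrier G" "A \<in> translates G H" "c \<in> carrier G"
  shows "(\<lambda>h. c \<otimes> h) ` A \<in> translates G H"
proof -
  obtain a b where ab: "A = (\<lambda>h. a \<otimes> h \<otimes> b) ` H" "a \<in> carrier G" "b \<in> carrier G"
    using assms(2) unfolding translates_def by auto
  have "(\<lambda>h. c \<otimes> h) ` A = (\<lambda>h. (c \<otimes> a) \<otimes> h \<otimes> b) ` H"
    unfolding ab(1) image_image using ab assms by (intro image_cong) (auto simp: m_assoc subsetD)
  then show ?thesis using ab(2,3) assms(3) unfolding translates_def by blast
qed

lemma translate_as_coset:
  assumes "H \<subseteq> carrier G" "A \<in> translates G H"
  shows "\<exists>c g. c \<in> carrier G \<and> g \<in> carrier G \<and> A = (\<lambda>h. c \<otimes> h) ` conjg G g H"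
proof -
  obtain a b where ab: "A = (\<lambda>h. a \<otimes> h \<otimes> b) ` H" "a \<in> carrier G" "b \<in> carrier G"
    using assms(2) unfolding translates_def by auto
  have "a \<otimes> h \<otimes> b = (a \<otimes> b) \<otimes> (inv b \<otimes> h \<otimes> inv (inv b))" if "h \<in> H" for h
    using that ab(2,3) assms(1) subsetD[OF assms(1) that]
    by (simp add: group_norm)
  then have "A = (\<lambda>h. (a \<otimes> b) \<otimes> h) ` conjg G (inv b) H"
    unfolding ab(1) conjg_def image_image by (intro image_cong) auto
  then show ?thesis using ab(2,3) by blast
qed

lemma subgroup_conjg:
  assumes "subgroup H G" "g \<in> carrier G"
  shows "subgroup (conjg G g H) G"
proof -
  have H: "H \<subseteq> carrier G" by (rule subgroup.subset[OF assms(1)])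
  note mem = mem_conjg[OF H assms(2)]
  show ?thesis
  proof (rule subgroupI)
    show "conjg G g H \<subseteq> carrier G" using mem by auto
    have "\<one> \<in> conjg G g H" unfolding mem using assms subgroup.one_closed by fastforce
    then show "conjg G g H \<noteq> {}" by blast
  next
    fix a assume "a \<in> conjg G g H"
    then have a: "a \<in> carrier G" "inv g \<otimes> a \<otimes> g \<in> H" unfolding mem by auto
    have "inv (inv g \<otimes> a \<otimes> g) = inv g \<otimes> inv a \<otimes> g"
      using a assms(2) by (simp add: group_norm)
    then show "inv a \<in> conjg G g H" unfolding mem
      using a subgroup.m_inv_closed[OF assms(1) a(2)] by simp
  next
    fix a b assume "a \<in> conjg G g H" "b \<in> conjg G g H"
    then have a: "a \<in> carrier G" "inv g \<otimes> a \<otimes> g \<in> H" and b: "b \<in> carrier G" "inv g \<otimes> b \<otimes> g \<in> H"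
      unfolding mem by auto
    have "(inv g \<otimes> a \<otimes> g) \<otimes> (inv g \<otimes> b \<otimes> g) = inv g \<otimes> (a \<otimes> b) \<otimes> g"
      using a b assms(2) by (simp add: group_norm)
    then show "a \<otimes> b \<in> conjg G g H" unfolding mem
      using a b subgroup.m_closed[OF assms(1) a(2) b(2)] by simp
  qed
qed

lemma conjg_mult:
  assumes "H \<subseteq> carrier G" "g \<in> carrier G" "h \<in> carrier G"
  shows "conjg G g (conjg G h H) = conjg G (g \<otimes> h) H"
  unfolding conjg_def image_image using assms
  by (intro image_cong) (auto simp: m_assoc inv_mult_group subsetD)

lemma conjg_one: "H \<subseteq> carrier G \<Longrightarrow> conjg G \<one> H = H"
  by (force simp: conjg_def)

lemma conjg_inv_cancel:
  assumes "H \<subseteq> carrier G" "g \<in> carrier G"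
  shows "conjg G (inv g) (conjg G g H) = H" "conjg G g (conjg G (inv g) H) = H"
  using assms by (simp_all add: conjg_mult conjg_one)

lemma inj_on_conj: "g \<in> carrier G \<Longrightarrow> inj_on (\<lambda>h. g \<otimes> h \<otimes> inv g) (carrier G)"
  by (rule inj_onI) auto

lemma card_conjg: "H \<subseteq> carrier G \<Longrightarrow> g \<in> carrier G \<Longrightarrow> card (conjg G g H) = card H"
  unfolding conjg_def by (intro card_image inj_on_subset[OF inj_on_conj])

lemma self_in_caps: "H \<subseteq> carrier G \<Longrightarrow> H \<in> caps G H"
  unfolding caps_def using conjg_one by (intro CollectI exI[of _ "{\<one>}"]) auto

lemma caps_subgroup:
  assumes "subgroup H G" "K \<in> caps G H"
  shows "subgroup K G"
proof -
  obtain S where S: "K = (\<Inter>g\<in>S. conjg G g H)" "S \<subseteq> carrier G" "S \<noteq> {}"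
    using assms(2) unfolding caps_def by auto
  show ?thesis unfolding S(1)
    by (rule subgroups_Inter) (use S assms subgroup_conjg in auto)
qed

lemma caps_Int:
  assumes "K \<in> caps G H" "L \<in> caps G H"
  shows "K \<inter> L \<in> caps G H"
proof -
  obtain S where S: "K = (\<Inter>g\<in>S. conjg G g H)" "S \<subseteq> carrier G" "S \<noteq> {}"
    using assms(1) unfolding caps_def by auto
  obtain T where T: "L = (\<Inter>g\<in>T. conjg G g H)" "T \<subseteq> carrier G" "T \<noteq> {}"
    using assms(2) unfolding caps_def by auto
  have "K \<inter> L = (\<Inter>g\<in>S \<union> T. conjg G g H)" using S T by auto
  then show ?thesis unfolding caps_def using S T by (intro CollectI exI[of _ "S \<union> T"]) auto
qed

lemma caps_conjg:
  assumes "H \<subseteq> carrier G" "K \<in> caps G H" "g \<in> carrier G"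
  shows "conjg G g K \<in> caps G H"
proof -
  obtain S where S: "K = (\<Inter>s\<in>S. conjg G s H)" "S \<subseteq> carrier G" "S \<noteq> {}"
    using assms(2) unfolding caps_def by auto
  have sub: "\<And>s. s \<in> S \<Longrightarrow> conjg G s H \<subseteq> carrier G"
    using S(2) mem_conjg[OF assms(1)] by blast
  obtain s0 where s0: "s0 \<in> S" using S(3) by auto
  have "conjg G g K = (\<Inter>s\<in>S. conjg G g (conjg G s H))"
    unfolding S(1) conjg_def[of G g]
    by (rule image_INT[OF inj_on_conj[OF assms(3)] _ s0]) (use sub in auto)
  also have "\<dots> = (\<Inter>s\<in>S. conjg G (g \<otimes> s) H)"
    using conjg_mult[OF assms(1,3)] S(2) by (intro INF_cong) auto
  also have "\<dots> = (\<Inter>s\<in>(\<otimes>) g ` S. conjg G s H)" by simp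
  finally show ?thesis unfolding caps_def using S(2,3) assms(3)
    by (intro CollectI exI[of _ "(\<otimes>) g ` S"]) auto
qed

lemma caps_translates:
  assumes "K \<in> caps G H"
  obtains F where "F \<subseteq> translates G H" "F \<noteq> {}" "K = \<Inter>F"
proof -
  obtain S where S: "K = (\<Inter>s\<in>S. conjg G s H)" "S \<subseteq> carrier G" "S \<noteq> {}"
    using assms unfolding caps_def by auto
  show ?thesis
    using S conjg_translate by (intro that[of "(\<lambda>g. conjg G g H) ` S"]) auto
qed

text \<open>The three sets \<open>L1\<close>, \<open>a L2\<close>, \<open>L3\<close> meet pairwise in \<open>a\<close>, \<open>a b\<close> and \<open>1\<close>; each is
  an intersection of translates, so the Helly property applies to all these translates at once.\<close>

lemma helly_triple:
  assumes "subgroup H G" "helly G H" and L: "L1 \<in> caps G H" "L2 \<in> caps G H" "L3 \<in> caps G H"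
    and ab: "a \<in> L1" "b \<in> L2" "a \<otimes> b \<in> L3"
  shows "\<exists>u. u \<in> L1 \<inter> L3 \<and> inv a \<otimes> u \<in> L2"
proof -
  have H: "H \<subseteq> carrier G" by (rule subgroup.subset[OF assms(1)])
  note sg = L[THEN caps_subgroup[OF assms(1)]]
  obtain F1 F2 F3 where F: "F1 \<subseteq> translates G H" "F1 \<noteq> {}" "L1 = \<Inter>F1"
      "F2 \<subseteq> translates G H" "F2 \<noteq> {}" "L2 = \<Inter>F2"
      "F3 \<subseteq> translates G H" "F3 \<noteq> {}" "L3 = \<Inter>F3"
    using L by (metis caps_translates)
  have ac: "a \<in> carrier G" and bc: "b \<in> carrier G"
    using ab sg by (meson subgroup.mem_carrier)+
  define F2' where "F2' = (\<lambda>A. (\<lambda>h. a \<otimes> h) ` A) ` F2"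
  have "F2' \<subseteq> translates G H" unfolding F2'_def using left_translate[OF H _ ac] F(4) by auto
  then have "F1 \<union> F2' \<union> F3 \<subseteq> translates G H" using F by auto
  moreover have "\<one> \<in> A \<and> a \<in> A" if "A \<in> F1" for A
    using that F(3) ab(1) sg(1) by (auto dest: subgroup.one_closed)
  moreover have "a \<in> A \<and> a \<otimes> b \<in> A" if A: "A \<in> F2'" for A
  proof -
    obtain A' where A': "A' \<in> F2" "A = (\<lambda>h. a \<otimes> h) ` A'" using A unfolding F2'_def by auto
    have "\<one> \<in> A'" "b \<in> A'" using A'(1) F(6) ab(2) sg(2) by (auto dest: subgroup.one_closed)
    then show ?thesis unfolding A'(2) using ac by (metis imageI r_one)
  qed
  moreover have "\<one> \<in> A \<and> a \<otimes> b \<in> A" if "A \<in> F3" for A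
    using that F(9) ab(3) sg(3) by (auto dest: subgroup.one_closed)
  ultimately have "F1 \<union> F2' \<union> F3 \<subseteq> translates G H"
      and "\<forall>A\<in>F1 \<union> F2' \<union> F3. \<forall>B\<in>F1 \<union> F2' \<union> F3. A \<inter> B \<noteq> {}"
    by blast+
  then have "\<exists>x\<in>carrier G. \<forall>A\<in>F1 \<union> F2' \<union> F3. x \<in> A"
    using assms(2) unfolding helly_def by blast
  then obtain u where u: "u \<in> carrier G" "\<forall>A\<in>F1 \<union> F2' \<union> F3. u \<in> A" by blast
  have "inv a \<otimes> u \<in> A" if "A \<in> F2" for A
  proof -
    have "u \<in> (\<lambda>h. a \<otimes> h) ` A" using u that unfolding F2'_def by auto
    then obtain h where h: "h \<in> A" "u = a \<otimes> h" by auto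
    have "h \<in> carrier G" using translates_subset[OF H] that F(4) h(1) by blast
    then show ?thesis using h ac by (simp add: group_norm)
  qed
  then show ?thesis using u(2) F by blast
qed

section \<open>Minimal intersections over a central subgroup\<close>

lemma caps_superset:
  assumes "H \<subseteq> carrier G" "Z \<subseteq> center G" "Z \<subseteq> H" "K \<in> caps G H"
  shows "Z \<subseteq> K"
proof -
  have "Z \<subseteq> conjg G g H" if "g \<in> carrier G" for g
  proof
    fix z assume z: "z \<in> Z"
    then have "z \<in> carrier G" "g \<otimes> z = z \<otimes> g" using assms(2) that by (auto simp: center_def)
    then have "inv g \<otimes> z \<otimes> g = z" using that by (metis inv_cancel_assoc(1) inv_closed m_assoc)
    then show "z \<in> conjg G g H" unfolding mem_conjg[OF assms(1) that]
      using z assms(3) \<open>z \<in> carrier G\<close> by auto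
  qed
  then show ?thesis using assms(4) unfolding caps_def by blast
qed

lemma conjg_central:
  assumes "Z \<subseteq> center G" "g \<in> carrier G"
  shows "conjg G g Z = Z"
proof -
  have "g \<otimes> z \<otimes> inv g = z" if "z \<in> Z" for z
  proof -
    have z: "z \<in> carrier G" "g \<otimes> z = z \<otimes> g" using that assms by (auto simp: center_def)
    then show ?thesis using assms(2) by (simp add: m_assoc)
  qed
  then show ?thesis unfolding conjg_def by (simp add: image_def)
qed

lemma mincap_conjg:
  assumes "H \<subseteq> carrier G" "Z \<subseteq> center G" "mincap G Z H K" "g \<in> carrier G" "K \<subseteq> carrier G"
  shows "mincap G Z H (conjg G g K)"
  unfolding mincap_def
proof (intro conjI ballI impI)
  have min: "K \<in> caps G H" "K \<noteq> Z" "\<And>L. L \<in> caps G H \<Longrightarrow> L \<subseteq> K \<Longrightarrow> L = Z \<or> L = K"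
    using assms(3) by (simp_all add: mincap_def)
  show "conjg G g K \<in> caps G H" by (rule caps_conjg[OF assms(1) min(1) assms(4)])
  show "conjg G g K \<noteq> Z"
  proof
    assume "conjg G g K = Z"
    then have "K = Z"
      using conjg_inv_cancel(1)[OF assms(5,4)] conjg_central[OF assms(2) inv_closed[OF assms(4)]]
      by metis
    then show False using min(2) by blast
  qed
  fix L assume L: "L \<in> caps G H" "L \<subseteq> conjg G g K"
  have Lc: "L \<subseteq> carrier G" using L(2) mem_conjg[OF assms(5,4)] by blast
  have "conjg G (inv g) L \<subseteq> conjg G (inv g) (conjg G g K)"
    unfolding conjg_def[of G "inv g"] by (rule image_mono[OF L(2)])
  then have "conjg G (inv g) L \<subseteq> K" unfolding conjg_inv_cancel(1)[OF assms(5,4)] .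
  then have "conjg G (inv g) L = Z \<or> conjg G (inv g) L = K"
    by (rule min(3)[OF caps_conjg[OF assms(1) L(1) inv_closed[OF assms(4)]]])
  then show "L = Z \<or> L = conjg G g K"
    using conjg_inv_cancel(2)[OF Lc assms(4)] conjg_central[OF assms(2,4)] by metis
qed

lemma mincap_exists:
  assumes "finite (carrier G)" "subgroup H G" "M \<in> caps G H" "M \<noteq> Z" "Z \<subseteq> center G" "Z \<subseteq> H"
  shows "\<exists>K\<subseteq>M. mincap G Z H K"
proof -
  define P where "P K \<longleftrightarrow> K \<in> caps G H \<and> K \<noteq> Z \<and> K \<subseteq> M" for K
  have "P M" using assms P_def by simp
  then obtain K where K: "P K" "\<And>L. P L \<Longrightarrow> card K \<le> card L"
    using ex_has_least_nat[of P M card] by auto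
  have "L = Z \<or> L = K" if L: "L \<in> caps G H" "L \<subseteq> K" for L
  proof (rule disjCI)
    assume "L \<noteq> K"
    moreover have "finite K" using K(1) assms caps_subgroup unfolding P_def
      by (meson finite_subset subgroup.subset)
    ultimately have "card L < card K" using L(2) psubset_card_mono by blast
    then show "L = Z" using K L unfolding P_def by (metis not_less order_trans)
  qed
  then show ?thesis using K(1) unfolding P_def mincap_def by blast
qed

lemma mincap_Int:
  assumes "mincap G Z H K" "mincap G Z H L"
  shows "K \<inter> L = Z \<or> K = L"
  using assms caps_Int[of K H L] unfolding mincap_def
  by (metis inf_le1 inf_le2)

text \<open>\<open>helly_triple\<close> gives u in L1 and L3 with a^-1 u in L2. If L1 = L3, then b =
  a^-1 (a b) lies in L1. Otherwise u lies in \<open>Z\<close>, hence a lies in L2, and L1 and L2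
  share an element outside \<open>Z\<close>, so they coincide.\<close>

lemma mincap_closed:
  assumes "subgroup H G" "helly G H" "Z \<subseteq> center G" "Z \<subseteq> H"
    and L: "mincap G Z H L1" "mincap G Z H L2" "mincap G Z H L3"
    and ab: "a \<in> L1" "a \<notin> Z" "b \<in> L2" "a \<otimes> b \<in> L3"
  shows "b \<in> L1"
proof -
  have caps: "L1 \<in> caps G H" "L2 \<in> caps G H" "L3 \<in> caps G H" using L by (auto simp: mincap_def)
  note sg = caps[THEN caps_subgroup[OF assms(1)]]
  have ac: "a \<in> carrier G" and bc: "b \<in> carrier G"
    using ab sg by (meson subgroup.mem_carrier)+
  obtain u where u: "u \<in> L1 \<inter> L3" "inv a \<otimes> u \<in> L2"
    using helly_triple[OF assms(1,2) caps ab(1,3,4)] by blast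
  show ?thesis
  proof (cases "L1 = L3")
    case True
    have "b = inv a \<otimes> (a \<otimes> b)" using ac bc by (simp add: group_norm)
    then show ?thesis using True ab(1,4) sg(1) by (metis subgroup.m_closed subgroup.m_inv_closed)
  next
    case False
    then have uZ: "u \<in> Z" using mincap_Int[OF L(1,3)] u(1) by blast
    then have uL: "u \<in> L2"
      using caps_superset[OF subgroup.subset[OF assms(1)] assms(3,4) caps(2)] by auto
    have uc: "u \<in> carrier G" using uL sg(2) by (meson subgroup.mem_carrier)
    have "inv a = (inv a \<otimes> u) \<otimes> inv u" using ac uc by (simp add: m_assoc)
    then have "inv a \<in> L2" using u(2) uL sg(2)
      by (metis subgroup.m_closed subgroup.m_inv_closed)
    then have "a \<in> L2" using ac sg(2) by (metis inv_inv subgroup.m_inv_closed)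
    then have "L1 = L2" using mincap_Int[OF L(1,2)] ab(1,2) by blast
    then show ?thesis using ab(3) by simp
  qed
qed

text \<open>Two distinct conjugates have trivial intersection here, so two members of a pairwise
  intersecting family that are cosets of distinct conjugates share a single point, and the
  hypothesis puts this point into every third member.\<close>

lemma hellyI:
  assumes H: "subgroup H G"
    and ab: "\<And>g1 g2 g3 a b. g1 \<in> carrier G \<Longrightarrow> g2 \<in> carrier G \<Longrightarrow> g3 \<in> carrier G
      \<Longrightarrow> conjg G g1 H \<noteq> conjg G g2 H \<Longrightarrow> a \<in> conjg G g1 H \<Longrightarrow> b \<in> conjg G g2 H
      \<Longrightarrow> a \<otimes> b \<in> conjg G g3 H \<Longrightarrow> a = \<one> \<or> b = \<one>"
  shows "helly G H"
  unfolding helly_def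
proof (intro allI impI)
  fix C assume C: "C \<subseteq> translates G H" and pw: "\<forall>A\<in>C. \<forall>B\<in>C. A \<inter> B \<noteq> {}"
  have Hc: "H \<subseteq> carrier G" by (rule subgroup.subset[OF H])
  note sg = subgroup_conjg[OF H]
  \<comment> \<open>Any point of a translate can be its coset representative. A common point x of
    two members therefore presents both as x times a conjugate of \<open>H\<close>.\<close>
  have coset: "\<exists>g\<in>carrier G. A = (\<lambda>h. x \<otimes> h) ` conjg G g H" if A: "A \<in> C" "x \<in> A" for A x
  proof -
    obtain c g where cg: "c \<in> carrier G" "g \<in> carrier G" "A = (\<lambda>h. c \<otimes> h) ` conjg G g H"
      using translate_as_coset[OF Hc] A(1) C by blast
    let ?L = "conjg G g H"
    obtain l where l: "l \<in> ?L" "x = c \<otimes> l" using A(2) cg(3) by blast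
    have lc: "l \<in> carrier G" by (rule subgroup.mem_carrier[OF sg[OF cg(2)] l(1)])
    have "c \<otimes> h \<in> (\<lambda>h. x \<otimes> h) ` ?L \<and> x \<otimes> h \<in> (\<lambda>h. c \<otimes> h) ` ?L" if h: "h \<in> ?L" for h
    proof -
      have hc: "h \<in> carrier G" by (rule subgroup.mem_carrier[OF sg[OF cg(2)] h])
      have "inv l \<otimes> h \<in> ?L" "l \<otimes> h \<in> ?L"
        using h l(1) sg[OF cg(2)] by (simp_all add: subgroup.m_closed subgroup.m_inv_closed)
      moreover have "c \<otimes> h = x \<otimes> (inv l \<otimes> h)" "x \<otimes> h = c \<otimes> (l \<otimes> h)"
        using l(2) lc hc cg(1) by (simp_all add: group_norm)
      ultimately show ?thesis by blast
    qed
    then have "A = (\<lambda>h. x \<otimes> h) ` ?L" using cg(3) by blast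
    then show ?thesis using cg(2) by blast
  qed
  have car: "x \<in> carrier G" if "x \<in> A" "A \<in> C" for x A
    using that C translates_subset[OF Hc] by blast
  show "\<exists>x\<in>carrier G. \<forall>A\<in>C. x \<in> A"
  proof (cases "\<exists>A\<in>C. \<exists>B\<in>C. A \<noteq> B")
    case False
    show ?thesis
    proof (cases "C = {}")
      case False
      then obtain A where A: "A \<in> C" by auto
      then obtain x where x: "x \<in> A" using pw by blast
      have "\<forall>B\<in>C. x \<in> B" using A x \<open>\<not> (\<exists>A\<in>C. \<exists>B\<in>C. A \<noteq> B)\<close> by blast
      then show ?thesis using car[OF x A] by blast
    qed auto
  next
    case True
    then obtain A B where AB: "A \<in> C" "B \<in> C" "A \<noteq> B" by auto
    then obtain x where x: "x \<in> A" "x \<in> B" using pw by blast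
    have xc: "x \<in> carrier G" by (rule car[OF x(1) AB(1)])
    obtain g1 where g1: "g1 \<in> carrier G" "A = (\<lambda>h. x \<otimes> h) ` conjg G g1 H"
      using coset[OF AB(1) x(1)] by blast
    obtain g2 where g2: "g2 \<in> carrier G" "B = (\<lambda>h. x \<otimes> h) ` conjg G g2 H"
      using coset[OF AB(2) x(2)] by blast
    have ne: "conjg G g1 H \<noteq> conjg G g2 H" using AB(3) g1(2) g2(2) by metis
    have "x \<in> D" if D: "D \<in> C" for D
    proof -
      obtain y where y: "y \<in> A" "y \<in> D" using pw AB D by blast
      obtain z where z: "z \<in> B" "z \<in> D" using pw AB D by blast
      obtain l1 where l1: "l1 \<in> conjg G g1 H" "y = x \<otimes> l1" using y(1) g1(2) by blast
      obtain l2 where l2: "l2 \<in> conjg G g2 H" "z = x \<otimes> l2" using z(1) g2(2) by blast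
      obtain g3 where g3: "g3 \<in> carrier G" "D = (\<lambda>h. y \<otimes> h) ` conjg G g3 H"
        using coset[OF D y(2)] by blast
      obtain l3 where l3: "l3 \<in> conjg G g3 H" "z = y \<otimes> l3" using z(2) g3(2) by blast
      have c: "l1 \<in> carrier G" "l2 \<in> carrier G" "l3 \<in> carrier G"
        using subgroup.mem_carrier[OF sg] l1(1) l2(1) l3(1) g1(1) g2(1) g3(1) by blast+
      have "x \<otimes> l2 = x \<otimes> (l1 \<otimes> l3)" using l1(2) l2(2) l3(2) c xc by (simp add: m_assoc)
      then have "l2 = l1 \<otimes> l3" using c xc by simp
      then have "inv l1 \<otimes> l2 = l3" using c by (simp add: group_norm)
      moreover have "inv l1 \<in> conjg G g1 H"
        by (rule subgroup.m_inv_closed[OF sg[OF g1(1)] l1(1)])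
      ultimately have "inv l1 = \<one> \<or> l2 = \<one>"
        using ab[OF g1(1) g2(1) g3(1) ne _ l2(1)] l3(1) by metis
      then show "x \<in> D"
      proof
        assume "inv l1 = \<one>"
        then have "l1 = \<one>" using c by (metis inv_inv inv_one)
        then show ?thesis using y(2) l1(2) xc by simp
      next
        assume "l2 = \<one>"
        then show ?thesis using z(2) l2(2) xc by simp
      qed
    qed
    then show ?thesis using xc by blast
  qed
qed

section \<open>Tuples of cosets as families of translates\<close>

lemma rcos_moved_iff:
  assumes "subgroup H G" "x \<in> carrier G" "y \<in> carrier G" "g \<in> carrier G"
  shows "(H #> x) #> g = H #> y \<longleftrightarrow> g \<in> (\<lambda>h. inv x \<otimes> h \<otimes> y) ` H"
proof -
  have H: "H \<subseteq> carrier G" by (rule subgroup.subset[OF assms(1)])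
  have "(H #> x) #> g = H #> (x \<otimes> g)" using assms H by (simp add: coset_mult_assoc)
  moreover have "H #> (x \<otimes> g) = H #> y \<longleftrightarrow> x \<otimes> g \<in> H #> y"
    using repr_independence[OF _ assms(3,1), of "x \<otimes> g"] rcos_self[OF _ assms(1), of "x \<otimes> g"] assms
    by auto
  ultimately have "(H #> x) #> g = H #> y \<longleftrightarrow> x \<otimes> g \<in> H #> y" by simp
  also have "\<dots> \<longleftrightarrow> x \<otimes> g \<otimes> inv y \<in> H"
    using assms subgroup.rcos_module[OF assms(1) is_group] by simp
  also have "\<dots> \<longleftrightarrow> g \<in> (\<lambda>h. inv x \<otimes> h \<otimes> y) ` H"
    using assms by (simp add: mem_translate[OF H])
  finally show ?thesis .
qed

lemma binary_iff_pairs: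
  assumes "finite \<Omega>"
  shows "binary_action G \<Omega> act \<longleftrightarrow>
    (\<forall>n\<ge>2. \<forall>I\<in>tuples \<Omega> n. \<forall>J\<in>tuples \<Omega> n. r_related G act 2 I J \<longrightarrow> r_related G act n I J)"
proof -
  let ?Q = "\<lambda>k::nat. k \<ge> 2 \<and>
    (\<forall>n\<ge>k. \<forall>I\<in>tuples \<Omega> n. \<forall>J\<in>tuples \<Omega> n. r_related G act k I J \<longrightarrow> r_related G act n I J)"
  have "?Q (Least ?Q)"
    by (rule LeastI_ex[OF relational_complexity_exists[OF assms]])
  moreover have "Least ?Q = 2" if "?Q 2" using that by (intro Least_equality) blast+
  ultimately show ?thesis unfolding binary_action_def relational_complexity_def
    by (smt (verit, best) order_refl)
qed

lemma r_related_2D: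
  assumes "r_related G act 2 I J" "i < length I" "j < length I" "2 \<le> length I"
  shows "\<exists>g\<in>carrier G. act (I ! i) g = J ! i \<and> act (I ! j) g = J ! j"
proof -
  \<comment> \<open>The indices may coincide, whereas \<open>r_related\<close> only speaks about
    sets of exactly two indices; hence the enlargement to \<open>K\<close>.\<close>
  have "card {i, j} \<le> 2" by (simp add: card_insert_if)
  then obtain K where K: "{i, j} \<subseteq> K" "K \<subseteq> {..<length I}" "card K = 2"
    using exists_subset_between[of "{i, j}" 2 "{..<length I}"] assms(2-4) by auto
  obtain g where "g \<in> carrier G" "\<forall>k\<in>K. act (I ! k) g = J ! k"
    using r_relatedD[OF assms(1) K(2,3)] by blast
  then show ?thesis using K(1) by blast
qed

lemma binary_iff_helly:
  assumes fin: "finite (carrier G)" and H: "subgroup H G"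
  shows "binary_action G (rcosets H) (\<lambda>C g. C #> g) \<longleftrightarrow> helly G H"
proof -
  let ?act = "\<lambda>C g. C #> g"
  have Hc: "H \<subseteq> carrier G" by (rule subgroup.subset[OF H])
  have finO: "finite (rcosets H)" using fin by (simp add: RCOSETS_def)
  show ?thesis unfolding binary_iff_pairs[OF finO]
  proof
    assume bin: "\<forall>n\<ge>2. \<forall>I\<in>tuples (rcosets H) n. \<forall>J\<in>tuples (rcosets H) n.
      r_related G ?act 2 I J \<longrightarrow> r_related G ?act n I J"
    show "helly G H" unfolding helly_def
    proof (intro allI impI)
      fix C assume C: "C \<subseteq> translates G H" and pw: "\<forall>A\<in>C. \<forall>B\<in>C. A \<inter> B \<noteq> {}"
      have car: "x \<in> carrier G" if "x \<in> A" "A \<in> C" for x A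
        using that C translates_subset[OF Hc] by blast
      show "\<exists>x\<in>carrier G. \<forall>A\<in>C. x \<in> A"
      proof (cases "C = {}")
        case False
        then obtain A0 where A0: "A0 \<in> C" by auto
        have "C \<subseteq> Pow (carrier G)" using car by blast
        then have "finite C" using fin finite_subset by blast
        then obtain cs0 where cs0: "set cs0 = C" using finite_list by blast
        \<comment> \<open>A member is repeated so that the tuple has length at least 2 even when the
          family is a singleton.\<close>
        define cs where "cs = A0 # A0 # cs0"
        have cs: "set cs = C" "length cs \<ge> 2" using cs0 A0 by (auto simp: cs_def)
        have "\<exists>a b. a \<in> carrier G \<and> b \<in> carrier G \<and> A = (\<lambda>h. inv a \<otimes> h \<otimes> b) ` H"
          if A: "A \<in> C" for A
        proof -
          obtain a b where "a \<in> carrier G" "b \<in> carrier G" "A = (\<lambda>h. a \<otimes> h \<otimes> b) ` H"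
            by (rule translatesE[OF subsetD[OF C A]])
          then show ?thesis by (intro exI[of _ "inv a"] exI[of _ b]) simp
        qed
        then obtain a b where ab: "\<And>A. A \<in> C \<Longrightarrow> a A \<in> carrier G"
            "\<And>A. A \<in> C \<Longrightarrow> b A \<in> carrier G"
            "\<And>A. A \<in> C \<Longrightarrow> A = (\<lambda>h. inv (a A) \<otimes> h \<otimes> b A) ` H" by metis
        define I J where "I = map (\<lambda>A. H #> a A) cs" and "J = map (\<lambda>A. H #> b A) cs"
        have "H #> a A \<in> rcosets H" "H #> b A \<in> rcosets H" if "A \<in> C" for A
          using ab(1,2)[OF that] unfolding RCOSETS_def by blast+
        then have tup: "I \<in> tuples (rcosets H) (length cs)" "J \<in> tuples (rcosets H) (length cs)"
          using cs(1) unfolding I_def J_def tuples_def by auto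
        have mv: "I ! k #> g = J ! k \<longleftrightarrow> g \<in> cs ! k"
          if "k < length cs" "g \<in> carrier G" for k g
        proof -
          have k: "cs ! k \<in> C" using that(1) cs(1) by auto
          have IJ: "I ! k = H #> a (cs ! k)" "J ! k = H #> b (cs ! k)"
            using that(1) by (simp_all add: I_def J_def)
          show ?thesis unfolding IJ rcos_moved_iff[OF H ab(1,2)[OF k] that(2)]
            using ab(3)[OF k] by metis
        qed
        have rel: "r_related G ?act 2 I J" unfolding r_related_def
        proof (intro allI impI)
          fix ks assume ks: "sorted_wrt (<) ks \<and> length ks = 2 \<and> set ks \<subseteq> {..<length I}"
          then obtain i j where ij: "ks = [i, j]" by (auto simp: length_Suc_conv numeral_2_eq_2)
          then have ijl: "i < length cs" "j < length cs" using ks by (simp_all add: I_def)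
          then have C2: "cs ! i \<in> C" "cs ! j \<in> C" using cs(1) nth_mem by blast+
          then obtain g where g: "g \<in> cs ! i" "g \<in> cs ! j" using pw by blast
          have gc: "g \<in> carrier G" by (rule car[OF g(1) C2(1)])
          have "I ! i #> g = J ! i" "I ! j #> g = J ! j"
            by (rule mv[OF ijl(1) gc, THEN iffD2, OF g(1)] mv[OF ijl(2) gc, THEN iffD2, OF g(2)])+
          then show "\<exists>g\<in>carrier G. \<forall>k\<in>set ks. I ! k #> g = J ! k"
            using gc unfolding ij by auto
        qed
        have len: "length I = length cs" "length J = length cs" by (simp_all add: I_def J_def)
        have "r_related G ?act (length cs) I J" using bin cs(2) tup rel by blast
        then obtain g where g: "g \<in> carrier G" "map (\<lambda>x. x #> g) I = J"
          unfolding r_related_full[OF len] by blast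
        have "g \<in> A" if A: "A \<in> C" for A
        proof -
          obtain k where k: "k < length cs" "A = cs ! k" using A cs(1) by (metis in_set_conv_nth)
          have "I ! k #> g = J ! k" unfolding g(2)[symmetric] using k(1) len(1) by simp
          then have "g \<in> cs ! k" by (rule mv[OF k(1) g(1), THEN iffD1])
          then show ?thesis using k(2) by simp
        qed
        then show ?thesis using g(1) by blast
      qed auto
    qed
  next
    assume hel: "helly G H"
    show "\<forall>n\<ge>2. \<forall>I\<in>tuples (rcosets H) n. \<forall>J\<in>tuples (rcosets H) n.
      r_related G ?act 2 I J \<longrightarrow> r_related G ?act n I J"
    proof (intro allI impI ballI)
      fix n I J assume n: "2 \<le> (n::nat)" and I: "I \<in> tuples (rcosets H) n"
        and J: "J \<in> tuples (rcosets H) n" and rel: "r_related G ?act 2 I J"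
      have len: "length I = n" "length J = n" using I J by (auto simp: tuples_def)
      have "\<exists>x y. x \<in> carrier G \<and> y \<in> carrier G \<and> I ! k = H #> x \<and> J ! k = H #> y" if "k < n" for k
      proof -
        have "I ! k \<in> set I" "J ! k \<in> set J" using that len by simp_all
        then have "I ! k \<in> rcosets H" "J ! k \<in> rcosets H"
          using I J unfolding tuples_def by blast+
        then show ?thesis unfolding RCOSETS_def by blast
      qed
      then obtain x y where xy: "\<And>k. k < n \<Longrightarrow> x k \<in> carrier G"
          "\<And>k. k < n \<Longrightarrow> y k \<in> carrier G"
          "\<And>k. k < n \<Longrightarrow> I ! k = H #> x k" "\<And>k. k < n \<Longrightarrow> J ! k = H #> y k" by metis
      define A where "A k = (\<lambda>h. inv (x k) \<otimes> h \<otimes> y k) ` H" for k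
      have mv: "I ! k #> g = J ! k \<longleftrightarrow> g \<in> A k" if "k < n" "g \<in> carrier G" for k g
        unfolding A_def xy(3,4)[OF that(1)] by (rule rcos_moved_iff[OF H xy(1,2)[OF that(1)] that(2)])
      have sub: "A ` {..<n} \<subseteq> translates G H"
      proof (rule image_subsetI)
        fix k assume "k \<in> {..<n}"
        then have "inv (x k) \<in> carrier G" "y k \<in> carrier G" using xy(1,2) by simp_all
        then show "A k \<in> translates G H" unfolding A_def by (rule translatesI)
      qed
      have "A i \<inter> A j \<noteq> {}" if ij: "i < n" "j < n" for i j
      proof -
        have l: "i < length I" "j < length I" "2 \<le> length I" using ij n len by simp_all
        have "\<exists>g\<in>carrier G. I ! i #> g = J ! i \<and> I ! j #> g = J ! j"
          by (rule r_related_2D[OF rel l])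
        then show ?thesis
        proof (elim bexE conjE)
          fix g assume g: "g \<in> carrier G" "I ! i #> g = J ! i" "I ! j #> g = J ! j"
          show ?thesis using mv[OF ij(1) g(1), THEN iffD1, OF g(2)] mv[OF ij(2) g(1), THEN iffD1, OF g(3)]
            by blast
        qed
      qed
      then have "\<forall>B\<in>A ` {..<n}. \<forall>B'\<in>A ` {..<n}. B \<inter> B' \<noteq> {}" by blast
      from hellyD[OF hel sub this]
      obtain g where g: "g \<in> carrier G" "\<forall>B\<in>A ` {..<n}. g \<in> B" by (rule bexE)
      have "map (\<lambda>C. C #> g) I = J"
      proof (rule nth_equalityI)
        fix k assume "k < length (map (\<lambda>C. C #> g) I)"
        then have k: "k < n" using len by simp
        then have "g \<in> A k" using g(2) by simp
        then have "I ! k #> g = J ! k" by (rule mv[OF k g(1), THEN iffD2])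
        then show "map (\<lambda>C. C #> g) I ! k = J ! k" using k len by simp
      qed (simp add: len)
      then show "r_related G ?act n I J" unfolding r_related_full[OF len] using g(1) by blast
    qed
  qed
qed

end

text \<open>Since \<open>f\<close> is onto, the translates of the full preimage are exactly the
  preimages of the translates of \<open>H'\<close>, and taking preimages neither creates nor
  destroys common points of subsets of the image.\<close>

lemma helly_hom_iff:
  assumes "group G" "group G'" "f \<in> hom G G'" "f ` carrier G = carrier G'" "H' \<subseteq> carrier G'"
  shows "helly G {g \<in> carrier G. f g \<in> H'} \<longleftrightarrow> helly G' H'"
proof -
  interpret G: group G by fact
  interpret G': group G' by fact
  interpret f: group_hom G G' f using assms by unfold_locales
  let ?H = "{g \<in> carrier G. f g \<in> H'}"
  let ?p = "\<lambda>A. {g \<in> carrier G. f g \<in> A}"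
  have sur: "\<exists>x\<in>carrier G. y = f x" if y: "y \<in> carrier G'" for y
    using y unfolding assms(4)[symmetric] by (elim imageE) (rule bexI)
  have pre: "(\<lambda>h. a \<otimes>\<^bsub>G\<^esub> h \<otimes>\<^bsub>G\<^esub> b) ` ?H = ?p ((\<lambda>h. f a \<otimes>\<^bsub>G'\<^esub> h \<otimes>\<^bsub>G'\<^esub> f b) ` H')"
    if "a \<in> carrier G" "b \<in> carrier G" for a b
  proof (rule Set.set_eqI)
    fix x
    have "x \<in> (\<lambda>h. a \<otimes>\<^bsub>G\<^esub> h \<otimes>\<^bsub>G\<^esub> b) ` ?H \<longleftrightarrow>
        x \<in> carrier G \<and> inv\<^bsub>G\<^esub> a \<otimes>\<^bsub>G\<^esub> x \<otimes>\<^bsub>G\<^esub> inv\<^bsub>G\<^esub> b \<in> ?H"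
      by (rule G.mem_translate) (use that in auto)
    moreover have "y \<in> (\<lambda>h. f a \<otimes>\<^bsub>G'\<^esub> h \<otimes>\<^bsub>G'\<^esub> f b) ` H' \<longleftrightarrow>
        y \<in> carrier G' \<and> inv\<^bsub>G'\<^esub> f a \<otimes>\<^bsub>G'\<^esub> y \<otimes>\<^bsub>G'\<^esub> inv\<^bsub>G'\<^esub> f b \<in> H'" for y
      by (rule G'.mem_translate) (use that assms(5) in auto)
    ultimately show "x \<in> (\<lambda>h. a \<otimes>\<^bsub>G\<^esub> h \<otimes>\<^bsub>G\<^esub> b) ` ?H \<longleftrightarrow>
        x \<in> ?p ((\<lambda>h. f a \<otimes>\<^bsub>G'\<^esub> h \<otimes>\<^bsub>G'\<^esub> f b) ` H')"
      using that by auto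
  qed
  have T: "translates G ?H = ?p ` translates G' H'"
  proof (intro equalityI subsetI)
    fix A assume "A \<in> translates G ?H"
    then obtain a b where ab: "a \<in> carrier G" "b \<in> carrier G" "A = (\<lambda>h. a \<otimes>\<^bsub>G\<^esub> h \<otimes>\<^bsub>G\<^esub> b) ` ?H"
      by (rule translatesE)
    show "A \<in> ?p ` translates G' H'"
      unfolding ab(3) pre[OF ab(1,2)] by (intro imageI translatesI f.hom_closed ab)
  next
    fix A assume "A \<in> ?p ` translates G' H'"
    then obtain B where B: "B \<in> translates G' H'" "A = ?p B" by (rule imageE)
    obtain a' b' where "a' \<in> carrier G'" "b' \<in> carrier G'"
        and B': "B = (\<lambda>h. a' \<otimes>\<^bsub>G'\<^esub> h \<otimes>\<^bsub>G'\<^esub> b') ` H'"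
      by (rule translatesE[OF B(1)])
    then obtain a b where ab: "a \<in> carrier G" "b \<in> carrier G" "a' = f a" "b' = f b"
      using sur by metis
    show "A \<in> translates G ?H"
      unfolding B(2) B' ab(3,4) pre[OF ab(1,2), symmetric] by (rule translatesI[OF ab(1,2)])
  qed
  have ne: "?p A \<inter> ?p B \<noteq> {} \<longleftrightarrow> A \<inter> B \<noteq> {}" if "A \<in> translates G' H'" for A B
  proof -
    have sub: "A \<subseteq> carrier G'" by (rule G'.translates_subset[OF assms(5) that])
    show ?thesis
    proof
      assume "A \<inter> B \<noteq> {}"
      then obtain y where y: "y \<in> A" "y \<in> B" by blast
      then obtain x where "x \<in> carrier G" "y = f x" using sur[OF subsetD[OF sub y(1)]] by metis
      then show "?p A \<inter> ?p B \<noteq> {}" using y by blast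
    qed blast
  qed
  show ?thesis
  proof
    assume h: "helly G ?H"
    show "helly G' H'" unfolding helly_def
    proof (intro allI impI)
      fix C assume C: "C \<subseteq> translates G' H'" "\<forall>A\<in>C. \<forall>B\<in>C. A \<inter> B \<noteq> {}"
      have "?p ` C \<subseteq> translates G ?H" unfolding T by (rule image_mono[OF C(1)])
      moreover have "\<forall>A\<in>?p ` C. \<forall>B\<in>?p ` C. A \<inter> B \<noteq> {}"
      proof (intro ballI; elim imageE)
        fix A B A' B' assume "A = ?p A'" "A' \<in> C" "B = ?p B'" "B' \<in> C"
        then show "A \<inter> B \<noteq> {}" using ne[of A' B'] C by blast
      qed
      ultimately have "\<exists>x\<in>carrier G. \<forall>A\<in>?p ` C. x \<in> A" by (rule hellyD[OF h])
      then obtain x where x: "x \<in> carrier G" "\<forall>A\<in>?p ` C. x \<in> A" by (rule bexE)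
      have "\<forall>A\<in>C. f x \<in> A" using x(2) by simp
      then show "\<exists>x\<in>carrier G'. \<forall>A\<in>C. x \<in> A" using f.hom_closed[OF x(1)] by (rule bexI)
    qed
  next
    assume h: "helly G' H'"
    show "helly G ?H" unfolding helly_def T
    proof (intro allI impI)
      fix C assume C: "C \<subseteq> ?p ` translates G' H'" "\<forall>A\<in>C. \<forall>B\<in>C. A \<inter> B \<noteq> {}"
      from C(1) obtain D where D: "D \<subseteq> translates G' H'" "C = ?p ` D"
        unfolding subset_image_iff by blast
      have "\<forall>A\<in>D. \<forall>B\<in>D. A \<inter> B \<noteq> {}"
      proof (intro ballI)
        fix A B assume AB: "A \<in> D" "B \<in> D"
        then have "?p A \<inter> ?p B \<noteq> {}" using C(2) unfolding D(2) by blast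
        then show "A \<inter> B \<noteq> {}" by blast
      qed
      from hellyD[OF h D(1) this] obtain y where y: "y \<in> carrier G'" "\<forall>A\<in>D. y \<in> A" by (rule bexE)
      obtain x where x: "x \<in> carrier G" "y = f x" using sur[OF y(1)] by metis
      have "\<forall>A\<in>C. x \<in> A" unfolding D(2) using x y(2) by simp
      then show "\<exists>x\<in>carrier G. \<forall>A\<in>C. x \<in> A" using x(1) by (rule bexI)
    qed
  qed
qed

section \<open>Finite fields\<close>

text \<open>Squaring is at most two-to-one on nonzero elements in any characteristic, and 0
  contributes one more square.\<close>

lemma card_squares:
  "CARD('k) + 1 \<le> 2 * card (range (\<lambda>x::'k::{field,finite}. x^2))"
proof -
  let ?N = "UNIV - {0::'k}" and ?f = "\<lambda>x::'k. x^2"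
  have "card ?N = (\<Sum>y\<in>?f ` ?N. card {x\<in>?N. ?f x = y})"
    using sum.image_gen[of ?N "\<lambda>_. 1::nat" ?f] by simp
  also have "\<dots> \<le> (\<Sum>y\<in>?f ` ?N. 2)"
  proof (rule sum_mono)
    fix y assume "y \<in> ?f ` ?N"
    then obtain z where z: "y = z^2" by auto
    have "{x\<in>?N. ?f x = y} \<subseteq> {z, - z}" using z by (auto simp: power2_eq_iff)
    then have "card {x\<in>?N. ?f x = y} \<le> card {z, - z}" by (intro card_mono) auto
    then show "card {x\<in>?N. ?f x = y} \<le> 2" by (simp add: card_insert_if split: if_splits)
  qed
  finally have "card ?N \<le> 2 * card (?f ` ?N)" by simp
  moreover have "card (range ?f) = Suc (card (?f ` ?N))"
  proof -
    have "range ?f = insert 0 (?f ` ?N)" by (force simp: image_iff)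
    then show ?thesis by (subst \<open>range ?f = _\<close>) (auto simp: card_insert_if)
  qed
  moreover have "card ?N = CARD('k) - 1" by simp
  ultimately show ?thesis by linarith
qed

text \<open>Pigeonhole: the values x^2 and the values m + D y^2 each fill more than half of the
  field.\<close>

lemma two_squares_solvable:
  fixes D m :: "'k::{field,finite}"
  assumes "D \<noteq> 0"
  shows "\<exists>x y. x^2 - D * y^2 = m"
proof -
  let ?S = "range (\<lambda>x::'k. x^2)"
  have "inj_on (\<lambda>s. m + D * s) ?S" using assms by (auto simp: inj_on_def)
  then have "card ((\<lambda>s. m + D * s) ` ?S) = card ?S" by (rule card_image)
  then have "CARD('k) < card ?S + card ((\<lambda>s. m + D * s) ` ?S)"
    using card_squares[where 'k = 'k] by linarith
  moreover have "card ?S + card ((\<lambda>s. m + D * s) ` ?S) = card (?S \<union> (\<lambda>s. m + D * s) ` ?S)"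
    if "?S \<inter> (\<lambda>s. m + D * s) ` ?S = {}"
    using that by (intro card_Un_disjoint[symmetric]) auto
  moreover have "card (?S \<union> (\<lambda>s. m + D * s) ` ?S) \<le> CARD('k)" by (intro card_mono) auto
  ultimately have "?S \<inter> (\<lambda>s. m + D * s) ` ?S \<noteq> {}" by linarith
  then obtain x y where "x^2 = m + D * y^2" by blast
  then show ?thesis by (intro exI[of _ x] exI[of _ y]) simp
qed

lemma char2_sqrt:
  assumes "(2::'k::{field,finite}) = 0"
  shows "\<exists>y::'k. x = y^2"
proof -
  have "inj (\<lambda>y::'k. y^2)"
  proof (rule injI)
    fix x y :: 'k assume "x^2 = y^2"
    then have "x = y \<or> x = - y" by (simp add: power2_eq_iff)
    moreover have "- y = y" using assms by (simp add: minus_equation_iff neg_eq_iff_add_eq_0 flip: mult_2)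
    ultimately show "x = y" by auto
  qed
  then have "surj (\<lambda>y::'k. y^2)" by (rule finite_UNIV_inj_surj[OF finite])
  then show ?thesis by (rule surjD)
qed

text \<open>A nondegenerate binary form over a finite field represents everything. In odd
  characteristic completing the square reduces this to \<open>two_squares_solvable\<close>; in
  characteristic two the term in x^2 alone already takes every value.\<close>

lemma binary_quadratic_solvable:
  fixes \<alpha> \<gamma> \<beta> m :: "'k::{field,finite}"
  assumes "\<gamma>^2 \<noteq> 4 * \<alpha> * \<beta>"
  shows "\<exists>x y. \<alpha> * x^2 + \<gamma> * x * y + \<beta> * y^2 = m"
proof (cases "\<alpha> = 0")
  case True
  then have "\<gamma> \<noteq> 0" using assms by auto
  then show ?thesis using True by (intro exI[of _ "(m - \<beta>) / \<gamma>"] exI[of _ 1]) simp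
next
  case \<alpha>: False
  show ?thesis
  proof (cases "(2::'k) = 0")
    case True
    obtain x where "m / \<alpha> = x^2" using char2_sqrt[OF True] by blast
    then have "\<alpha> * x^2 = m" using \<alpha> by (simp add: field_simps)
    then show ?thesis by (intro exI[of _ x] exI[of _ 0]) simp
  next
    case False
    have four: "(4::'k) \<noteq> 0"
    proof -
      have "(4::'k) = 2 * 2" by simp
      then show ?thesis using False by (metis mult_eq_0_iff)
    qed
    have "\<gamma>^2 - 4 * \<alpha> * \<beta> \<noteq> 0" using assms by simp
    from two_squares_solvable[OF this, of "4 * \<alpha> * m"]
    obtain p y where p: "p^2 - (\<gamma>^2 - 4 * \<alpha> * \<beta>) * y^2 = 4 * \<alpha> * m" by blast
    define x where "x = (p - \<gamma> * y) / (2 * \<alpha>)"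
    have "p = 2 * \<alpha> * x + \<gamma> * y" using False \<alpha> by (simp add: x_def)
    then have "4 * \<alpha> * (\<alpha> * x^2 + \<gamma> * x * y + \<beta> * y^2) = 4 * \<alpha> * m"
      using p by Groebner_Basis.algebra
    then show ?thesis using four \<alpha> by auto
  qed
qed

text \<open>Adding 1 permutes the field, so the sum of all x + 1 equals the sum of all x.\<close>

lemma of_nat_CARD: "of_nat CARD('k) = (0::'k::{field,finite})"
proof -
  have "(\<Sum>x\<in>UNIV. x + 1) = (\<Sum>x\<in>UNIV. x::'k)"
    by (rule sum.reindex_bij_witness[of _ "\<lambda>x. x - 1" "\<lambda>x. x + 1"]) auto
  then show ?thesis by (simp add: sum.distrib)
qed

lemma char2_if_even_card:
  assumes "CARD('k::{field,finite}) = 2 ^ a"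
  shows "(2::'k) = 0"
proof -
  have "(2::'k) ^ a = 0" using of_nat_CARD[where 'k = 'k] assms by simp
  then show ?thesis by simp
qed

lemma not_char2_if_odd_card:
  assumes "odd CARD('k::{field,finite})"
  shows "(2::'k) \<noteq> 0"
proof
  assume two: "(2::'k) = 0"
  obtain n where "CARD('k) = 2 * n + 1" using assms by (rule oddE)
  then show False using of_nat_CARD[where 'k = 'k] two by simp
qed

lemma fermat_finite_field:
  fixes x :: "'k::{field,finite}"
  assumes "x \<noteq> 0"
  shows "x ^ (CARD('k) - 1) = 1"
proof -
  have "(\<Prod>y\<in>UNIV-{0}. x * y) = (\<Prod>y\<in>UNIV-{0::'k}. y)"
    by (rule prod.reindex_bij_witness[of _ "\<lambda>y. y / x" "\<lambda>y. x * y"]) (use assms in auto)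
  moreover have "(\<Prod>y\<in>UNIV-{0}. x * y) = x ^ (CARD('k) - 1) * (\<Prod>y\<in>UNIV-{0::'k}. y)"
    by (simp add: prod.distrib)
  moreover have "(\<Prod>y\<in>UNIV-{0::'k}. y) \<noteq> 0" by (simp add: prod_zero_iff)
  ultimately show ?thesis by (metis mult_cancel_right1)
qed

lemma ex_not_in:
  fixes S :: "'k::finite set"
  assumes "card S < CARD('k)"
  shows "\<exists>x. x \<notin> S"
  using assms by (metis UNIV_eq_I less_irrefl)

section \<open>Points on a conic\<close>

definition conic :: "'k::field \<Rightarrow> 'k \<Rightarrow> ('k \<times> 'k) set" where
  "conic t m = {(x, z). x^2 + t * x * z + z^2 = m}"

text \<open>Lines through a given point meet the conic in one further point, unless their direction
  is isotropic.\<close>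

lemma card_conic:
  fixes t m :: "'k::{field,finite}"
  assumes t: "t^2 \<noteq> 4" and m: "m \<noteq> 0"
  shows "CARD('k) + 1 \<le> card (conic t m) + card {v. v^2 + t * v + 1 = 0}"
proof -
  obtain p s where ps: "p^2 + t * p * s + s^2 = m"
    using binary_quadratic_solvable[of t 1 1 m] t by auto
  \<comment> \<open>(a, b) is the gradient of the form at the base point (p, s). It is nonzero
    because the form is nondegenerate and m is not 0.\<close>
  define a b where "a = 2 * p + t * s" and "b = t * p + 2 * s"
  have ab: "\<not> (a = 0 \<and> b = 0)"
  proof
    assume "a = 0 \<and> b = 0"
    then have "(t^2 - 4) * p = 0" "(t^2 - 4) * s = 0" unfolding a_def b_def by Groebner_Basis.algebra+
    then have "p = 0" "s = 0" using t by auto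
    then show False using ps m by simp
  qed
  let ?R = "{v. v^2 + t * v + 1 = 0}"
  \<comment> \<open>The line through (p, s) in direction (1, v) meets the conic again at parameter
    \<open>l v\<close>. \<open>None\<close> stands for the direction (0, 1). The tangent direction
    has parameter 0 and returns the base point, which no other direction does.\<close>
  define l where "l v = - (a + v * b) / (v^2 + t * v + 1)" for v
  define f where "f v = (case v of None \<Rightarrow> (p, s - b) | Some v \<Rightarrow> (p + l v, s + l v * v))" for v
  let ?D = "insert None (Some ` (- ?R))"
  have "f v \<in> conic t m" if "v \<in> ?D" for v
  proof (cases v)
    case None
    have "p^2 + t * p * (s - b) + (s - b)^2 = m" unfolding b_def ps[symmetric] by Groebner_Basis.algebra
    then show ?thesis by (simp add: None f_def conic_def)
  next
    case (Some w)
    then have w: "w^2 + t * w + 1 \<noteq> 0" using that by auto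
    then have "l w * (w^2 + t * w + 1) + (a + w * b) = 0" by (simp add: l_def)
    then have "(p + l w)^2 + t * (p + l w) * (s + l w * w) + (s + l w * w)^2 = m"
      unfolding a_def b_def ps[symmetric] by Groebner_Basis.algebra
    then show ?thesis by (simp add: Some f_def conic_def)
  qed
  then have "f ` ?D \<subseteq> conic t m" by blast
  moreover have "inj_on f ?D"
  proof (rule inj_onI)
    fix v w assume v: "v \<in> ?D" and w: "w \<in> ?D" and eq: "f v = f w"
    have l0: "a + v * b = 0" if "l v = 0" "v^2 + t * v + 1 \<noteq> 0" for v
      using that unfolding l_def by (metis divide_eq_0_iff neg_equal_0_iff_equal)
    show "v = w"
    proof (cases v; cases w)
      fix v' w' assume vw: "v = Some v'" "w = Some w'"
      then have l: "l v' = l w'" "l v' * v' = l w' * w'" using eq by (auto simp: f_def)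
      show ?thesis
      proof (cases "l v' = 0")
        case True
        then have "a + v' * b = 0" "a + w' * b = 0" using l0 l v w vw by auto
        then have "(v' - w') * b = 0" "a + v' * b = 0" by Groebner_Basis.algebra+
        then show ?thesis using ab vw by auto
      qed (use l vw in auto)
    next
      fix w' assume vw: "v = None" "w = Some w'"
      then have "l w' = 0" "b = 0" using eq by (auto simp: f_def)
      then show ?thesis using l0[of w'] w vw ab by auto
    next
      fix v' assume vw: "v = Some v'" "w = None"
      then have "l v' = 0" "b = 0" using eq by (auto simp: f_def)
      then show ?thesis using l0[of v'] v vw ab by auto
    qed simp
  qed
  ultimately have "card ?D \<le> card (conic t m)" 
    using card_image[of f ?D] card_mono[OF finite, of "f ` ?D" "conic t m"] by simp
  moreover have "card ?D = Suc (card (- ?R))"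
    by (simp add: card_image)
  moreover have "card (- ?R) + card ?R = CARD('k)"
    using card_Un_disjoint[of "- ?R" ?R] by (simp add: Compl_partition2)
  ultimately show ?thesis by linarith
qed

lemma card_quadratic_roots: "card {v::'k::{field,finite}. v^2 + t * v + 1 = 0} \<le> 2"
proof (cases "\<exists>v::'k. v^2 + t * v + 1 = 0")
  case True
  then obtain r :: 'k where r: "r^2 + t * r + 1 = 0" by blast
  have "{v. v^2 + t * v + 1 = 0} \<subseteq> {r, - t - r}"
  proof
    fix v assume "v \<in> {v. v^2 + t * v + 1 = 0}"
    then have "(v - r) * (v - (- t - r)) = 0" using r by simp (Groebner_Basis.algebra)
    then show "v \<in> {r, - t - r}" by simp
  qed
  then have "card {v. v^2 + t * v + 1 = 0} \<le> card {r, - t - r}" by (intro card_mono) auto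
  also have "\<dots> \<le> 2" by (simp add: card_insert_if)
  finally show ?thesis .
qed simp

text \<open>The Gram determinant of two vectors is t^2 - 4 times the square of their cross product,
  up to sign. Two points of the conic with isotropic difference have polar product
  \<open>2 * m\<close>, so this determinant vanishes and one is r times the other; then (1 - r)^2 m
  = 0.\<close>

lemma conic_isotropic_difference:
  fixes t m :: "'k::field"
  assumes t: "t^2 \<noteq> 4" and m: "m \<noteq> 0"
    and u: "p^2 + t * p * s + s^2 = m" and u': "p'^2 + t * p' * s' + s'^2 = m"
    and d: "(p - p')^2 + t * (p - p') * (s - s') + (s - s')^2 = 0"
  shows "p = p' \<and> s = s'"
proof -
  let ?h = "2 * p * p' + t * (p * s' + p' * s) + 2 * s * s'"
  have "?h = (p^2 + t * p * s + s^2) + (p'^2 + t * p' * s' + s'^2)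
      - ((p - p')^2 + t * (p - p') * (s - s') + (s - s')^2)" by Groebner_Basis.algebra
  then have h: "?h = 2 * m" unfolding u u' d by simp
  have "(t^2 - 4) * (p * s' - p' * s)^2 =
      ?h^2 - 4 * (p^2 + t * p * s + s^2) * (p'^2 + t * p' * s' + s'^2)" by Groebner_Basis.algebra
  then have "(t^2 - 4) * (p * s' - p' * s)^2 = 0" unfolding h u u' by (simp add: power2_eq_square)
  then have cross: "p * s' = p' * s" using t by simp
  define r where "r = (p * p' + t * s * p' + s * s') / m"
  have "m * p' = p * (p * p' + t * s * p' + s * s')" "m * s' = s * (p * p' + t * s * p' + s * s')"
    unfolding u[symmetric] using cross by Groebner_Basis.algebra+
  then have p': "p' = r * p" and s': "s' = r * s" using m by (auto simp: r_def field_simps)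
  have "(1 - r)^2 * (p^2 + t * p * s + s^2) = 0" using d unfolding p' s' by Groebner_Basis.algebra
  then have "(1 - r)^2 * m = 0" unfolding u .
  then have "r = 1" using m by simp
  then show ?thesis using p' s' by simp
qed

section \<open>Two-by-two matrices\<close>

definition m2 :: "'k \<Rightarrow> 'k \<Rightarrow> 'k \<Rightarrow> 'k \<Rightarrow> 'k::zero ^ 2 ^ 2" where
  "m2 a b c d = vector [vector [a, b], vector [c, d]]"

lemma m2_nth [simp]:
  "m2 a b c d $ 1 $ 1 = a" "m2 a b c d $ 1 $ 2 = b" "m2 a b c d $ 2 $ 1 = c" "m2 a b c d $ 2 $ 2 = d"
  by (simp_all add: m2_def)

lemma m2_eq_iff [simp]: "m2 a b c d = m2 a' b' c' d' \<longleftrightarrow> a = a' \<and> b = b' \<and> c = c' \<and> d = d'"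
  by (metis m2_nth)

lemma m2_exhaust: obtains a b c d where "A = m2 a b c d"
proof
  show "A = m2 (A $ 1 $ 1) (A $ 1 $ 2) (A $ 2 $ 1) (A $ 2 $ 2)"
    by (simp add: vec_eq_iff forall_2)
qed

lemma m2_mult [simp]:
  "m2 a b c d ** m2 a' b' c' d' =
     m2 (a * a' + b * c') (a * b' + b * d') (c * a' + d * c') (c * b' + d * (d'::'k::comm_ring_1))"
  by (simp add: vec_eq_iff forall_2 matrix_matrix_mult_def sum_2)

lemma det_m2 [simp]: "det (m2 a b c d) = a * d - b * (c::'k::comm_ring_1)"
  by (simp add: det_2)

lemma trace_m2 [simp]: "trace (m2 a b c d) = a + (d::'k::comm_ring_1)"
  by (simp add: trace_def sum_2)

lemma mat_1_m2: "mat 1 = m2 1 0 0 (1::'k::comm_ring_1)"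
  by (simp add: vec_eq_iff forall_2 mat_def)

definition upper :: "'k::field \<Rightarrow> 'k ^ 2 ^ 2" where "upper s = m2 1 s 0 1"

definition companion :: "'k::field \<Rightarrow> 'k ^ 2 ^ 2" where "companion t = m2 0 (-1) 1 t"

section \<open>The group \<open>SL\<^sub>2\<close>\<close>

interpretation SL2: group "SL2 :: ('k::field ^ 2 ^ 2) monoid"
  by (rule group_SL2)

lemma carrier_SL2: "A \<in> carrier SL2 \<longleftrightarrow> det A = 1" by (simp add: SL2_def)

lemma m2_carrier: "m2 a b c d \<in> carrier SL2 \<longleftrightarrow> a * d - b * c = 1" by (simp add: carrier_SL2)

lemma mult_SL2 [simp]: "A \<otimes>\<^bsub>SL2\<^esub> B = A ** B" by (simp add: SL2_def)

lemma one_SL2: "\<one>\<^bsub>SL2\<^esub> = m2 1 0 0 1" by (simp add: SL2_def mat_1_m2)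

lemma m2_exhaust_SL2:
  assumes "A \<in> carrier SL2"
  obtains a b c d where "A = m2 a b c d" "a * d - b * c = 1"
  using assms m2_exhaust[of A] by (metis m2_carrier)

lemma inv_SL2:
  assumes "a * d - b * c = (1::'k::field)"
  shows "inv\<^bsub>SL2\<^esub> (m2 a b c d) = m2 d (-b) (-c) a"
proof -
  have "m2 d (-b) (-c) a \<otimes>\<^bsub>SL2\<^esub> m2 a b c d = \<one>\<^bsub>SL2\<^esub>"
    using assms by (simp add: one_SL2) (simp add: algebra_simps)
  then show ?thesis using assms by (intro SL2.inv_equality) (auto simp: m2_carrier algebra_simps)
qed

lemma upper_carrier [simp]: "upper s \<in> carrier SL2" by (simp add: upper_def m2_carrier)

lemma companion_carrier [simp]: "companion t \<in> carrier SL2" by (simp add: companion_def m2_carrier)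

lemma trace_upper [simp]: "trace (upper s) = 2" by (simp add: upper_def)

lemma trace_companion [simp]: "trace (companion t) = t" by (simp add: companion_def)

definition sl2_conj :: "'k::field ^ 2 ^ 2 \<Rightarrow> 'k ^ 2 ^ 2 \<Rightarrow> bool" where
  "sl2_conj A B \<longleftrightarrow> (\<exists>g\<in>carrier SL2. A ** g = g ** B)"

lemma sl2_conj_iff:
  assumes "A \<in> carrier SL2" "B \<in> carrier SL2"
  shows "sl2_conj A B \<longleftrightarrow> (\<exists>g\<in>carrier SL2. A = g \<otimes>\<^bsub>SL2\<^esub> B \<otimes>\<^bsub>SL2\<^esub> inv\<^bsub>SL2\<^esub> g)"
proof -
  have "A \<otimes>\<^bsub>SL2\<^esub> g = g \<otimes>\<^bsub>SL2\<^esub> B \<longleftrightarrow> A = g \<otimes>\<^bsub>SL2\<^esub> B \<otimes>\<^bsub>SL2\<^esub> inv\<^bsub>SL2\<^esub> g"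
    if "g \<in> carrier SL2" for g
    using that assms SL2.inv_solve_right[of A "g \<otimes>\<^bsub>SL2\<^esub> B" g] SL2.m_closed[of g B] by auto
  then show ?thesis unfolding sl2_conj_def by simp
qed

lemma sl2_conj_sym:
  assumes "A \<in> carrier SL2" "B \<in> carrier SL2" "sl2_conj A B"
  shows "sl2_conj B A"
proof -
  obtain g where g: "g \<in> carrier SL2" "A = g \<otimes>\<^bsub>SL2\<^esub> B \<otimes>\<^bsub>SL2\<^esub> inv\<^bsub>SL2\<^esub> g"
    using assms sl2_conj_iff by blast
  have "B = inv\<^bsub>SL2\<^esub> g \<otimes>\<^bsub>SL2\<^esub> A \<otimes>\<^bsub>SL2\<^esub> inv\<^bsub>SL2\<^esub> (inv\<^bsub>SL2\<^esub> g)"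
    unfolding g(2) using g(1) assms(2) by (simp add: SL2.group_norm del: mult_SL2)
  then show ?thesis using sl2_conj_iff[OF assms(2,1)] g(1) by (metis SL2.inv_closed)
qed

lemma sl2_conj_trans:
  assumes "sl2_conj A B" "sl2_conj B C"
  shows "sl2_conj A C"
proof -
  obtain g h where "g \<in> carrier SL2" "A ** g = g ** B" "h \<in> carrier SL2" "B ** h = h ** C"
    using assms unfolding sl2_conj_def by blast
  then have "g ** h \<in> carrier SL2" "A ** (g ** h) = (g ** h) ** C"
    using SL2.m_closed[of g h] by (simp, metis matrix_mul_assoc)
  then show ?thesis unfolding sl2_conj_def by blast
qed

lemma sl2_conj_conjg:
  assumes "A \<in> carrier SL2" "K \<subseteq> carrier SL2" "sl2_conj A B" "B \<in> K"
  shows "\<exists>g\<in>carrier SL2. A \<in> conjg SL2 g K"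
  using assms sl2_conj_iff[of A B] unfolding conjg_def by blast

lemma trace_conj:
  assumes "g \<in> carrier SL2" "A \<in> carrier SL2"
  shows "trace (g \<otimes>\<^bsub>SL2\<^esub> A \<otimes>\<^bsub>SL2\<^esub> inv\<^bsub>SL2\<^esub> g) = trace A"
proof -
  have "trace (g \<otimes>\<^bsub>SL2\<^esub> A \<otimes>\<^bsub>SL2\<^esub> inv\<^bsub>SL2\<^esub> g) = trace (inv\<^bsub>SL2\<^esub> g \<otimes>\<^bsub>SL2\<^esub> (g \<otimes>\<^bsub>SL2\<^esub> A))"
    unfolding mult_SL2 by (rule trace_mul_sym)
  also have "inv\<^bsub>SL2\<^esub> g \<otimes>\<^bsub>SL2\<^esub> (g \<otimes>\<^bsub>SL2\<^esub> A) = A" by (rule SL2.inv_cancel_assoc(1)[OF assms])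
  finally show ?thesis .
qed

text \<open>The columns of the conjugating matrix are v = (x, y) and A v. Its determinant is a
  quadratic form in v of discriminant (tr A)^2 - 4, so it takes the value 1, and Cayley-Hamilton
  puts \<open>A\<close> into companion form.\<close>

lemma conj_companion:
  fixes A :: "'k::{field,finite} ^ 2 ^ 2"
  assumes "A \<in> carrier SL2" "(trace A)^2 \<noteq> 4"
  shows "sl2_conj A (companion (trace A))"
proof -
  obtain a b c d where A: "A = m2 a b c d" "a * d - b * c = 1" by (rule m2_exhaust_SL2[OF assms(1)])
  have "(d - a)^2 - 4 * c * (- b) = (a + d)^2 - 4 * (a * d - b * c)" by Groebner_Basis.algebra
  also have "\<dots> = (trace A)^2 - 4" using A by simp
  finally have "(d - a)^2 \<noteq> 4 * c * (- b)" using assms(2) by (metis eq_iff_diff_eq_0)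
  then obtain x y where xy: "c * x^2 + (d - a) * x * y + (- b) * y^2 = 1"
    using binary_quadratic_solvable[of "d - a" c "- b" 1] by blast
  let ?g = "m2 x (a * x + b * y) y (c * x + d * y)"
  have "x * (c * x + d * y) - (a * x + b * y) * y = c * x^2 + (d - a) * x * y + (- b) * y^2"
    by Groebner_Basis.algebra
  then have "?g \<in> carrier SL2" unfolding xy by (simp add: m2_carrier)
  moreover have "A ** ?g = ?g ** companion (trace A)"
  proof -
    have "a * (a * x + b * y) + b * (c * x + d * y) = (a * x + b * y) * (a + d) - (a * d - b * c) * x"
      by Groebner_Basis.algebra
    moreover have "c * (a * x + b * y) + d * (c * x + d * y) = (c * x + d * y) * (a + d) - (a * d - b * c) * y"
      by Groebner_Basis.algebra
    ultimately show ?thesis unfolding A(2) by (simp add: A(1) companion_def)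
  qed
  ultimately show ?thesis unfolding sl2_conj_def by blast
qed

lemma same_trace_conj:
  fixes A :: "'k::{field,finite} ^ 2 ^ 2"
  assumes "A \<in> carrier SL2" "B \<in> carrier SL2" "trace A = trace B" "(trace A)^2 \<noteq> 4"
  shows "sl2_conj A B"
proof (rule sl2_conj_trans)
  show "sl2_conj A (companion (trace A))" by (rule conj_companion) (use assms in auto)
  show "sl2_conj (companion (trace A)) B"
    using conj_companion[of B] sl2_conj_sym[of B "companion (trace B)"] assms by simp
qed

text \<open>Trace 2 means (A - 1)^2 = 0. Unless \<open>A\<close> is already upper triangular, its
  fixed vector (A - 1) e1 = (a - 1, c) is the first column of the conjugating matrix.\<close>

lemma conj_upper:
  assumes "A \<in> carrier SL2" "trace A = 2" "A \<noteq> \<one>\<^bsub>SL2\<^esub>"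
  shows "\<exists>s. s \<noteq> 0 \<and> sl2_conj A (upper s)"
proof -
  obtain a b c d where A: "A = m2 a b c d" "a * d - b * c = 1" by (rule m2_exhaust_SL2[OF assms(1)])
  have d: "d = 2 - a" using assms(2) A(1) by (simp add: algebra_simps)
  have a1: "(a - 1)^2 = - b * c" using A(2) unfolding d by Groebner_Basis.algebra
  show ?thesis
  proof (cases "c = 0")
    case True
    then have "a = 1" using a1 by simp
    then have "A = upper b" using A d True by (simp add: upper_def)
    moreover from this have "b \<noteq> 0" using assms(3) by (auto simp: upper_def one_SL2)
    moreover have "A ** \<one>\<^bsub>SL2\<^esub> = \<one>\<^bsub>SL2\<^esub> ** A" by (simp add: one_SL2 A(1))
    ultimately show ?thesis unfolding sl2_conj_def by (metis SL2.one_closed)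
  next
    case False
    let ?g = "m2 (a - 1) (- 1 / c) c 0"
    have "?g \<in> carrier SL2" using False by (simp add: m2_carrier)
    moreover have "A ** ?g = ?g ** upper (- 1 / c)"
    proof -
      have "a * (a - 1) + b * c = a - 1" using a1 by Groebner_Basis.algebra
      moreover have "c * (a - 1) + d * c = c" unfolding d by (simp add: algebra_simps)
      moreover have "- (a / c) = - ((a - 1) / c) - 1 / c" by (simp add: diff_divide_distrib)
      ultimately show ?thesis using False by (simp add: A(1) upper_def)
    qed
    ultimately show ?thesis unfolding sl2_conj_def using False
      by (intro exI[of _ "- 1 / c"]) auto
  qed
qed

text \<open>Row and column operations by \<open>upper\<close> matrices clear the diagonal of the
  given element. The resulting antidiagonal matrix conjugates upper into lower unipotents, and the
  two kinds together generate SL2.\<close>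

lemma subgroup_with_uppers:
  fixes S :: "('k::field ^ 2 ^ 2) set"
  assumes S: "subgroup S SL2" and up: "\<And>s. upper s \<in> S" and g: "m2 a b c d \<in> S" "c \<noteq> 0"
  shows "S = carrier SL2"
proof
  show "S \<subseteq> carrier SL2" by (rule subgroup.subset[OF S])
  have mult: "A ** B \<in> S" if "A \<in> S" "B \<in> S" for A B
    using subgroup.m_closed[OF S that] by simp
  have dt: "a * d - b * c = 1" using subgroup.mem_carrier[OF S g(1)] by (simp add: m2_carrier)
  have "upper (- a / c) ** m2 a b c d ** upper (- d / c) \<in> S" by (intro mult up g)
  moreover have "upper (- a / c) ** m2 a b c d ** upper (- d / c) = m2 0 (- 1 / c) c 0"
    using g(2) dt by (simp add: upper_def field_simps)
  ultimately have w: "m2 0 (- 1 / c) c 0 \<in> S" by simp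
  have low: "m2 1 0 r 1 \<in> S" for r
  proof -
    have "inv\<^bsub>SL2\<^esub> (m2 0 (- 1 / c) c 0) \<in> S" by (rule subgroup.m_inv_closed[OF S w])
    then have "m2 0 (1 / c) (- c) 0 \<in> S" using g(2) by (simp add: inv_SL2)
    then have "m2 0 (- 1 / c) c 0 ** upper (- r / c^2) ** m2 0 (1 / c) (- c) 0 \<in> S"
      by (intro mult w up)
    then show ?thesis using g(2) by (simp add: upper_def power2_eq_square)
  qed
  have nz: "m2 x y z w \<in> S" if "z \<noteq> 0" "x * w - y * z = 1" for x y z w
  proof -
    have "upper ((x - 1) / z) ** m2 1 0 z 1 ** upper ((w - 1) / z) \<in> S" by (intro mult up low)
    moreover have "upper ((x - 1) / z) ** m2 1 0 z 1 ** upper ((w - 1) / z) = m2 x y z w"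
      using that by (simp add: upper_def field_simps)
    ultimately show ?thesis by simp
  qed
  show "carrier SL2 \<subseteq> S"
  proof
    fix A :: "'k ^ 2 ^ 2" assume "A \<in> carrier SL2"
    then obtain x y z w where A: "A = m2 x y z w" "x * w - y * z = 1" by (rule m2_exhaust_SL2)
    show "A \<in> S"
    proof (cases "z = 0")
      case True
      then have "x \<noteq> 0" using A(2) by auto
      then have "m2 x y x (y + w) \<in> S" using A(2) True by (intro nz) (auto simp: algebra_simps)
      then have "m2 1 0 (- 1) 1 ** m2 x y x (y + w) \<in> S" by (intro mult low)
      then show ?thesis using A True by simp
    qed (use nz A in auto)
  qed
qed

text \<open>Once both traces are prescribed, two entries of \<open>B\<close> remain free and det B =
  1 is a conic in them. Its centre is (\<open>x0\<close>, \<open>z0\<close>) and its quadratic part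
  has discriminant t^2 - 4, so it has a point.\<close>

lemma exists_traces:
  fixes t s r :: "'k::{field,finite}"
  assumes t: "t^2 \<noteq> 4"
  shows "\<exists>B\<in>carrier SL2. trace B = s \<and> trace (companion t ** B) = r"
proof -
  define D where "D = 4 - t^2"
  have D: "D \<noteq> 0" using t by (simp add: D_def)
  define x0 where "x0 = (2 * s + t * (r - t * s)) / D"
  define z0 where "z0 = (- 2 * (r - t * s) - t * s) / D"
  have Dx: "D * x0 = 2 * s + t * (r - t * s)" and Dz: "D * z0 = - 2 * (r - t * s) - t * s"
    using D by (simp_all add: x0_def z0_def)
  have x0: "2 * x0 + t * z0 = s"
  proof -
    have "D * (2 * x0 + t * z0) = 2 * (D * x0) + t * (D * z0)" by (simp add: algebra_simps)
    also have "\<dots> = D * s" unfolding Dx Dz unfolding D_def by Groebner_Basis.algebra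
    finally show ?thesis using D by simp
  qed
  have z0: "t * x0 + 2 * z0 = - (r - t * s)"
  proof -
    have "D * (t * x0 + 2 * z0) = t * (D * x0) + 2 * (D * z0)" by (simp add: algebra_simps)
    also have "\<dots> = D * (- (r - t * s))" unfolding Dx Dz unfolding D_def by Groebner_Basis.algebra
    finally show ?thesis using D by simp
  qed
  define m where "m = x0^2 + t * x0 * z0 + z0^2 - s * x0 + (r - t * s) * z0 + 1"
  obtain p q where pq: "p^2 + t * p * q + q^2 = - m"
    using binary_quadratic_solvable[of t 1 1 "- m"] t by auto
  define x where "x = p + x0"
  define z where "z = q + z0"
  let ?B = "m2 x (r + z - t * (s - x)) z (s - x)"
  have "x * (s - x) - (r + z - t * (s - x)) * z = 1"
  proof -
    have "x * (s - x) - (r + z - t * (s - x)) * z - 1 =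
       - (p^2 + t * p * q + q^2) - p * (2 * x0 + t * z0 - s) - q * (t * x0 + 2 * z0 + (r - t * s))
       - m"
      unfolding x_def z_def m_def by Groebner_Basis.algebra
    also have "\<dots> = 0" unfolding pq x0 z0 by simp
    finally show ?thesis by simp
  qed
  then have "?B \<in> carrier SL2" by (simp add: m2_carrier)
  moreover have "trace ?B = s" "trace (companion t ** ?B) = r" by (simp_all add: companion_def)
  ultimately show ?thesis by blast
qed

text \<open>An element whose trace is neither \<open>2\<close> nor \<open>-2\<close> is a quotient of two elements of
  any prescribed trace of the same kind.\<close>

lemma normal_subgroup_SL2:
  fixes N :: "('k::{field,finite} ^ 2 ^ 2) set"
  assumes q: "CARD('k) \<ge> 4" and N: "subgroup N SL2"
    and nrm: "\<And>g. g \<in> carrier SL2 \<Longrightarrow> conjg SL2 g N \<subseteq> N"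
    and A: "A \<in> N" "(trace A)^2 \<noteq> 4"
  shows "N = carrier SL2"
proof -
  note Nc = subgroup.subset[OF N]
  have mem: "B \<in> N" if "B \<in> carrier SL2" "sl2_conj B C" "C \<in> N" for B C
    using sl2_conj_conjg[OF that(1) Nc that(2,3)] nrm by blast
  have quot: "D \<in> N" if "D \<in> carrier SL2" "C \<in> N" "D ** C \<in> N" for C D
  proof -
    have C: "C \<in> carrier SL2" using that(2) Nc by blast
    have "(D \<otimes>\<^bsub>SL2\<^esub> C) \<otimes>\<^bsub>SL2\<^esub> inv\<^bsub>SL2\<^esub> C \<in> N"
      using subgroup.m_closed[OF N _ subgroup.m_inv_closed[OF N that(2)], of "D \<otimes>\<^bsub>SL2\<^esub> C"] that(3)
      by simp
    then show ?thesis using that(1) C by (simp add: SL2.m_assoc del: mult_SL2)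
  qed
  have tr: "B \<in> N" if "B \<in> carrier SL2" "trace B = trace A" for B
    by (rule mem[OF that(1) same_trace_conj A(1)]) (use that A Nc in auto)
  have ss: "D \<in> N" if D: "D \<in> carrier SL2" "(trace D)^2 \<noteq> 4" for D
  proof -
    obtain B where B: "B \<in> carrier SL2" "trace B = trace A" "trace (companion (trace D) ** B) = trace A"
      using exists_traces[OF D(2)] by blast
    have "companion (trace D) ** B \<in> carrier SL2" using SL2.m_closed[OF companion_carrier B(1)] by simp
    then have "companion (trace D) \<in> N" using quot[OF companion_carrier] tr B by blast
    then show ?thesis using mem[OF D(1) conj_companion[OF D]] by blast
  qed
  have up: "upper s \<in> N" for s
  proof (cases "s = 0")
    case True
    then show ?thesis using subgroup.one_closed[OF N] by (simp add: upper_def one_SL2)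
  next
    case False
    let ?t = "trace A"
    \<comment> \<open>A trace r other than 2 and -2 is chosen so that \<open>upper s\<close> becomes
      the quotient of an element of trace r by one of trace \<open>?t\<close>; r must differ from
      \<open>?t\<close> for the entry z to be nonzero.\<close>
    have "card {?t, 2, -2} < CARD('k)" using q card_length[of "[?t, 2, -2]"] by simp
    then obtain r where r: "r \<notin> {?t, 2, -2}" using ex_not_in by blast
    have r4: "r^2 \<noteq> 4"
    proof
      assume "r^2 = 4"
      then have "(r - 2) * (r + 2) = 0" by (simp add: algebra_simps power2_eq_square)
      then show False using r by (auto simp: eq_neg_iff_add_eq_0)
    qed
    define z where "z = (r - ?t) / s"
    have z: "z \<noteq> 0" "s * z = r - ?t" using r False by (auto simp: z_def)
    let ?C = "m2 0 (- 1 / z) z ?t"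
    have C: "?C \<in> carrier SL2" using z by (simp add: m2_carrier)
    have "?C \<in> N" using tr[OF C] by simp
    moreover have "upper s ** ?C \<in> carrier SL2" using SL2.m_closed[OF upper_carrier C] by simp
    moreover have "trace (upper s ** ?C) = r" using z(2) by (simp add: upper_def)
    ultimately show ?thesis using quot[OF upper_carrier] ss r4 by blast
  qed
  have "companion (trace A) \<in> N" using ss[OF companion_carrier] A(2) by simp
  then show ?thesis using subgroup_with_uppers[OF N up, of 0 "-1" 1 "trace A"] by (simp add: companion_def)
qed

section \<open>Order and centre of SL2\<close>

lemma card_SL2: "card (carrier (SL2 :: ('k::{field,finite} ^ 2 ^ 2) monoid)) = CARD('k) * (CARD('k)^2 - 1)"
proof -
  let ?q = "CARD('k)"
  let ?N = "UNIV - {0::'k}"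
  let ?f = "\<lambda>(a, c, d). m2 a ((a * d - 1) / c) c (d::'k)"
  let ?g = "\<lambda>(a, b). m2 a b 0 (1 / a::'k)"
  have "carrier SL2 = ?f ` (UNIV \<times> ?N \<times> UNIV) \<union> ?g ` (?N \<times> UNIV)"
  proof (intro equalityI subsetI)
    fix A :: "'k ^ 2 ^ 2" assume "A \<in> carrier SL2"
    then obtain a b c d where A: "A = m2 a b c d" "a * d - b * c = 1" by (rule m2_exhaust_SL2)
    show "A \<in> ?f ` (UNIV \<times> ?N \<times> UNIV) \<union> ?g ` (?N \<times> UNIV)"
    proof (cases "c = 0")
      case True
      then have ad: "a * d = 1" using A(2) by simp
      then have "a \<noteq> 0" by auto
      then have "d = 1 / a" using ad by (simp add: eq_divide_eq mult.commute)
      then have "A = ?g (a, b)" using A(1) True by simp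
      then show ?thesis using \<open>a \<noteq> 0\<close> by blast
    next
      case False
      then have "b = (a * d - 1) / c" using A(2) by (simp add: field_simps)
      then have "A = ?f (a, c, d)" using A(1) by simp
      then show ?thesis using False by blast
    qed
  qed (auto simp: m2_carrier split: if_splits)
  moreover have "?f ` (UNIV \<times> ?N \<times> UNIV) \<inter> ?g ` (?N \<times> UNIV) = {}" by auto
  moreover have "card (?f ` (UNIV \<times> ?N \<times> UNIV)) = ?q * ((?q - 1) * ?q)"
    by (subst card_image) (auto simp: inj_on_def card_cartesian_product)
  moreover have "card (?g ` (?N \<times> UNIV)) = (?q - 1) * ?q"
    by (subst card_image) (auto simp: inj_on_def card_cartesian_product)
  ultimately have "card (carrier (SL2 :: ('k ^ 2 ^ 2) monoid)) = ?q * ((?q - 1) * ?q) + (?q - 1) * ?q"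
    by (simp add: card_Un_disjoint)
  also have "\<dots> = ?q * (?q^2 - 1)"
    by (cases ?q) (simp_all add: power2_eq_square algebra_simps)
  finally show ?thesis .
qed

lemma center_SL2: "center (SL2 :: ('k::field ^ 2 ^ 2) monoid) = {m2 1 0 0 1, m2 (-1) 0 0 (-1)}"
proof (intro equalityI subsetI)
  fix A :: "'k ^ 2 ^ 2" assume A: "A \<in> center SL2"
  then have Ac: "A \<in> carrier SL2" by (simp add: center_def)
  then obtain a b c d where abcd: "A = m2 a b c d" "a * d - b * c = 1" by (rule m2_exhaust_SL2)
  have com: "g ** A = A ** g" if "g \<in> carrier SL2" for g using A that by (simp add: center_def)
  have "m2 1 1 0 1 ** A = A ** m2 1 1 0 1" "m2 1 0 1 1 ** A = A ** m2 1 0 1 1"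
    by (rule com, simp add: m2_carrier)+
  then have "c = 0" "b = 0" "a = d" using abcd(1) by auto
  then have "a * a = 1" using abcd(2) by simp
  then have "a = 1 \<or> a = - 1" by (simp add: square_eq_1_iff)
  then show "A \<in> {m2 1 0 0 1, m2 (-1) 0 0 (-1)}" using abcd \<open>c = 0\<close> \<open>b = 0\<close> \<open>a = d\<close> by auto
next
  fix A :: "'k ^ 2 ^ 2" assume A: "A \<in> {m2 1 0 0 1, m2 (-1) 0 0 (-1)}"
  then have "A \<in> carrier SL2" by (auto simp: m2_carrier)
  moreover have "g ** A = A ** g" for g
    using A by (cases rule: m2_exhaust[of g]) auto
  ultimately show "A \<in> center SL2" by (simp add: center_def)
qed

text \<open>The general matrix B for which B and \<open>companion t ** B\<close> both have trace k
  (t + 2), in coordinates centred so that det B = 1 has no linear terms and says that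
  \<open>u\<close> lies on \<open>conic t (k^2 * (t + 2) - 1)\<close>.\<close>

definition conic_matrix :: "'k::field \<Rightarrow> 'k \<Rightarrow> 'k \<times> 'k \<Rightarrow> 'k ^ 2 ^ 2" where
  "conic_matrix k t u = m2 (k * (1 + t) + fst u) (k + snd u + t * fst u) (snd u - k) (k - fst u)"

lemma conic_matrix_carrier:
  assumes "u \<in> conic t (k^2 * (t + 2) - 1)"
  shows "conic_matrix k t u \<in> carrier SL2"
proof -
  obtain x z where u: "u = (x, z)" by (cases u)
  have "(k * (1 + t) + x) * (k - x) - (k + z + t * x) * (z - k) =
      k^2 * (t + 2) - (x^2 + t * x * z + z^2)" by Groebner_Basis.algebra
  then show ?thesis using assms by (simp add: conic_matrix_def m2_carrier u conic_def)
qed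

lemma trace_conic_matrix:
  "trace (conic_matrix k t u) = k * (t + 2)" "trace (companion t ** conic_matrix k t u) = k * (t + 2)"
  by (simp_all add: conic_matrix_def companion_def algebra_simps)

text \<open>Write \<open>B(u)\<close> for \<open>conic_matrix k t u\<close>. If \<open>B(u) B(u')\<inverse> = B(v) B(v')\<inverse> = P\<close>, then the
  traces of \<open>P ** N\<close> and of \<open>companion t ** P ** N\<close> vanish for \<open>N = B(u') - B(v')\<close>. These are two
  linear equations for \<open>u' - v'\<close> whose determinant is a multiple of the quadratic form at
  \<open>u - u'\<close>.\<close>

lemma conic_matrix_quotient_inj:
  fixes k t :: "'k::field"
  assumes t: "t^2 \<noteq> 4" and k: "k \<noteq> 0" and m: "k^2 * (t + 2) - 1 \<noteq> 0"
    and u: "u \<in> conic t (k^2 * (t + 2) - 1)" "u' \<in> conic t (k^2 * (t + 2) - 1)" "u \<noteq> u'"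
    and v: "v \<in> conic t (k^2 * (t + 2) - 1)" "v' \<in> conic t (k^2 * (t + 2) - 1)"
    and eq: "conic_matrix k t u \<otimes>\<^bsub>SL2\<^esub> inv\<^bsub>SL2\<^esub> (conic_matrix k t u')
       = conic_matrix k t v \<otimes>\<^bsub>SL2\<^esub> inv\<^bsub>SL2\<^esub> (conic_matrix k t v')"
  shows "u = v \<and> u' = v'"
proof -
  note car = u(1,2)[THEN conic_matrix_carrier] v[THEN conic_matrix_carrier]
  let ?B = "conic_matrix k t"
  obtain x z x' z' where xz: "u = (x, z)" "u' = (x', z')" by (cases u; cases u')
  obtain y w y' w' where yw: "v = (y, w)" "v' = (y', w')" by (cases v; cases v')
  define P where "P = ?B u \<otimes>\<^bsub>SL2\<^esub> inv\<^bsub>SL2\<^esub> (?B u')"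
  have P1: "P ** ?B u' = ?B u"
    using car by (simp add: P_def SL2.m_assoc flip: mult_SL2)
  have P2: "P ** ?B v' = ?B v"
    using car by (simp add: P_def eq SL2.m_assoc flip: mult_SL2)
  have u'det: "(k * (1 + t) + x') * (k - x') - (k + z' + t * x') * (z' - k) = 1"
    using car(2) by (simp add: conic_matrix_def m2_carrier xz)
  define p1 p2 p3 p4 where
    "p1 = (k * (1 + t) + x) * (k - x') + (k + z + t * x) * (k - z')" and
    "p2 = - (k * (1 + t) + x) * (k + z' + t * x') + (k + z + t * x) * (k * (1 + t) + x')" and
    "p3 = (z - k) * (k - x') + (k - x) * (k - z')" and
    "p4 = - (z - k) * (k + z' + t * x') + (k - x) * (k * (1 + t) + x')"
  have P: "P = m2 p1 p2 p3 p4"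
    unfolding P_def conic_matrix_def xz fst_conv snd_conv inv_SL2[OF u'det]
      mult_SL2 m2_mult m2_eq_iff p1_def p2_def p3_def p4_def
    by (simp add: algebra_simps)
  define n1 n2 where "n1 = x' - y'" and "n2 = z' - w'"
  define a b where "a = p1 - p4 + t * p3" and "b = p2 + p3"
  have tr: "trace (P ** ?B u') = k * (t + 2)" "trace (P ** ?B v') = k * (t + 2)"
      "trace (companion t ** (P ** ?B u')) = k * (t + 2)" "trace (companion t ** (P ** ?B v')) = k * (t + 2)"
    unfolding P1 P2 by (simp_all add: trace_conic_matrix)
  have "trace (P ** ?B u') - trace (P ** ?B v') = a * n1 + b * n2"
    unfolding P a_def b_def n1_def n2_def by (simp add: conic_matrix_def xz yw algebra_simps)
  then have e1: "a * n1 + b * n2 = 0" unfolding tr by simp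
  have "trace (companion t ** (P ** ?B u')) - trace (companion t ** (P ** ?B v')) = (t * a - b) * n1 + a * n2"
    unfolding P a_def b_def n1_def n2_def
    by (simp add: conic_matrix_def xz yw companion_def algebra_simps)
  then have e2: "(t * a - b) * n1 + a * n2 = 0" unfolding tr by simp
  have a: "a = k * (t + 2) * ((x - x') + (z - z'))"
    unfolding a_def p1_def p2_def p3_def p4_def by Groebner_Basis.algebra
  have b: "b = k * (t + 2) * ((z - z') + (t - 1) * (x - x'))"
    unfolding b_def p2_def p3_def by Groebner_Basis.algebra
  let ?Q = "(x - x')^2 + t * (x - x') * (z - z') + (z - z')^2"
  have det: "a^2 - t * a * b + b^2 = (k * (t + 2))^2 * (2 - t) * ?Q"
    unfolding a b by Groebner_Basis.algebra
  have d0: "(a^2 - t * a * b + b^2) * n1 = 0" "(a^2 - t * a * b + b^2) * n2 = 0"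
    using e1 e2 by Groebner_Basis.algebra+
  have Q: "?Q \<noteq> 0"
    using conic_isotropic_difference[OF t m, of x z x' z'] u by (auto simp: xz conic_def)
  have t2: "t + 2 \<noteq> 0" "2 - t \<noteq> 0"
  proof -
    have "(t + 2) * (2 - t) = 4 - t^2" by Groebner_Basis.algebra
    then show "t + 2 \<noteq> 0" "2 - t \<noteq> 0" using t by auto
  qed
  then have "a^2 - t * a * b + b^2 \<noteq> 0" unfolding det using k Q by simp
  then have "n1 = 0" "n2 = 0" using d0 by auto
  then have u'v': "u' = v'" unfolding n1_def n2_def by (simp add: xz yw)
  then have "?B u = ?B v" using P1 P2 by simp
  then have "u = v" by (simp add: conic_matrix_def xz yw)
  then show ?thesis using u'v' by simp
qed

text \<open>Ordered pairs of distinct points give distinct quotients, none of them the identity; the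
  identity supplies the extra 1.\<close>

lemma card_subgroup_conic:
  fixes t k :: "'k::{field,finite}"
  assumes t: "t^2 \<noteq> 4" and k: "k \<noteq> 0" and m: "k^2 * (t + 2) - 1 \<noteq> 0"
    and S: "subgroup S SL2" and sub: "conic_matrix k t ` conic t (k^2 * (t + 2) - 1) \<subseteq> S"
    and e: "e = card (conic t (k^2 * (t + 2) - 1))"
  shows "e * (e - 1) + 1 \<le> card S"
proof -
  let ?C = "conic t (k^2 * (t + 2) - 1)" and ?B = "conic_matrix k t"
  let ?D = "{(u, u'). u \<in> ?C \<and> u' \<in> ?C \<and> u \<noteq> u'}"
  let ?f = "\<lambda>(u, u'). ?B u \<otimes>\<^bsub>SL2\<^esub> inv\<^bsub>SL2\<^esub> (?B u')"
  have "inj_on ?f ?D"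
  proof (rule inj_onI)
    fix p p' assume pp: "p \<in> ?D" "p' \<in> ?D" "?f p = ?f p'"
    obtain u u' where p: "p = (u, u')" by (cases p)
    obtain v v' where p': "p' = (v, v')" by (cases p')
    have uv: "u \<in> ?C" "u' \<in> ?C" "u \<noteq> u'" "v \<in> ?C" "v' \<in> ?C"
      using pp(1,2) unfolding p p' by blast+
    have eq: "?B u \<otimes>\<^bsub>SL2\<^esub> inv\<^bsub>SL2\<^esub> (?B u') = ?B v \<otimes>\<^bsub>SL2\<^esub> inv\<^bsub>SL2\<^esub> (?B v')"
      using pp(3) unfolding p p' prod.case .
    show "p = p'" using conic_matrix_quotient_inj[OF t k m uv eq] unfolding p p' by blast
  qed
  then have 1: "card (?f ` ?D) = card ?D" by (rule card_image)
  have "?D = (SIGMA u:?C. ?C - {u})" by auto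
  then have "card ?D = (\<Sum>u\<in>?C. card (?C - {u}))" by (simp add: card_SigmaI)
  also have "\<dots> = e * (e - 1)" using e by simp
  finally have 2: "card ?D = e * (e - 1)" .
  have B1: "?B u \<in> S" if "u \<in> ?C" for u using sub that by blast
  have fS: "?f ` ?D \<subseteq> S"
  proof (rule image_subsetI)
    fix p assume "p \<in> ?D"
    then obtain u u' where p: "p = (u, u')" "u \<in> ?C" "u' \<in> ?C" by blast
    have "?B u \<otimes>\<^bsub>SL2\<^esub> inv\<^bsub>SL2\<^esub> (?B u') \<in> S"
      by (rule subgroup.m_closed[OF S B1[OF p(2)] subgroup.m_inv_closed[OF S B1[OF p(3)]]])
    then show "?f p \<in> S" by (simp add: p)
  qed
  have n1: "\<one>\<^bsub>SL2\<^esub> \<notin> ?f ` ?D"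
  proof
    assume "\<one>\<^bsub>SL2\<^esub> \<in> ?f ` ?D"
    then obtain u u' where u: "u \<in> ?C" "u' \<in> ?C" "u \<noteq> u'"
        and eq1: "\<one>\<^bsub>SL2\<^esub> = ?B u \<otimes>\<^bsub>SL2\<^esub> inv\<^bsub>SL2\<^esub> (?B u')" by auto
    have "?B u = \<one>\<^bsub>SL2\<^esub> \<otimes>\<^bsub>SL2\<^esub> ?B u'"
      using SL2.inv_solve_right[OF SL2.one_closed u(1,2)[THEN conic_matrix_carrier]] eq1
      by (rule iffD1)
    then have "?B u = ?B u'"
      using SL2.l_one[OF conic_matrix_carrier[OF u(2)]] by (simp del: mult_SL2)
    then show False using u(3) by (cases u; cases u') (simp add: conic_matrix_def)
  qed
  have "card (insert \<one>\<^bsub>SL2\<^esub> (?f ` ?D)) \<le> card S"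
    using fS subgroup.one_closed[OF S] by (intro card_mono) auto
  then show ?thesis using 1 2 n1 by (simp add: card_insert_if)
qed

text \<open>Each fibre of the product map from H x K to the group embeds into the intersection by
  sending (h, k) to h0^-1 h, for a fixed (h0, k0) in the fibre.\<close>

lemma (in group) card_subgroups_le:
  assumes fin: "finite (carrier G)" and H: "subgroup H G" and K: "subgroup K G"
  shows "card H * card K \<le> card (carrier G) * card (H \<inter> K)"
proof -
  have Hc: "H \<subseteq> carrier G" and Kc: "K \<subseteq> carrier G" using H K by (auto dest: subgroup.subset)
  have finH: "finite H" and finK: "finite K" using fin Hc Kc finite_subset by auto
  let ?F = "\<lambda>g. {p \<in> H \<times> K. fst p \<otimes> snd p = g}"
  have "H \<times> K = (\<Union>g\<in>carrier G. ?F g)"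
    using subsetD[OF Hc] subsetD[OF Kc] by auto
  then have "card (H \<times> K) = card (\<Union>g\<in>carrier G. ?F g)" by simp
  also have "\<dots> \<le> (\<Sum>g\<in>carrier G. card (?F g))" by (rule card_UN_le[OF fin])
  also have "\<dots> \<le> (\<Sum>g\<in>carrier G. card (H \<inter> K))"
  proof (rule sum_mono)
    fix g assume "g \<in> carrier G"
    show "card (?F g) \<le> card (H \<inter> K)"
    proof (cases "?F g = {}")
      case False
      then obtain h0 k0 where hk0: "h0 \<in> H" "k0 \<in> K" "h0 \<otimes> k0 = g" by auto
      have hk0c: "h0 \<in> carrier G" "k0 \<in> carrier G" using hk0 subsetD[OF Hc] subsetD[OF Kc] by auto
      let ?m = "\<lambda>p. inv h0 \<otimes> fst p"
      have "?m ` ?F g \<subseteq> H \<inter> K"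
      proof (rule image_subsetI)
        fix p assume "p \<in> ?F g"
        then have p: "fst p \<in> H" "snd p \<in> K" "fst p \<otimes> snd p = g" by auto
        have pc: "fst p \<in> carrier G" "snd p \<in> carrier G" using p subsetD[OF Hc] subsetD[OF Kc] by auto
        have "inv h0 \<otimes> fst p = k0 \<otimes> inv (snd p)"
        proof -
          have "inv h0 \<otimes> (fst p \<otimes> snd p) = inv h0 \<otimes> (h0 \<otimes> k0)" using p(3) hk0(3) by simp
          then have "inv h0 \<otimes> fst p \<otimes> snd p = k0" using pc hk0c by (simp add: group_norm)
          then show ?thesis using pc hk0c by (simp add: inv_solve_right)
        qed
        moreover have "inv h0 \<otimes> fst p \<in> H" "k0 \<otimes> inv (snd p) \<in> K"
          using H K hk0 p by (simp_all add: subgroup.m_closed subgroup.m_inv_closed)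
        ultimately show "?m p \<in> H \<inter> K" by simp
      qed
      moreover have "inj_on ?m (?F g)"
      proof (rule inj_onI)
        fix p p' assume p: "p \<in> ?F g" "p' \<in> ?F g" and eq: "?m p = ?m p'"
        have pc: "fst p \<in> carrier G" "snd p \<in> carrier G" "fst p' \<in> carrier G" "snd p' \<in> carrier G"
          using p subsetD[OF Hc] subsetD[OF Kc] by auto
        have f: "fst p = fst p'" using eq pc hk0c by simp
        have "fst p \<otimes> snd p = fst p' \<otimes> snd p'" using p by simp
        then have "snd p = snd p'" using f pc by simp
        then show "p = p'" using f by (simp add: prod_eq_iff)
      qed
      ultimately show ?thesis using finH by (intro card_inj_on_le[of ?m]) auto
    next
      case True
      show ?thesis unfolding True by simp
    qed
  qed
  also have "\<dots> = card (carrier G) * card (H \<inter> K)" by simp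
  finally show ?thesis by (simp add: card_cartesian_product)
qed

section \<open>Subgroups of \<open>SL\<^sub>2\<close> with the Helly property\<close>

lemma upper_mult [simp]: "upper a ** upper b = upper (a + b)"
  by (simp add: upper_def add.commute)

lemma upper_0: "upper 0 = \<one>\<^bsub>SL2\<^esub>" by (simp add: upper_def one_SL2)

lemma upper_eq_iff [simp]: "upper a = upper b \<longleftrightarrow> a = b" by (simp add: upper_def)

lemma inv_upper [simp]: "inv\<^bsub>SL2\<^esub> (upper a) = upper (- a)"
  by (rule SL2.inv_equality) (simp_all add: upper_0)

lemma subgroup_range_upper: "subgroup (range upper) (SL2 :: ('k::field ^ 2 ^ 2) monoid)"
  by (rule SL2.subgroupI) auto

lemma card_range_upper: "card (range (upper :: 'k::{field,finite} \<Rightarrow> _)) = CARD('k)"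
  by (intro card_image injI) simp

lemma trace_center:
  assumes "A \<in> center (SL2 :: ('k::field ^ 2 ^ 2) monoid)"
  shows "(trace A)^2 = 4"
  using assms unfolding center_SL2 by (auto simp: power2_eq_square)

lemma upper_not_center: "a \<noteq> 0 \<Longrightarrow> upper a \<notin> center SL2"
  by (simp add: center_SL2 upper_def)

lemma card_center_SL2: "card (center (SL2 :: ('k::field ^ 2 ^ 2) monoid)) \<le> 2"
  unfolding center_SL2 by (simp add: card_insert_if)

lemma finite_carrier_SL2: "finite (carrier (SL2 :: ('k::{field,finite} ^ 2 ^ 2) monoid))"
  by simp

lemma square_eq_4_iff: "(r::'k::field)^2 = 4 \<longleftrightarrow> r = 2 \<or> r = - 2"
proof -
  have "r^2 = 4 \<longleftrightarrow> (r - 2) * (r + 2) = 0" by (simp add: algebra_simps power2_eq_square)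
  then show ?thesis by (auto simp: eq_neg_iff_add_eq_0)
qed

text \<open>\<open>H\<close> stands for the full preimage of a proper subgroup of PSL2, hence the
  condition on the centre.\<close>

locale helly_subgroup =
  fixes H :: "('k::{field,finite} ^ 2 ^ 2) set"
  assumes q4: "CARD('k) \<ge> 4" and q5: "CARD('k) \<noteq> 5"
    and sub: "subgroup H SL2" and center_sub: "center SL2 \<subseteq> H"
    and hel: "helly SL2 H" and proper: "H \<noteq> carrier SL2"
begin

abbreviation minimal :: "('k ^ 2 ^ 2) set \<Rightarrow> bool" where
  "minimal K \<equiv> mincap SL2 (center SL2) H K"

lemma H_carrier: "H \<subseteq> carrier SL2" by (rule subgroup.subset[OF sub])

lemma cap_subgroup: "K \<in> caps SL2 H \<Longrightarrow> subgroup K SL2"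
  by (rule SL2.caps_subgroup[OF sub])

lemma cap_carrier: "K \<in> caps SL2 H \<Longrightarrow> K \<subseteq> carrier SL2"
  using cap_subgroup subgroup.subset by blast

lemma cap_center: "K \<in> caps SL2 H \<Longrightarrow> center SL2 \<subseteq> K"
  by (rule SL2.caps_superset[OF H_carrier order_refl center_sub])

lemma conj_cap: "g \<in> carrier SL2 \<Longrightarrow> conjg SL2 g H \<in> caps SL2 H"
  by (rule SL2.caps_conjg[OF H_carrier SL2.self_in_caps[OF H_carrier]])

lemma cap_in_conj:
  assumes "K \<in> caps SL2 H"
  shows "\<exists>g\<in>carrier SL2. K \<subseteq> conjg SL2 g H"
  using assms unfolding caps_def by blast

lemma cap_proper:
  assumes "K \<in> caps SL2 H"
  shows "K \<noteq> carrier SL2"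
proof
  assume K: "K = carrier SL2"
  obtain g where g: "g \<in> carrier SL2" "K \<subseteq> conjg SL2 g H" using cap_in_conj[OF assms] by blast
  then have "card K \<le> card (conjg SL2 g H)" by (intro card_mono) auto
  also have "\<dots> = card H" by (rule SL2.card_conjg[OF H_carrier g(1)])
  also have "\<dots> < card (carrier (SL2 :: ('k ^ 2 ^ 2) monoid))"
    using H_carrier proper by (intro psubset_card_mono) auto
  finally show False using K by simp
qed

lemma minimal_cap: "minimal K \<Longrightarrow> K \<in> caps SL2 H" by (simp add: mincap_def)

lemma minimal_ne_center: "minimal K \<Longrightarrow> K \<noteq> center SL2" by (simp add: mincap_def)

lemma minimal_conjg: "minimal K \<Longrightarrow> g \<in> carrier SL2 \<Longrightarrow> minimal (conjg SL2 g K)"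
  by (rule SL2.mincap_conjg[OF H_carrier order_refl _ _ cap_carrier[OF minimal_cap]])

lemma minimal_exists:
  assumes "M \<in> caps SL2 H" "M \<noteq> center SL2"
  shows "\<exists>K\<subseteq>M. minimal K"
  by (rule SL2.mincap_exists[OF finite_carrier_SL2 sub assms order_refl center_sub])

lemma minimal_Int:
  assumes "minimal K" "minimal L" "A \<in> K" "A \<in> L" "A \<notin> center SL2"
  shows "K = L"
  using SL2.mincap_Int[OF assms(1,2)] assms(3-5) by blast

lemma conj_into_minimal:
  assumes "minimal K" "A \<in> K" "B \<in> carrier SL2" "sl2_conj B A"
  shows "\<exists>L. minimal L \<and> B \<in> L"
  using sl2_conj_conjg[OF assms(3) cap_carrier[OF minimal_cap[OF assms(1)]] assms(4,2)]
    minimal_conjg[OF assms(1)] by blast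

text \<open>The form of \<open>mincap_closed\<close> in which traces can be used: \<open>B\<close>
  and \<open>A ** B\<close> only need to be conjugate into \<open>K\<close>, which for traces other
  than 2 and -2 is a condition on the trace alone.\<close>

lemma minimal_closed:
  assumes K: "minimal K" and A: "A \<in> K" "A \<notin> center SL2" and B: "B \<in> carrier SL2"
    and C: "C \<in> K" "sl2_conj B C" and D: "D \<in> K" "sl2_conj (A ** B) D"
  shows "B \<in> K"
proof -
  have "A \<in> carrier SL2" using A(1) cap_carrier[OF minimal_cap[OF K]] by blast
  then have AB: "A ** B \<in> carrier SL2" using SL2.m_closed[of A B] B by simp
  obtain L2 where L2: "minimal L2" "B \<in> L2" using conj_into_minimal[OF K C(1) B C(2)] by blast
  obtain L3 where L3: "minimal L3" "A ** B \<in> L3" using conj_into_minimal[OF K D(1) AB D(2)] by blast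
  show ?thesis
    by (rule SL2.mincap_closed[OF sub hel order_refl center_sub K L2(1) L3(1) A L2(2)])
      (use L3 in simp)
qed

text \<open>\<open>K\<close> is not normal, since a normal subgroup with such an element would be
  all of SL2. So some conjugate of \<open>K\<close> meets it only in the centre, whose order is at
  most 2.\<close>

lemma card_minimal_bound:
  assumes K: "minimal K" and A: "A \<in> K" "(trace A)^2 \<noteq> 4"
  shows "(card K)^2 \<le> 2 * (CARD('k) * (CARD('k)^2 - 1))"
proof -
  note Ks = cap_subgroup[OF minimal_cap[OF K]] and Kc = cap_carrier[OF minimal_cap[OF K]]
  obtain g where g: "g \<in> carrier SL2" "\<not> conjg SL2 g K \<subseteq> K"
    using normal_subgroup_SL2[OF q4 Ks _ A] cap_proper[OF minimal_cap[OF K]] by blast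
  have I: "K \<inter> conjg SL2 g K = center SL2"
    using SL2.mincap_Int[OF K minimal_conjg[OF K g(1)]] g(2) by blast
  have "card K * card (conjg SL2 g K) \<le> card (carrier (SL2 :: ('k ^ 2 ^ 2) monoid)) * card (K \<inter> conjg SL2 g K)"
    by (rule SL2.card_subgroups_le[OF finite_carrier_SL2 Ks SL2.subgroup_conjg[OF Ks g(1)]])
  also have "\<dots> \<le> CARD('k) * (CARD('k)^2 - 1) * 2"
    unfolding I card_SL2 by (rule mult_le_mono2[OF card_center_SL2])
  finally show ?thesis using SL2.card_conjg[OF Kc g(1)] by (simp add: power2_eq_square mult.commute)
qed

text \<open>The threshold is sharp: at n = 5 the two sides are 240 and 169.\<close>

lemma conic_size_bound:
  fixes n :: nat
  assumes "n \<ge> 6"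
  shows "2 * (n * (n^2 - 1)) < ((n - 1) * (n - 2) + 1)^2"
proof -
  obtain m where n: "n = m + 6" using assms by (metis add.commute le_Suc_ex)
  have "n^2 - 1 = m * m + 12 * m + 35" by (simp add: n power2_eq_square algebra_simps)
  then show ?thesis by (simp add: n power2_eq_square algebra_simps)
qed

lemma minimal_trace:
  assumes K: "minimal K" and A: "A \<in> K" "(trace A)^2 \<noteq> 4" "trace A \<noteq> 0" "trace A \<noteq> - 1"
  shows False
proof -
  define t where "t = trace A"
  have t: "t^2 \<noteq> 4" "t \<noteq> 0" "t \<noteq> - 1" "t + 2 \<noteq> 0" "t - 2 \<noteq> 0" "t + 1 \<noteq> 0"
    using A(2-4) by (auto simp: t_def square_eq_4_iff eq_neg_iff_add_eq_0)
  have Ac: "A \<in> carrier SL2" using A(1) cap_carrier[OF minimal_cap[OF K]] by blast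
  have "sl2_conj (companion t) A" using same_trace_conj[of "companion t" A] Ac t by (simp add: t_def)
  then obtain L where L: "minimal L" "companion t \<in> L"
    using conj_into_minimal[OF K A(1) companion_carrier] by blast
  note Ls = cap_subgroup[OF minimal_cap[OF L(1)]]
  \<comment> \<open>With this k both traces of \<open>conic_matrix k t u\<close> equal t. It is
    nonzero because t is, and t other than -1 makes the constant of the conic nonzero.\<close>
  define k where "k = t / (t + 2)"
  have k: "k \<noteq> 0" "k * (t + 2) = t" using t by (simp_all add: k_def)
  have "(k^2 * (t + 2) - 1) * (t + 2) = (t - 2) * (t + 1)"
  proof -
    have "(k^2 * (t + 2) - 1) * (t + 2) = (k * (t + 2))^2 - (t + 2)" by Groebner_Basis.algebra
    also have "\<dots> = (t - 2) * (t + 1)" unfolding k(2) by Groebner_Basis.algebra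
    finally show ?thesis .
  qed
  then have m: "k^2 * (t + 2) - 1 \<noteq> 0" using t by auto
  let ?C = "conic t (k^2 * (t + 2) - 1)"
  have "companion t \<notin> center SL2" using trace_center[of "companion t"] t(1) by auto
  have "conic_matrix k t u \<in> L" if u: "u \<in> ?C" for u
  proof -
    let ?B = "conic_matrix k t u"
    have B: "?B \<in> carrier SL2" by (rule conic_matrix_carrier[OF u])
    have AB: "companion t ** ?B \<in> carrier SL2" using SL2.m_closed[OF companion_carrier B] by simp
    show ?thesis
    proof (rule minimal_closed[OF L(1,2) \<open>companion t \<notin> center SL2\<close> B L(2) _ L(2)])
      show "sl2_conj ?B (companion t)" "sl2_conj (companion t ** ?B) (companion t)"
        using B AB t(1) by (auto intro!: same_trace_conj simp: trace_conic_matrix k(2))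
    qed
  qed
  then have sub: "conic_matrix k t ` ?C \<subseteq> L" by blast
  define e where "e = card ?C"
  have "e * (e - 1) + 1 \<le> card L" by (rule card_subgroup_conic[OF t(1) k(1) m Ls sub e_def])
  then have "(e * (e - 1) + 1)^2 \<le> (card L)^2" by (rule power_mono) simp
  also have "\<dots> \<le> 2 * (CARD('k) * (CARD('k)^2 - 1))"
    by (rule card_minimal_bound[OF L]) (use t in simp)
  finally have ub: "(e * (e - 1) + 1)^2 \<le> 2 * (CARD('k) * (CARD('k)^2 - 1))" .
  have e: "CARD('k) + 1 \<le> e + card {v. v^2 + t * v + 1 = 0}"
    unfolding e_def by (rule card_conic[OF t(1) m])
  show False
  proof (cases "CARD('k) = 4")
    case False
    then have q: "CARD('k) \<ge> 6" using q4 q5 by simp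
    have "CARD('k) - 1 \<le> e" using e card_quadratic_roots[of t] by linarith
    then have "((CARD('k) - 1) * (CARD('k) - 2) + 1)^2 \<le> (e * (e - 1) + 1)^2"
      by (intro power_mono add_mono mult_mono) auto
    then show False using ub conic_size_bound[OF q] by linarith
  next
    case True
    have two: "(2::'k) = 0" by (rule char2_if_even_card[of 2]) (simp add: True)
    \<comment> \<open>Over four elements q - 1 points would not suffice. A root v satisfies v^3 = 1,
      which forces t to be 0 or 1; since both are excluded there are no isotropic directions and at
      least 5 points.\<close>
    have "{v. v^2 + t * v + 1 = 0} = {}"
    proof (rule ccontr)
      assume "{v. v^2 + t * v + 1 = 0} \<noteq> {}"
      then obtain v where v: "v^2 + t * v + 1 = 0" by blast
      then have v0: "v \<noteq> 0" by auto
      have v3: "v^3 = 1" using fermat_finite_field[OF v0] True by simp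
      have "v^2 * (t * (t + 1)) = (v * t) * (v * t + v)" by Groebner_Basis.algebra
      also have "v * t = - (v^2 + 1)" using v by (simp add: eq_neg_iff_add_eq_0 algebra_simps)
      also have "- (v^2 + 1) * (- (v^2 + 1) + v) = v * v^3 - v^3 + 2 * v^2 - v + 1"
        by Groebner_Basis.algebra
      also have "\<dots> = 0" unfolding v3 two by simp
      finally have "v^2 * (t * (t + 1)) = 0" .
      then show False using v0 t by simp
    qed
    then have "5 \<le> e" using e True by simp
    then have "(5 * 4 + 1)^2 \<le> (e * (e - 1) + 1)^2" by (intro power_mono add_mono mult_mono) auto
    then show False using ub True by simp
  qed
qed

lemma uminus_in_cap:
  assumes "K \<in> caps SL2 H" "m2 a b c d \<in> K"
  shows "m2 (- a) (- b) (- c) (- d) \<in> K"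
proof -
  have "m2 (-1) 0 0 (-1) \<in> K" using cap_center[OF assms(1)] by (auto simp: center_SL2)
  then have "m2 (-1) 0 0 (-1) \<otimes>\<^bsub>SL2\<^esub> m2 a b c d \<in> K"
    using assms(2) by (rule subgroup.m_closed[OF cap_subgroup[OF assms(1)]])
  then show ?thesis by simp
qed

subsection \<open>Odd characteristic\<close>

text \<open>The only trace that \<open>minimal_trace\<close> leaves open is -1. The negative of
  \<open>A\<close> also lies in \<open>K\<close>, and its trace 1 is generic in odd
  characteristic.\<close>

lemma minimal_trace_nonzero:
  assumes two: "(2::'k) \<noteq> 0" and K: "minimal K"
    and A: "A \<in> K" "(trace A)^2 \<noteq> 4" "trace A \<noteq> 0"
  shows False
proof (cases "trace A = - 1")
  case True
  obtain a b c d where abcd: "A = m2 a b c d" by (rule m2_exhaust)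
  have "m2 (- a) (- b) (- c) (- d) \<in> K" using uminus_in_cap[OF minimal_cap[OF K]] A(1) abcd by simp
  moreover have "trace (m2 (- a) (- b) (- c) (- d)) = - trace A" using abcd by simp
  then have "trace (m2 (- a) (- b) (- c) (- d)) = 1" using True by simp
  moreover have "(1::'k) \<noteq> - 1" using two by (simp add: eq_neg_iff_add_eq_0)
  moreover have "(1::'k) \<noteq> 4" using A(2) True by simp
  ultimately show False using minimal_trace[OF K, of "m2 (- a) (- b) (- c) (- d)"] by simp
qed (use minimal_trace[OF K A] in auto)

text \<open>For trace 0 the conic with t = k = 0 still consists of matrices in \<open>L\<close>, but
  k = 0 rules out counting quotients. Instead the product of two of its matrices has trace 2 s, with
  s the scalar product of the points, and for suitable points this trace is nonzero and has square
  other than 4.\<close>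

lemma minimal_semisimple:
  assumes two: "(2::'k) \<noteq> 0" and K: "minimal K" and A: "A \<in> K" "(trace A)^2 \<noteq> 4"
  shows False
proof (cases "trace A = 0")
  case True
  have Ac: "A \<in> carrier SL2" using A(1) cap_carrier[OF minimal_cap[OF K]] by blast
  have four: "(4::'k) \<noteq> 0" using A(2) True by auto
  have "sl2_conj (companion 0) A" using same_trace_conj[of "companion 0" A] Ac True four by simp
  then obtain L where L: "minimal L" "companion 0 \<in> L"
    using conj_into_minimal[OF K A(1) companion_carrier] by blast
  note Ls = cap_subgroup[OF minimal_cap[OF L(1)]]
  have cn: "companion (0::'k) \<notin> center SL2" using trace_center[of "companion (0::'k)"] four by auto
  let ?C = "conic (0::'k) (- 1)" and ?B = "conic_matrix (0::'k) 0"
  have BL: "?B u \<in> L" if u: "u \<in> ?C" for u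
  proof -
    have B: "?B u \<in> carrier SL2" by (rule conic_matrix_carrier) (use u in simp)
    have AB: "companion 0 ** ?B u \<in> carrier SL2" using SL2.m_closed[OF companion_carrier B] by simp
    show ?thesis
    proof (rule minimal_closed[OF L(1,2) cn B L(2) _ L(2)])
      show "sl2_conj (?B u) (companion 0)" "sl2_conj (companion 0 ** ?B u) (companion 0)"
        using B AB four by (auto intro!: same_trace_conj simp: trace_conic_matrix)
    qed
  qed
  have "CARD('k) \<noteq> 4" using char2_if_even_card[where 'k = 'k, of 2] two by auto
  then have q: "CARD('k) \<ge> 6" using q4 q5 by simp
  have "CARD('k) + 1 \<le> card ?C + card {v::'k. v^2 + 0 * v + 1 = 0}"
    by (rule card_conic) (use four in auto)
  then have C5: "card ?C \<ge> 5" using card_quadratic_roots[of "0::'k"] q by linarith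
  then obtain u0 where "u0 \<in> ?C" by (metis card.empty equals0I not_numeral_le_zero)
  then obtain x0 z0 where u0: "(x0, z0) \<in> ?C" by (cases u0) auto
  \<comment> \<open>Relative to a fixed point, s = 0, 1 or -1 occurs only at these four points, and
    the conic has at least five.\<close>
  let ?bad = "set [(x0, z0), (- x0, - z0), (z0, - x0), (- z0, x0)]"
  have "card ?bad < card ?C" using card_length[of "[(x0, z0), (- x0, - z0), (z0, - x0), (- z0, x0)]"] C5 by simp
  then have "\<not> ?C \<subseteq> ?bad" by (metis card_mono finite_set not_le)
  then obtain x z where u: "(x, z) \<in> ?C" "(x, z) \<notin> ?bad" by auto
  define s d where "s = x0 * x + z0 * z" and "d = x0 * z - z0 * x"
  have n0: "x0^2 + z0^2 = - 1" and n: "x^2 + z^2 = - 1" using u0 u(1) by (auto simp: conic_def)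
  have sd: "s^2 + d^2 = 1"
  proof -
    have "s^2 + d^2 = (x0^2 + z0^2) * (x^2 + z^2)" unfolding s_def d_def by Groebner_Basis.algebra
    then show ?thesis unfolding n0 n by simp
  qed
  have xs: "x = z0 * d - x0 * s" "z = - (z0 * s) - x0 * d"
  proof -
    have "(x0^2 + z0^2) * x = x0 * s - z0 * d" "(x0^2 + z0^2) * z = z0 * s + x0 * d"
      unfolding s_def d_def by Groebner_Basis.algebra+
    then have xz: "- x = x0 * s - z0 * d" "- z = z0 * s + x0 * d" unfolding n0 by simp_all
    show "x = z0 * d - x0 * s" "z = - (z0 * s) - x0 * d"
      using xz[THEN arg_cong[of _ _ uminus]] by simp_all
  qed
  have s0: "s \<noteq> 0"
  proof
    assume "s = 0"
    then have "d = 1 \<or> d = - 1" using sd by (simp add: power2_eq_1_iff)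
    then show False using u(2) xs \<open>s = 0\<close> by auto
  qed
  have s1: "s^2 \<noteq> 1"
  proof
    assume "s^2 = 1"
    then have "d^2 = 0" "s = 1 \<or> s = - 1" using sd by (auto simp: power2_eq_1_iff)
    then show False using u(2) xs by auto
  qed
  have "?B (x0, z0) \<otimes>\<^bsub>SL2\<^esub> ?B (x, z) \<in> L"
    by (rule subgroup.m_closed[OF Ls BL[OF u0] BL[OF u(1)]])
  moreover have tr: "trace (?B (x0, z0) \<otimes>\<^bsub>SL2\<^esub> ?B (x, z)) = 2 * s"
    by (simp add: conic_matrix_def s_def algebra_simps)
  moreover have "(2 * s)^2 \<noteq> 4"
  proof -
    have "(2 * s)^2 - 4 = 4 * (s^2 - 1)" by Groebner_Basis.algebra
    then show ?thesis using four s1 by auto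
  qed
  ultimately show False using minimal_trace_nonzero[OF two L(1)] two s0 by (metis mult_eq_0_iff)
qed (use minimal_trace_nonzero[OF two K A] in auto)

text \<open>The entry \<open>-4/a\<close> below gives the product with \<open>upper a\<close> the trace \<open>-2\<close>, so that up to sign
  it is again conjugate into the subgroup.\<close>

lemma no_minimal_odd:
  assumes two: "(2::'k) \<noteq> 0" and K: "minimal K"
  shows False
proof -
  note Kcap = minimal_cap[OF K]
  obtain A where A: "A \<in> K" "A \<notin> center SL2"
    using cap_center[OF Kcap] minimal_ne_center[OF K] by blast
  have tr4: "(trace B)^2 = 4" if "B \<in> K" for B
    using minimal_semisimple[OF two K that] by blast
  obtain A' where A': "A' \<in> K" "trace A' = 2" "A' \<noteq> \<one>\<^bsub>SL2\<^esub>"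
  proof (cases "trace A = 2")
    case True
    then show thesis using that[of A] A by (auto simp: center_SL2 one_SL2)
  next
    case False
    obtain a b c d where abcd: "A = m2 a b c d" by (rule m2_exhaust)
    have "trace A = - 2" using tr4[OF A(1)] False by (simp add: square_eq_4_iff)
    moreover have "trace (m2 (- a) (- b) (- c) (- d)) = - trace A" using abcd by simp
    ultimately have "trace (m2 (- a) (- b) (- c) (- d)) = 2" by simp
    moreover have "m2 (- a) (- b) (- c) (- d) \<noteq> \<one>\<^bsub>SL2\<^esub>"
      using A(2) by (auto simp: abcd center_SL2 one_SL2 minus_equation_iff)
    ultimately show thesis using that uminus_in_cap[OF Kcap] A(1) abcd by blast
  qed
  have A'c: "A' \<in> carrier SL2" using A'(1) cap_carrier[OF Kcap] by blast
  obtain a where a: "a \<noteq> 0" "sl2_conj A' (upper a)" using conj_upper[OF A'c A'(2,3)] by blast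
  obtain L where L: "minimal L" "upper a \<in> L"
    using conj_into_minimal[OF K A'(1) upper_carrier sl2_conj_sym[OF A'c upper_carrier a(2)]] by blast
  note Ls = cap_subgroup[OF minimal_cap[OF L(1)]] and un = upper_not_center[OF a(1)]
  let ?B = "m2 1 0 (- 4 / a) 1"
  have B: "?B \<in> carrier SL2" by (simp add: m2_carrier)
  have "sl2_conj ?B (upper a)" unfolding sl2_conj_def
  proof
    show "m2 0 (a / 2) (- 2 / a) 0 \<in> carrier SL2" using a two by (simp add: m2_carrier)
    show "?B ** m2 0 (a / 2) (- 2 / a) 0 = m2 0 (a / 2) (- 2 / a) 0 ** upper a"
      using a two by (simp add: upper_def field_simps)
  qed
  moreover have "m2 (- 1) a 0 (- 1) \<in> L"
  proof -
    have "upper (- a) \<in> L" using subgroup.m_inv_closed[OF Ls L(2)] by simp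
    then show ?thesis using uminus_in_cap[OF minimal_cap[OF L(1)], of 1 "- a" 0 1] by (simp add: upper_def)
  qed
  moreover have "sl2_conj (upper a ** ?B) (m2 (- 1) a 0 (- 1))" unfolding sl2_conj_def
  proof
    show "m2 1 0 (2 / a) 1 \<in> carrier SL2" by (simp add: m2_carrier)
    show "upper a ** ?B ** m2 1 0 (2 / a) 1 = m2 1 0 (2 / a) 1 ** m2 (- 1) a 0 (- 1)"
      using a by (simp add: upper_def field_simps)
  qed
  ultimately have BL: "?B \<in> L" using minimal_closed[OF L un B L(2)] by blast
  \<comment> \<open>Conjugation by \<open>upper c\<close> fixes \<open>upper a\<close>, hence fixes
    \<open>L\<close>. So \<open>L\<close> contains the product of \<open>?B\<close> with its
    conjugate, of trace 2 - d^2, whose square is 4 only for d in {0, 2, -2}.\<close>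
  have "card (set [0, 2, - 2 :: 'k]) < CARD('k)" using q4 card_length[of "[0, 2, - 2 :: 'k]"] by simp
  then obtain d :: 'k where d: "d \<notin> set [0, 2, - 2]" using ex_not_in by blast
  define c where "c = - d * a / 4"
  have four: "(4::'k) \<noteq> 0" using two by (metis mult_2 mult_eq_0_iff numeral_Bit0)
  have cd: "- 4 / a * c = d" using a four by (simp add: c_def)
  have "conjg SL2 (upper c) L = L"
  proof (rule minimal_Int[OF minimal_conjg[OF L(1) upper_carrier] L(1) _ L(2) un])
    show "upper a \<in> conjg SL2 (upper c) L"
      unfolding SL2.mem_conjg[OF subgroup.subset[OF Ls] upper_carrier] using L(2) by simp
  qed
  moreover have "upper c \<otimes>\<^bsub>SL2\<^esub> ?B \<otimes>\<^bsub>SL2\<^esub> inv\<^bsub>SL2\<^esub> (upper c) \<in> conjg SL2 (upper c) L"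
    unfolding conjg_def using BL by blast
  ultimately have "upper c ** ?B ** upper (- c) \<otimes>\<^bsub>SL2\<^esub> ?B \<in> L"
    using subgroup.m_closed[OF Ls _ BL] by simp
  moreover have "trace (upper c ** ?B ** upper (- c) \<otimes>\<^bsub>SL2\<^esub> ?B) = 2 - (- 4 / a * c)^2"
    by (simp add: upper_def power2_eq_square algebra_simps)
  ultimately have "(2 - d^2)^2 = 4" unfolding cd using tr4 K L by (metis minimal_semisimple two)
  then have "d^2 = 0 \<or> d^2 = 4" by (auto simp: square_eq_4_iff algebra_simps)
  then show False using d by (auto simp: square_eq_4_iff)
qed

lemma odd_char_trivial:
  assumes "(2::'k) \<noteq> 0"
  shows "H = center SL2"
  using minimal_exists[OF SL2.self_in_caps[OF H_carrier]] no_minimal_odd[OF assms] by blast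

end

subsection \<open>Characteristic two\<close>

text \<open>In characteristic two the characteristic polynomial of \<open>companion 1\<close> is x^2
  + x + 1, so \<open>companion 1\<close> has order three and this is the cyclic group it
  generates.\<close>

definition ord3 :: "('k::field ^ 2 ^ 2) set" where
  "ord3 = {\<one>\<^bsub>SL2\<^esub>, companion 1, companion 1 ** companion 1}"

lemma char2_uminus: "(2::'k::field) = 0 \<Longrightarrow> - x = (x::'k)"
  by (simp add: minus_equation_iff neg_eq_iff_add_eq_0 flip: mult_2)

lemma center_SL2_char2:
  assumes "(2::'k::field) = 0"
  shows "center (SL2 :: ('k ^ 2 ^ 2) monoid) = {\<one>\<^bsub>SL2\<^esub>}"
  unfolding center_SL2 one_SL2 using char2_uminus[OF assms, of 1] by simp

text \<open>For trace-one matrices \<open>A\<close> and \<open>B\<close>, the condition \<open>trace (A ** B) = 1\<close> says that the form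
  \<open>x\<^sup>2 + x z + z\<^sup>2\<close> vanishes at the coordinates of \<open>B - A\<close>.\<close>

lemma trace_one_unique:
  fixes B :: "'k::field ^ 2 ^ 2"
  assumes two: "(2::'k) = 0" and no: "\<And>w::'k. w^2 + w + 1 \<noteq> 0"
    and B: "B \<in> carrier SL2" "trace B = 1" "trace (companion 1 ** B) = 1"
  shows "B = companion 1"
proof -
  obtain x y z w where xyzw: "B = m2 x y z w" "x * w - y * z = 1" by (rule m2_exhaust_SL2[OF B(1)])
  have w: "w = 1 - x" using B(2) xyzw(1) by (simp add: algebra_simps)
  have y: "y = x + z" using B(3) xyzw(1) w by (simp add: companion_def algebra_simps)
  define v where "v = z - 1"
  have "x * w - y * z = - (x^2 + x * v + v^2) - 1 + 2 * (- v) "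
    unfolding w y v_def by Groebner_Basis.algebra
  then have "x^2 + x * v + v^2 = - 2" using xyzw(2) two by (simp add: algebra_simps)
  then have Q: "x^2 + x * v + v^2 = 0" using two by simp
  have "v = 0"
  proof (rule ccontr)
    assume "v \<noteq> 0"
    then have "(x / v)^2 + x / v + 1 = (x^2 + x * v + v^2) / v^2"
      by (simp add: power2_eq_square field_simps)
    then show False using no[of "x / v"] Q by simp
  qed
  then have "x = 0" "z = 1" using Q by (simp_all add: v_def)
  then show ?thesis using w y char2_uminus[OF two, of 1] by (simp add: xyzw(1) companion_def)
qed

text \<open>For a nontrivial member \<open>B\<close>, the product \<open>companion 1 ** B\<close> is
  either the identity, so that \<open>B\<close> is the inverse of \<open>companion 1\<close>, or of
  trace 1, so that \<open>trace_one_unique\<close> applies.\<close>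

lemma subgroup_eq_ord3:
  assumes two: "(2::'k::field) = 0" and no: "\<And>w::'k. w^2 + w + 1 \<noteq> 0"
    and S: "subgroup S (SL2 :: ('k ^ 2 ^ 2) monoid)" and c: "companion 1 \<in> S"
    and tr: "\<And>B. B \<in> S \<Longrightarrow> B = \<one>\<^bsub>SL2\<^esub> \<or> trace B = 1"
  shows "S = ord3"
proof
  have mult: "A ** B \<in> S" if "A \<in> S" "B \<in> S" for A B using subgroup.m_closed[OF S that] by simp
  show "ord3 \<subseteq> S" unfolding ord3_def using mult[OF c c] c subgroup.one_closed[OF S] by simp
  show "S \<subseteq> ord3"
  proof
    fix B assume BS: "B \<in> S"
    then have B: "B \<in> carrier SL2" by (rule subgroup.mem_carrier[OF S])
    consider "B = \<one>\<^bsub>SL2\<^esub>" | "trace B = 1" "companion 1 ** B = \<one>\<^bsub>SL2\<^esub>"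
      | "trace B = 1" "trace (companion 1 ** B) = 1"
      using tr[OF BS] tr[OF mult[OF c BS]] by blast
    then show "B \<in> ord3"
    proof cases
      case 2
      obtain x y z w where B: "B = m2 x y z w" by (rule m2_exhaust)
      have "- z = 1 \<and> w = 0 \<and> x + z = 0 \<and> y + w = 1"
        using 2(2) by (auto simp: B companion_def one_SL2)
      then have "z = 1" "w = 0" "y = 1" "x + 1 = 0" using char2_uminus[OF two, of z] by auto
      moreover from this have "x = 1" using char2_uminus[OF two, of 1] by (metis eq_neg_iff_add_eq_0)
      ultimately have "B = companion 1 ** companion 1"
        using char2_uminus[OF two, of 1] by (simp add: B companion_def)
      then show ?thesis by (simp add: ord3_def)
    next
      case 3
      then show ?thesis using trace_one_unique[OF two no B] by (simp add: ord3_def)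
    qed (simp add: ord3_def)
  qed
qed

section \<open>Characteristic two: minimal subgroups and subgroups with an involution\<close>

context helly_subgroup
begin

context
  assumes two: "(2::'k) = 0"
begin

lemma center_one: "center (SL2 :: ('k ^ 2 ^ 2) monoid) = {\<one>\<^bsub>SL2\<^esub>}"
  by (rule center_SL2_char2[OF two])

lemma four: "(4::'k) = 0"
proof -
  have "(4::'k) = 2 * 2" by simp
  then show ?thesis using two by simp
qed

lemma minimal_trace_char2: "minimal K \<Longrightarrow> A \<in> K \<Longrightarrow> trace A = 0 \<or> trace A = 1"
  using minimal_trace[of K A] char2_uminus[OF two, of 1] four by auto

lemma trace_zero_conj:
  assumes "A \<in> carrier SL2" "trace A = 0" "A \<noteq> \<one>\<^bsub>SL2\<^esub>"
  shows "\<exists>s. s \<noteq> (0::'k) \<and> sl2_conj A (upper s)"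
  using conj_upper[of A] assms two by simp

text \<open>Conjugation by diag(r, 1/r) multiplies the parameter by r^2, and every element is a
  square.\<close>

lemma conj_upper_upper:
  assumes "a \<noteq> 0" "b \<noteq> (0::'k)"
  shows "sl2_conj (upper b) (upper a)"
proof -
  obtain r where r: "b / a = r^2" using char2_sqrt[OF two] by blast
  have r0: "r \<noteq> 0" using r assms by auto
  have b: "b = r^2 * a" using r assms by (simp add: field_simps)
  show ?thesis unfolding sl2_conj_def
  proof
    show "m2 r 0 0 (1 / r) \<in> carrier SL2" using r0 by (simp add: m2_carrier)
    show "upper b ** m2 r 0 0 (1 / r) = m2 r 0 0 (1 / r) ** upper a"
      using r0 by (simp add: upper_def b power2_eq_square)
  qed
qed

lemma diagonal_part:
  assumes S: "subgroup S SL2" and up: "range upper \<subseteq> S" and A: "m2 x y 0 w \<in> S"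
  shows "m2 x 0 0 w \<in> S"
proof -
  have xw: "x * w = 1" using subgroup.mem_carrier[OF S A] by (simp add: m2_carrier)
  have "m2 x y 0 w \<otimes>\<^bsub>SL2\<^esub> upper (- y * w) \<in> S"
    using up A by (intro subgroup.m_closed[OF S]) auto
  moreover have "x * (y * w) = y" using xw by (simp add: mult.left_commute)
  ultimately show ?thesis by (simp add: upper_def)
qed

text \<open>Conjugation by this Weyl element exchanges upper and lower triangular matrices.\<close>

definition W :: "'k ^ 2 ^ 2" where "W = m2 0 (- 1) 1 0"

lemma W_carrier: "W \<in> carrier SL2" by (simp add: W_def m2_carrier)

lemma inv_W: "inv\<^bsub>SL2\<^esub> W = m2 0 1 (- 1) 0" unfolding W_def by (subst inv_SL2) simp_all

lemma mem_conjg_W: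
  assumes "S \<subseteq> carrier SL2" "x * w - y * z = 1"
  shows "m2 x y z w \<in> conjg SL2 W S \<longleftrightarrow> m2 w (- z) (- y) x \<in> S"
  using assms(2) by (simp add: SL2.mem_conjg[OF assms(1) W_carrier] inv_W m2_carrier) (simp add: W_def)

text \<open>All nontrivial \<open>upper b\<close> are conjugate, so \<open>minimal_closed\<close>
  puts every one of them into \<open>K\<close>. A nontrivial diagonal element would also lie in the
  conjugate of \<open>K\<close> by \<open>W\<close>; the two would then be equal, and
  \<open>K\<close> would contain lower unipotents as well and be everything.\<close>

lemma minimal_with_upper:
  assumes K: "minimal K" and a: "upper a \<in> K" "a \<noteq> 0"
  shows "K = range upper"
proof
  note Ks = cap_subgroup[OF minimal_cap[OF K]] and Kc = cap_carrier[OF minimal_cap[OF K]]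
  have up: "upper b \<in> K" for b
  proof (cases "b = 0 \<or> a + b = 0")
    case True
    then show ?thesis
    proof
      assume "a + b = 0"
      then have "b = - a" by (simp add: eq_neg_iff_add_eq_0 add.commute)
      then show ?thesis using subgroup.m_inv_closed[OF Ks a(1)] by simp
    qed (use subgroup.one_closed[OF Ks] in \<open>simp add: upper_0\<close>)
  next
    case False
    show ?thesis
      by (rule minimal_closed[OF K a(1) upper_not_center[OF a(2)] upper_carrier a(1) _ a(1)])
        (use False a(2) conj_upper_upper in auto)
  qed
  then show "range upper \<subseteq> K" by blast
  have low: "c = 0" if "m2 x y c d \<in> K" for x y c d
    using subgroup_with_uppers[OF Ks up that] cap_proper[OF minimal_cap[OF K]] by blast
  show "K \<subseteq> range upper"
  proof
    fix A assume AK: "A \<in> K"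
    then have "A \<in> carrier SL2" using Kc by blast
    then obtain x y z w where A: "A = m2 x y z w" "x * w - y * z = 1" by (rule m2_exhaust_SL2)
    have z: "z = 0" using low AK A(1) by blast
    then have xw: "x * w = 1" using A(2) by simp
    have D: "m2 x 0 0 w \<in> K"
      using diagonal_part[OF Ks] up AK A(1) z by blast
    have "x = 1"
    proof (rule ccontr)
      assume x1: "x \<noteq> 1"
      have "inv\<^bsub>SL2\<^esub> (m2 x 0 0 w) \<in> K" by (rule subgroup.m_inv_closed[OF Ks D])
      then have "m2 w 0 0 x \<in> K" using xw by (simp add: inv_SL2)
      then have "m2 x 0 0 w \<in> conjg SL2 W K" using mem_conjg_W[OF Kc, of x w 0 0] xw by simp
      moreover have "m2 x 0 0 w \<notin> center SL2" using x1 by (simp add: center_one one_SL2)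
      ultimately have eq: "conjg SL2 W K = K"
        using minimal_Int[OF minimal_conjg[OF K W_carrier] K _ D] by blast
      have "m2 1 0 (- 1) 1 \<in> conjg SL2 W K"
        using mem_conjg_W[OF Kc, of 1 1 0 "- 1"] up[of 1] by (simp add: upper_def)
      then show False using low eq by fastforce
    qed
    then have "A = upper y" using A z xw by (simp add: upper_def)
    then show "A \<in> range upper" by blast
  qed
qed

text \<open>An element of trace 0 leads to \<open>minimal_with_upper\<close>. Otherwise all
  nontrivial traces are 1, and the question is whether an element of trace 1 can be
  diagonalised.\<close>

lemma minimal_cases:
  assumes K: "minimal K"
  shows "(\<exists>g\<in>carrier SL2. conjg SL2 g K = range upper) \<or>
    ((\<forall>w::'k. w^2 + w + 1 \<noteq> 0) \<and> (\<exists>g\<in>carrier SL2. conjg SL2 g K = ord3))"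
proof -
  note Kc = cap_carrier[OF minimal_cap[OF K]]
  show ?thesis
  proof (cases "\<exists>A\<in>K. A \<noteq> \<one>\<^bsub>SL2\<^esub> \<and> trace A = 0")
    case True
    then obtain A where A: "A \<in> K" "A \<noteq> \<one>\<^bsub>SL2\<^esub>" "trace A = 0" by blast
    then have Ac: "A \<in> carrier SL2" using Kc by blast
    obtain s where s: "s \<noteq> 0" "sl2_conj A (upper s)" using trace_zero_conj[OF Ac A(3,2)] by blast
    obtain g where g: "g \<in> carrier SL2" "upper s \<in> conjg SL2 g K"
      using sl2_conj_conjg[OF upper_carrier Kc sl2_conj_sym[OF Ac upper_carrier s(2)] A(1)] by blast
    have "conjg SL2 g K = range upper"
      by (rule minimal_with_upper[OF minimal_conjg[OF K g(1)] g(2) s(1)])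
    then show ?thesis using g(1) by blast
  next
    case False
    have tr: "A = \<one>\<^bsub>SL2\<^esub> \<or> trace A = 1" if "A \<in> K" for A
      using minimal_trace_char2[OF K that] False that by blast
    obtain A where A: "A \<in> K" "A \<noteq> \<one>\<^bsub>SL2\<^esub>"
      using cap_center[OF minimal_cap[OF K]] minimal_ne_center[OF K] center_one by blast
    then have Ac: "A \<in> carrier SL2" and tA: "trace A = 1" using Kc tr by blast+
    have not4: "(1::'k)^2 \<noteq> 4" using four by simp
    have conjA: "\<exists>g\<in>carrier SL2. C \<in> conjg SL2 g K" if "C \<in> carrier SL2" "trace C = 1" for C
      by (rule sl2_conj_conjg[OF that(1) Kc same_trace_conj[OF that(1) Ac] A(1)])
        (use that tA not4 in auto)
    have no: "w^2 + w + 1 \<noteq> 0" for w :: 'k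
    proof
      assume w: "w^2 + w + 1 = 0"
      then have w0: "w \<noteq> 0" by auto
      \<comment> \<open>If it can, diag(w, v) and the matrix with these diagonal entries and upper
        right entry 1 have trace 1, and so does their product. Both then lie in one minimal
        subgroup, and their quotient is the involution \<open>upper v\<close>.\<close>
      define v where "v = 1 / w"
      have wv: "w * v = 1" using w0 by (simp add: v_def)
      have v1: "w + v = 1"
      proof -
        have "w * (w + v - 1) = w^2 + w + 1 - 2 * w + (w * v - 1)" by Groebner_Basis.algebra
        then show ?thesis using w wv two w0 by simp
      qed
      let ?D = "m2 w 0 0 v"
      have D: "?D \<in> carrier SL2" using wv by (simp add: m2_carrier)
      obtain g where g: "g \<in> carrier SL2" "?D \<in> conjg SL2 g K" using conjA[OF D] v1 by auto
      let ?L = "conjg SL2 g K" and ?B = "m2 w 1 0 v"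
      have L: "minimal ?L" by (rule minimal_conjg[OF K g(1)])
      note Ls = cap_subgroup[OF minimal_cap[OF L]]
      have w1: "w \<noteq> 1"
      proof
        assume "w = 1"
        then have "(3::'k) = 0" using w by simp
        moreover have "(3::'k) = 2 + 1" by simp
        ultimately show False using two by simp
      qed
      have B: "?B \<in> carrier SL2" using wv by (simp add: m2_carrier)
      have DB: "?D ** ?B \<in> carrier SL2" using SL2.m_closed[OF D B] by simp
      have "trace (?D ** ?B) = (w + v)^2 - 2 * (w * v)" by (simp add: power2_eq_square algebra_simps)
      then have tDB: "trace (?D ** ?B) = 1" unfolding v1 wv using two by simp
      have "?D \<notin> center SL2" using w1 by (simp add: center_one one_SL2)
      then have "?B \<in> ?L"
        by (rule minimal_closed[OF L g(2) _ B g(2) _ g(2)])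
          (use same_trace_conj[OF B D] same_trace_conj[OF DB D] v1 tDB not4 in auto)
      then have "inv\<^bsub>SL2\<^esub> ?D \<otimes>\<^bsub>SL2\<^esub> ?B \<in> ?L"
        by (rule subgroup.m_closed[OF Ls subgroup.m_inv_closed[OF Ls g(2)]])
      moreover have "inv\<^bsub>SL2\<^esub> ?D \<otimes>\<^bsub>SL2\<^esub> ?B = upper v"
        using wv by (subst inv_SL2) (simp_all add: upper_def mult.commute)
      ultimately have vL: "upper v \<in> ?L" by simp
      have "v \<noteq> 0" using wv by auto
      then have "?L = range upper" by (rule minimal_with_upper[OF L vL])
      then show False using g(2) w1 by (auto simp: upper_def)
    qed
    obtain g where g: "g \<in> carrier SL2" "companion 1 \<in> conjg SL2 g K"
      using conjA[OF companion_carrier trace_companion] by blast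
    have "conjg SL2 g K = ord3"
    proof (rule subgroup_eq_ord3[OF two no cap_subgroup[OF minimal_cap[OF minimal_conjg[OF K g(1)]]] g(2)])
      fix B assume "B \<in> conjg SL2 g K"
      then obtain C where C: "C \<in> K" "B = g \<otimes>\<^bsub>SL2\<^esub> C \<otimes>\<^bsub>SL2\<^esub> inv\<^bsub>SL2\<^esub> g" unfolding conjg_def by blast
      then have "C \<in> carrier SL2" using Kc by blast
      then show "B = \<one>\<^bsub>SL2\<^esub> \<or> trace B = 1"
        using tr[OF C(1)] trace_conj[OF g(1)] g(1) unfolding C(2) by (auto simp del: mult_SL2)
    qed
    then show ?thesis using no g(1) by blast
  qed
qed

text \<open>A nontrivial diagonal element of this conjugate of \<open>H\<close> also lies in its
  conjugate by \<open>W\<close>. The intersection of the two is diagonal, and a minimal subgroup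
  inside it has an element of trace 1 whose entry is a root of w^2 + w + 1. That leaves only the
  type \<open>range upper\<close>, all of whose traces are 0.\<close>

lemma conj_with_uppers:
  assumes g: "g \<in> carrier SL2" and up: "range upper \<subseteq> conjg SL2 g H"
  shows "conjg SL2 g H = range upper"
proof (rule equalityI[OF _ up])
  let ?S = "conjg SL2 g H"
  have cap: "?S \<in> caps SL2 H" by (rule conj_cap[OF g])
  note Ss = cap_subgroup[OF cap] and Sc = cap_carrier[OF cap]
  have low: "c = 0" if "m2 x y c d \<in> ?S" for x y c d
    using subgroup_with_uppers[OF Ss _ that] up cap_proper[OF cap] by blast
  show "?S \<subseteq> range upper"
  proof
    fix A assume AS: "A \<in> ?S"
    then have "A \<in> carrier SL2" using Sc by blast
    then obtain x y z w where A: "A = m2 x y z w" "x * w - y * z = 1" by (rule m2_exhaust_SL2)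
    have z: "z = 0" using low AS A(1) by blast
    then have xw: "x * w = 1" using A(2) by simp
    have D: "m2 x 0 0 w \<in> ?S" using diagonal_part[OF Ss up] AS A(1) z by blast
    have "x = 1"
    proof (rule ccontr)
      assume x1: "x \<noteq> 1"
      let ?M = "?S \<inter> conjg SL2 W ?S"
      have M: "?M \<in> caps SL2 H"
        by (rule SL2.caps_Int[OF cap SL2.caps_conjg[OF H_carrier cap W_carrier]])
      have "inv\<^bsub>SL2\<^esub> (m2 x 0 0 w) \<in> ?S" by (rule subgroup.m_inv_closed[OF Ss D])
      then have "m2 w 0 0 x \<in> ?S" using xw by (simp add: inv_SL2)
      then have "m2 x 0 0 w \<in> ?M" using mem_conjg_W[OF Sc, of x w 0 0] xw D by simp
      moreover have "m2 x 0 0 w \<notin> center SL2" using x1 by (simp add: center_one one_SL2)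
      ultimately obtain K where K: "K \<subseteq> ?M" "minimal K" using minimal_exists[OF M] by blast
      note Kc = cap_carrier[OF minimal_cap[OF K(2)]]
      obtain B where B: "B \<in> K" "B \<noteq> \<one>\<^bsub>SL2\<^esub>"
        using cap_center[OF minimal_cap[OF K(2)]] minimal_ne_center[OF K(2)] center_one by blast
      have "B \<in> carrier SL2" using B(1) Kc by blast
      then obtain a b c d where B': "B = m2 a b c d" "a * d - b * c = 1" by (rule m2_exhaust_SL2)
      have BM: "m2 a b c d \<in> ?S" "m2 a b c d \<in> conjg SL2 W ?S" using B(1) K(1) B'(1) by auto
      have c: "c = 0" using low BM(1) by blast
      have "m2 d (- c) (- b) a \<in> ?S" using BM(2) mem_conjg_W[OF Sc B'(2)] by simp
      then have "- b = 0" using low by blast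
      then have b: "b = 0" by simp
      have ad: "a * d = 1" using B'(2) b c by simp
      have a1: "a \<noteq> 1" using B(2) B'(1) b c ad by (auto simp: one_SL2)
      have "a + d \<noteq> 0"
      proof
        assume "a + d = 0"
        then have "d = a" using char2_uminus[OF two, of d] by (simp add: add_eq_0_iff2)
        then have "a^2 = 1" using ad by (simp add: power2_eq_square)
        then show False using a1 char2_uminus[OF two, of 1] by (simp add: power2_eq_1_iff)
      qed
      then have t1: "a + d = 1" using minimal_trace_char2[OF K(2) B(1)] B'(1) by simp
      have "a^2 + a + 1 = a * (a + d) - (a * d - 1) + a" by Groebner_Basis.algebra
      then have w0: "a^2 + a + 1 = 0" unfolding t1 ad using two by (simp flip: mult_2)
      obtain h where h: "h \<in> carrier SL2" "conjg SL2 h K = range upper"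
        using minimal_cases[OF K(2)] w0 by blast
      have "h \<otimes>\<^bsub>SL2\<^esub> B \<otimes>\<^bsub>SL2\<^esub> inv\<^bsub>SL2\<^esub> h \<in> range upper"
        using B(1) unfolding h(2)[symmetric] conjg_def by blast
      then have "trace (h \<otimes>\<^bsub>SL2\<^esub> B \<otimes>\<^bsub>SL2\<^esub> inv\<^bsub>SL2\<^esub> h) = 0" using two by auto
      then show False using trace_conj[OF h(1)] B(1) Kc B'(1) t1 by (auto simp del: mult_SL2)
    qed
    then have "A = upper y" using A z xw by (simp add: upper_def)
    then show "A \<in> range upper" by blast
  qed
qed

lemma minimal_upper_type:
  assumes K: "minimal K" and g: "g \<in> carrier SL2" "conjg SL2 g K = range upper"
  shows "\<exists>h\<in>carrier SL2. conjg SL2 h H = range upper"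
proof -
  have "range upper \<in> caps SL2 H" using minimal_cap[OF minimal_conjg[OF K g(1)]] g(2) by simp
  from cap_in_conj[OF this] obtain h where h: "h \<in> carrier SL2" "range upper \<subseteq> conjg SL2 h H"
    by (rule bexE)
  show ?thesis using conj_with_uppers[OF h] h(1) by (rule bexI)
qed

lemma commutator_upper:
  assumes "x * w - y * z = (1::'k)" "m2 x y z w \<in> S" "subgroup S SL2"
    and nrm: "\<And>c. conjg SL2 (upper c) S = S"
  shows "m2 x y z w ** (upper s ** m2 w (- y) (- z) x ** upper (- s)) \<in> S"
proof -
  have "m2 w (- y) (- z) x \<in> S"
    using subgroup.m_inv_closed[OF assms(3,2)] inv_SL2[OF assms(1)] by simp
  then have "upper s \<otimes>\<^bsub>SL2\<^esub> m2 w (- y) (- z) x \<otimes>\<^bsub>SL2\<^esub> inv\<^bsub>SL2\<^esub> (upper s) \<in> conjg SL2 (upper s) S"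
    unfolding conjg_def by blast
  then have "upper s ** m2 w (- y) (- z) x ** upper (- s) \<in> S" using nrm by simp
  then show ?thesis using subgroup.m_closed[OF assms(3,2)] by simp
qed

text \<open>\<open>L\<close> is the smallest intersection of conjugates containing
  \<open>upper a\<close>. Since \<open>upper\<close> matrices commute, left multiplication by
  \<open>upper c\<close> preserves \<open>S\<close>, so \<open>upper c\<close> normalises
  \<open>L\<close>. A member that is not upper triangular makes the normaliser everything; an upper
  triangular one with x other than 1 yields all of \<open>range upper\<close> by commutators;
  otherwise \<open>L\<close> is unipotent and a minimal subgroup in it cannot be of type
  \<open>ord3\<close>.\<close>

lemma involution_case:
  assumes u: "u \<in> H" "u \<noteq> \<one>\<^bsub>SL2\<^esub>" "trace u = 0"
  shows "\<exists>h\<in>carrier SL2. conjg SL2 h H = range upper"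
proof -
  have uc: "u \<in> carrier SL2" using u(1) H_carrier by blast
  obtain a where a: "a \<noteq> 0" "sl2_conj u (upper a)" using trace_zero_conj[OF uc u(3,2)] by blast
  define S where "S = {g \<in> carrier SL2. upper a \<in> conjg SL2 g H}"
  have "\<exists>g\<in>carrier SL2. upper a \<in> conjg SL2 g H"
    by (rule sl2_conj_conjg[OF upper_carrier H_carrier sl2_conj_sym[OF uc upper_carrier a(2)] u(1)])
  then obtain g0 where g0: "g0 \<in> S" unfolding S_def by blast
  define L where "L = (\<Inter>g\<in>S. conjg SL2 g H)"
  have "S \<subseteq> carrier SL2" "S \<noteq> {}" using g0 unfolding S_def by auto
  then have cap: "L \<in> caps SL2 H" unfolding caps_def L_def by blast
  note Ls = cap_subgroup[OF cap] and Lc = cap_carrier[OF cap]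
  have aL: "upper a \<in> L" unfolding L_def S_def by blast
  have shift: "upper c \<otimes>\<^bsub>SL2\<^esub> g \<in> S" if "g \<in> S" for c g
  proof -
    have g: "g \<in> carrier SL2" "upper a \<in> conjg SL2 g H" using that unfolding S_def by auto
    have "upper a \<in> conjg SL2 (upper c) (conjg SL2 g H)"
      using g(2) unfolding SL2.mem_conjg[OF cap_carrier[OF conj_cap[OF g(1)]] upper_carrier] by simp
    then have "upper a \<in> conjg SL2 (upper c \<otimes>\<^bsub>SL2\<^esub> g) H"
      unfolding SL2.conjg_mult[OF H_carrier upper_carrier g(1)] .
    then show ?thesis using SL2.m_closed[OF upper_carrier g(1)] unfolding S_def by blast
  qed
  have nrm1: "conjg SL2 (upper c) L \<subseteq> L" for c
  proof
    fix A assume A: "A \<in> conjg SL2 (upper c) L"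
    have "A \<in> conjg SL2 g H" if g: "g \<in> S" for g
    proof -
      have gc: "g \<in> carrier SL2" using g unfolding S_def by blast
      have "L \<subseteq> conjg SL2 (upper (- c) \<otimes>\<^bsub>SL2\<^esub> g) H" unfolding L_def using shift[OF g] by blast
      also have "\<dots> = conjg SL2 (upper (- c)) (conjg SL2 g H)"
        by (rule SL2.conjg_mult[OF H_carrier upper_carrier gc, symmetric])
      finally have "conjg SL2 (upper c) L \<subseteq> conjg SL2 (upper c) (conjg SL2 (upper (- c)) (conjg SL2 g H))"
        unfolding conjg_def[of SL2 "upper c"] by (rule image_mono)
      also have "\<dots> = conjg SL2 g H"
        using SL2.conjg_inv_cancel(2)[OF cap_carrier[OF conj_cap[OF gc]] upper_carrier[of c]] by simp
      finally show ?thesis using A by blast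
    qed
    then show "A \<in> L" unfolding L_def by blast
  qed
  have nrm: "conjg SL2 (upper c) L = L" for c
  proof (rule equalityI[OF nrm1])
    have "conjg SL2 (upper c) (conjg SL2 (upper (- c)) L) \<subseteq> conjg SL2 (upper c) L"
      unfolding conjg_def[of SL2 "upper c"] by (rule image_mono[OF nrm1])
    then show "L \<subseteq> conjg SL2 (upper c) L"
      using SL2.conjg_inv_cancel(2)[OF Lc upper_carrier[of c]] by simp
  qed
  show ?thesis
  proof (cases "\<exists>x y z w. m2 x y z w \<in> L \<and> z \<noteq> 0")
    case True
    then obtain x y z w where A: "m2 x y z w \<in> L" "z \<noteq> 0" by blast
    have d: "x * w - y * z = 1" using A(1) Lc by (auto simp: m2_carrier subset_iff)
    define N where "N = {g \<in> carrier SL2. conjg SL2 g L = L}"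
    have N: "subgroup N SL2"
    proof (rule SL2.subgroupI)
      show "N \<noteq> {}" using nrm upper_carrier unfolding N_def by blast
      fix g assume "g \<in> N"
      then show "inv\<^bsub>SL2\<^esub> g \<in> N" using SL2.conjg_inv_cancel(1)[OF Lc, of g] unfolding N_def by auto
    next
      fix g h assume "g \<in> N" "h \<in> N"
      then show "g \<otimes>\<^bsub>SL2\<^esub> h \<in> N" using SL2.conjg_mult[OF Lc, of g h] SL2.m_closed[of g h]
        unfolding N_def by (auto simp del: mult_SL2)
    qed (auto simp: N_def)
    have LN: "g \<in> N" if g: "g \<in> L" for g
    proof -
      have gc: "g \<in> carrier SL2" using g Lc by blast
      have sub1: "conjg SL2 h L \<subseteq> L" if h: "h \<in> L" for h
        unfolding conjg_def using h subgroup.m_closed[OF Ls] subgroup.m_inv_closed[OF Ls] by blast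
      have "conjg SL2 g (conjg SL2 (inv\<^bsub>SL2\<^esub> g) L) \<subseteq> conjg SL2 g L"
        unfolding conjg_def[of SL2 g] by (rule image_mono[OF sub1[OF subgroup.m_inv_closed[OF Ls g]]])
      then have "L \<subseteq> conjg SL2 g L" using SL2.conjg_inv_cancel(2)[OF Lc gc] by simp
      then show ?thesis using sub1[OF g] gc unfolding N_def by blast
    qed
    have "N = carrier SL2"
      by (rule subgroup_with_uppers[OF N _ LN[OF A(1)] A(2)]) (use nrm in \<open>simp add: N_def\<close>)
    then have normal: "conjg SL2 g L \<subseteq> L" if "g \<in> carrier SL2" for g using that unfolding N_def by blast
    \<comment> \<open>The commutator with \<open>upper s\<close> has trace 2 + (s z)^2, which this
      choice turns into 1. A normal subgroup with such an element is all of SL2.\<close>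
    define s where "s = 1 / z"
    have sz: "s * z = 1" using A(2) by (simp add: s_def)
    let ?E = "m2 x y z w ** (upper s ** m2 w (- y) (- z) x ** upper (- s))"
    have E: "?E \<in> L" by (rule commutator_upper[OF d A(1) Ls nrm])
    have "trace ?E = 2 * (x * w - y * z) + (s * z)^2"
      by (simp add: upper_def power2_eq_square algebra_simps)
    then have "trace ?E = 1" unfolding d sz using two by simp
    then have "L = carrier SL2" using normal_subgroup_SL2[OF q4 Ls normal E] four by simp
    then show ?thesis using cap_proper[OF cap] by blast
  next
    case False
    show ?thesis
    proof (cases "\<exists>x y w. m2 x y 0 w \<in> L \<and> x \<noteq> 1")
      case True
      then obtain x y w where A: "m2 x y 0 w \<in> L" "x \<noteq> 1" by blast
      have d: "x * w - y * 0 = 1" using A(1) Lc by (auto simp: m2_carrier subset_iff)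
      have "x^2 \<noteq> 1" unfolding power2_eq_1_iff char2_uminus[OF two, of 1] using A(2) by simp
      then have x2: "x^2 - 1 \<noteq> 0" by simp
      have "upper b \<in> L" for b
      proof -
        \<comment> \<open>The commutator with \<open>upper s\<close> is
          \<open>upper ((x^2 - 1) * s)\<close>.\<close>
        define s where "s = b / (x^2 - 1)"
        have "(x^2 - 1) * s = b" using x2 by (simp add: s_def)
        then have s: "x^2 * s - s = b" by (simp add: left_diff_distrib)
        have xw: "x * w = 1" "w * x = 1" using d by (simp_all add: mult.commute)
        have "m2 x y 0 w ** (upper s ** m2 w (- y) (- 0) x ** upper (- s)) = upper (x^2 * s - s)"
        proof -
          have "x * (w * (- s) + (s * x - y)) + y * x = x^2 * s - s * (x * w)" by Groebner_Basis.algebra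
          then show ?thesis using xw by (simp add: upper_def algebra_simps power2_eq_square)
        qed
        then show ?thesis using commutator_upper[OF d A(1) Ls nrm, of s] s by simp
      qed
      then have "range upper \<subseteq> conjg SL2 g0 H" using g0 unfolding L_def by blast
      moreover have "g0 \<in> carrier SL2" using g0 unfolding S_def by blast
      ultimately show ?thesis using conj_with_uppers by blast
    next
      case False2: False
      have Lup: "L \<subseteq> range upper"
      proof
        fix A assume AL: "A \<in> L"
        then have "A \<in> carrier SL2" using Lc by blast
        then obtain x y z w where A: "A = m2 x y z w" "x * w - y * z = 1" by (rule m2_exhaust_SL2)
        have "z = 0" using False AL A(1) by blast
        moreover from this have "x = 1" using False2 AL A(1) by blast
        ultimately have "A = upper y" using A by (simp add: upper_def)
        then show "A \<in> range upper" by blast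
      qed
      have "L \<noteq> center SL2" using aL upper_not_center[OF a(1)] by blast
      then obtain K where K: "K \<subseteq> L" "minimal K" using minimal_exists[OF cap] by blast
      have "conjg SL2 g K \<noteq> ord3" if g: "g \<in> carrier SL2" for g
      proof
        assume "conjg SL2 g K = ord3"
        then have "companion 1 \<in> conjg SL2 g K" by (simp add: ord3_def)
        then obtain A where A: "A \<in> K" "companion 1 = g \<otimes>\<^bsub>SL2\<^esub> A \<otimes>\<^bsub>SL2\<^esub> inv\<^bsub>SL2\<^esub> g"
          unfolding conjg_def by blast
        have "A \<in> carrier SL2" using A(1) K Lc by blast
        then have "trace A = 1" using trace_conj[OF g, of A] A(2) trace_companion by metis
        moreover have "trace A = 2" using A(1) K(1) Lup by auto
        ultimately show False using two by simp
      qed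
      then show ?thesis using minimal_cases[OF K(2)] minimal_upper_type[OF K(2)] by blast
    qed
  qed
qed

end

end

section \<open>Characteristic two: subgroups without involutions\<close>

context helly_subgroup
begin

context
  assumes two: "(2::'k) = 0" and no_involution: "\<And>u. u \<in> H \<Longrightarrow> trace u = 0 \<Longrightarrow> u = \<one>\<^bsub>SL2\<^esub>"
    and nontrivial: "H \<noteq> center SL2"
begin

lemma conj_no_involution:
  assumes g: "g \<in> carrier SL2" and A: "A \<in> conjg SL2 g H" "trace A = 0"
  shows "A = \<one>\<^bsub>SL2\<^esub>"
proof -
  obtain B where B: "B \<in> H" "A = g \<otimes>\<^bsub>SL2\<^esub> B \<otimes>\<^bsub>SL2\<^esub> inv\<^bsub>SL2\<^esub> g" using A(1) unfolding conjg_def by blast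
  then have "B \<in> carrier SL2" using H_carrier by blast
  then have "trace B = 0" using A(2) trace_conj[OF g] unfolding B(2) by metis
  then have "B = \<one>\<^bsub>SL2\<^esub>" using no_involution B(1) by blast
  then show ?thesis using g by (simp add: B(2) del: mult_SL2)
qed

lemma all_minimal_ord3:
  shows "\<forall>w::'k. w^2 + w + 1 \<noteq> 0" and "\<exists>L. minimal L \<and> L = ord3"
    and "\<exists>A\<in>H. trace A = 1"
proof -
  obtain K where K: "K \<subseteq> H" "minimal K"
    using minimal_exists[OF SL2.self_in_caps[OF H_carrier] nontrivial] by blast
  have "conjg SL2 g K \<noteq> range upper" if g: "g \<in> carrier SL2" for g
  proof
    assume "conjg SL2 g K = range upper"
    then have "upper (1::'k) \<in> conjg SL2 g H" using K(1) unfolding conjg_def by blast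
    then have "upper (1::'k) = \<one>\<^bsub>SL2\<^esub>" using conj_no_involution[OF g, of "upper 1"] two by simp
    then show False by (simp add: upper_def one_SL2)
  qed
  then obtain g where g: "\<forall>w::'k. w^2 + w + 1 \<noteq> 0" "g \<in> carrier SL2" "conjg SL2 g K = ord3"
    using minimal_cases[OF two K(2)] by blast
  show "\<forall>w::'k. w^2 + w + 1 \<noteq> 0" by (rule g(1))
  show "\<exists>L. minimal L \<and> L = ord3" using minimal_conjg[OF K(2) g(2)] g(3) by auto
  have "companion 1 \<in> conjg SL2 g K" unfolding g(3) by (simp add: ord3_def)
  then obtain A where A: "A \<in> K" "companion 1 = g \<otimes>\<^bsub>SL2\<^esub> A \<otimes>\<^bsub>SL2\<^esub> inv\<^bsub>SL2\<^esub> g"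
    unfolding conjg_def by blast
  have "A \<in> carrier SL2" using A(1) K(1) H_carrier by blast
  then have "trace A = 1" using trace_conj[OF g(2), of A] A(2) trace_companion by metis
  then show "\<exists>A\<in>H. trace A = 1" using A(1) K(1) by blast
qed

lemma not_four: "(1::'k)^2 \<noteq> 4" using four[OF two] by simp

lemma trace_one_in_minimal:
  assumes "B \<in> carrier SL2" "trace B = 1"
  shows "\<exists>L. minimal L \<and> B \<in> L"
proof -
  obtain L where L: "minimal L" "L = ord3" using all_minimal_ord3(2) by blast
  have "companion 1 \<in> L" unfolding L(2) by (simp add: ord3_def)
  then show ?thesis
    by (rule conj_into_minimal[OF L(1) _ assms(1) same_trace_conj[OF assms(1) companion_carrier]])
      (use assms(2) not_four in auto)
qed

text \<open>The Helly property applied to the minimal subgroups containing \<open>B\<close> and \<open>B ** Y\<close> and to the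
  conjugate of \<open>H\<close> containing \<open>Y\<close>.\<close>

lemma trace_one_factor:
  assumes g: "g \<in> carrier SL2" and Y: "Y \<in> conjg SL2 g H" "trace Y \<noteq> 0" "trace Y \<noteq> 1"
    and B: "B \<in> carrier SL2" "trace B = 1" "trace (B ** Y) = 1"
  shows "B \<in> conjg SL2 g H"
proof -
  have cap: "conjg SL2 g H \<in> caps SL2 H" by (rule conj_cap[OF g])
  have Yc: "Y \<in> carrier SL2" using Y(1) cap_carrier[OF cap] by blast
  have BY: "B ** Y \<in> carrier SL2" using SL2.m_closed[OF B(1) Yc] by simp
  obtain L1 where L1: "minimal L1" "B \<in> L1" using trace_one_in_minimal[OF B(1,2)] by blast
  obtain L3 where L3: "minimal L3" "B ** Y \<in> L3" using trace_one_in_minimal[OF BY B(3)] by blast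
  note sg = cap_subgroup[OF minimal_cap[OF L1(1)]]
  have ne: "L1 \<noteq> L3"
  proof
    assume "L1 = L3"
    then have "inv\<^bsub>SL2\<^esub> B \<otimes>\<^bsub>SL2\<^esub> (B \<otimes>\<^bsub>SL2\<^esub> Y) \<in> L1"
      using subgroup.m_closed[OF sg subgroup.m_inv_closed[OF sg L1(2)]] L3(2) by simp
    then have "Y \<in> L1" using SL2.inv_cancel_assoc(1)[OF B(1) Yc] by simp
    then show False using minimal_trace_char2[OF two L1(1)] Y(2,3) by blast
  qed
  obtain u where u: "u \<in> L1 \<inter> L3" "inv\<^bsub>SL2\<^esub> B \<otimes>\<^bsub>SL2\<^esub> u \<in> conjg SL2 g H"
    using SL2.helly_triple[OF sub hel minimal_cap[OF L1(1)] cap minimal_cap[OF L3(1)] L1(2) Y(1)] L3(2)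
    by auto
  have "u = \<one>\<^bsub>SL2\<^esub>" using SL2.mincap_Int[OF L1(1) L3(1)] ne u(1) center_one[OF two] by blast
  then have "inv\<^bsub>SL2\<^esub> B \<in> conjg SL2 g H" using u(2) B(1) by (simp del: mult_SL2)
  then have "inv\<^bsub>SL2\<^esub> (inv\<^bsub>SL2\<^esub> B) \<in> conjg SL2 g H"
    by (rule subgroup.m_inv_closed[OF cap_subgroup[OF cap]])
  then show ?thesis using B(1) by simp
qed

text \<open>\<open>trace_one_factor\<close> supplies a one-parameter family of matrices in the
  conjugate. A quotient of two of them moves the diagonal \<open>Y\<close> to a triangular but not
  diagonal matrix with the same eigenvalues, and the commutator with \<open>Y\<close> is a forbidden
  involution.\<close>

lemma split_case:
  assumes g: "g \<in> carrier SL2" and Y: "m2 v 0 0 v' \<in> conjg SL2 g H" "v * v' = 1"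
    and t: "v + v' \<noteq> 0" "v + v' \<noteq> 1"
  shows False
proof -
  let ?S = "conjg SL2 g H" and ?Y = "m2 v 0 0 v'"
  have S: "subgroup ?S SL2" by (rule cap_subgroup[OF conj_cap[OF g]])
  have m: "A ** B \<in> ?S" if "A \<in> ?S" "B \<in> ?S" for A B using subgroup.m_closed[OF S that] by simp
  \<comment> \<open>The solution of p + w = 1 and p v + w v' = 1: these diagonal entries give
    \<open>B\<close> and \<open>B ** ?Y\<close> trace 1. The product of the off-diagonal entries is
    then fixed as n = p w - 1, and their ratio is free.\<close>
  define p w where "p = 1 / (v + 1)" and "w = v / (v + 1)"
  have vv: "v \<noteq> v'" "v + 1 \<noteq> 0"
  proof -
    show "v \<noteq> v'" using t(1) two by (metis mult_2 mult_zero_left)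
    show "v + 1 \<noteq> 0"
    proof
      assume "v + 1 = 0"
      then have "v = 1" using char2_uminus[OF two, of 1] by (metis eq_neg_iff_add_eq_0)
      then show False using Y(2) t(1) two by simp
    qed
  qed
  have pw: "p + w = 1" "p * v + w * v' = 1"
  proof -
    show "p + w = 1" using vv(2) by (simp add: p_def w_def add_divide_distrib[symmetric] add.commute)
    have "w * v' = 1 / (v + 1)" using Y(2) by (simp add: w_def)
    then show "p * v + w * v' = 1" using vv(2) by (simp add: p_def add_divide_distrib[symmetric])
  qed
  define n where "n = p * w - 1"
  have v1: "(v + 1) * (v' + 1) = v + v'"
  proof -
    have "(v + 1) * (v' + 1) = v * v' + 1 + (v + v')" by Groebner_Basis.algebra
    then show ?thesis unfolding Y(2) using two by simp
  qed
  have pwt: "p * w * (v + v') = 1"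
  proof -
    have "(v + 1) * (v + 1) = v * (v + v') + 2 * v + (1 - v * v')" by Groebner_Basis.algebra
    then have "(v + 1) * (v + 1) = v * (v + v')" using Y(2) two by simp
    moreover have "v \<noteq> 0" using Y(2) by auto
    ultimately show ?thesis using vv(2) t(1) by (simp add: p_def w_def)
  qed
  then have pw0: "p * w \<noteq> 0" by auto
  have n0: "n \<noteq> 0"
  proof
    assume "n = 0"
    then have "p * w = 1" by (simp add: n_def)
    then show False using pwt t(2) by simp
  qed
  have BS: "m2 p c (n / c) w \<in> ?S" if c: "c \<noteq> 0" for c
  proof (rule trace_one_factor[OF g Y(1)])
    show "m2 p c (n / c) w \<in> carrier SL2" using c by (simp add: m2_carrier n_def)
  qed (use t pw in auto)
  \<comment> \<open>This c makes the upper left entry p w - c n of the quotient vanish, so that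
    conjugating \<open>?Y\<close> by it gives a lower triangular matrix. Nonzero
    \<open>\<gamma>\<close> and \<open>\<delta>\<close> keep that matrix from being
    diagonal.\<close>
  define c where "c = p * w / n"
  have c0: "c \<noteq> 0" and cn: "c * n = p * w" using pw0 n0 by (simp_all add: c_def)
  have c1: "c \<noteq> 1" using cn by (auto simp: n_def)
  have "inv\<^bsub>SL2\<^esub> (m2 p 1 (n / 1) w) \<in> ?S" by (rule subgroup.m_inv_closed[OF S BS]) simp
  then have "m2 w (- 1) (- n) p \<in> ?S" by (subst (asm) inv_SL2) (simp_all add: n_def)
  then have "m2 p c (n / c) w ** m2 w (- 1) (- n) p \<in> ?S" by (rule m[OF BS[OF c0]])
  moreover define \<beta> \<gamma> \<delta> where "\<beta> = p * (c - 1)" and "\<gamma> = w * (n / c - n)" and "\<delta> = w * p - n / c"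
  have "m2 p c (n / c) w ** m2 w (- 1) (- n) p = m2 0 \<beta> \<gamma> \<delta>"
    using cn by (simp add: \<beta>_def \<gamma>_def \<delta>_def algebra_simps)
  ultimately have M: "m2 0 \<beta> \<gamma> \<delta> \<in> ?S" by simp
  have det: "- (\<beta> * \<gamma>) = 1" using subgroup.mem_carrier[OF S M] by (simp add: m2_carrier)
  then have \<gamma>0: "\<gamma> \<noteq> 0" by auto
  have \<delta>0: "\<delta> \<noteq> 0"
  proof
    assume "\<delta> = 0"
    then have "w * p * c = n" using c0 by (simp add: \<delta>_def field_simps)
    then have "p * w * (c * n) = n^2" by (simp add: power2_eq_square algebra_simps)
    then have "(p * w)^2 = n^2" unfolding cn by (simp add: power2_eq_square)
    then have "p * w = n \<or> p * w = - n" by (simp add: power2_eq_iff)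
    then have "p * w = n" using char2_uminus[OF two, of n] by simp
    then show False by (simp add: n_def)
  qed
  have iM: "m2 \<delta> (- \<beta>) (- \<gamma>) 0 \<in> ?S"
    using subgroup.m_inv_closed[OF S M] inv_SL2[of 0 \<delta> \<beta> \<gamma>] det by simp
  define r where "r = \<gamma> * \<delta> * (v - v')"
  have r0: "r \<noteq> 0" using \<gamma>0 \<delta>0 vv(1) by (simp add: r_def)
  have "m2 0 \<beta> \<gamma> \<delta> ** ?Y ** m2 \<delta> (- \<beta>) (- \<gamma>) 0 \<in> ?S" by (intro m M Y(1) iM)
  moreover have "m2 0 \<beta> \<gamma> \<delta> ** ?Y ** m2 \<delta> (- \<beta>) (- \<gamma>) 0
      = m2 (v' * (- (\<beta> * \<gamma>))) 0 r (v * (- (\<beta> * \<gamma>)))"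
    by (simp add: r_def algebra_simps)
  ultimately have Q: "m2 v' 0 r v \<in> ?S" unfolding det by simp
  have iQ: "m2 v 0 (- r) v' \<in> ?S"
    using subgroup.m_inv_closed[OF S Q] inv_SL2[of v' v 0 r] Y(2) by (simp add: mult.commute)
  have iY: "m2 v' 0 0 v \<in> ?S"
    using subgroup.m_inv_closed[OF S Y(1)] inv_SL2[of v v' 0 0] Y(2) by simp
  \<comment> \<open>The commutator of \<open>?Y\<close> with its triangular conjugate.\<close>
  have "?Y ** m2 v' 0 r v ** m2 v' 0 0 v ** m2 v 0 (- r) v' \<in> ?S" by (intro m Y(1) Q iY iQ)
  moreover have "?Y ** m2 v' 0 r v ** m2 v' 0 0 v ** m2 v 0 (- r) v' = m2 1 0 (r * (v' - v)) 1"
  proof -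
    have e: "v * v' = 1" "v' * v = 1" using Y(2) by (simp_all add: mult.commute)
    have "v * v' * v' * v = 1" "v' * v * v * v' = 1" using e by (simp_all add: mult.assoc)
    moreover have "v' * r * v' * v + v' * v * v * (- r) = r * (v' * (v' * v) - v * (v' * v))"
      by Groebner_Basis.algebra
    ultimately show ?thesis using e by simp
  qed
  ultimately have "m2 1 0 (r * (v' - v)) 1 \<in> ?S" by simp
  then have "m2 1 0 (r * (v' - v)) 1 = \<one>\<^bsub>SL2\<^esub>"
    by (rule conj_no_involution[OF g]) (use two in simp)
  then show False using r0 vv(1) by (simp add: one_SL2)
qed

text \<open>Without roots the conic has at least q + 1 points, so the conjugate has more than q^2
  elements. Having no involution it meets \<open>range upper\<close> trivially, which bounds its
  order by q^2 - 1.\<close>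

lemma nonsplit_case:
  assumes g: "g \<in> carrier SL2" and Y: "companion t \<in> conjg SL2 g H"
    and t: "t \<noteq> 0" "t \<noteq> 1" and no_root: "{v. v^2 + t * v + 1 = 0} = {}"
  shows False
proof -
  let ?S = "conjg SL2 g H"
  have cap: "?S \<in> caps SL2 H" by (rule conj_cap[OF g])
  note Ss = cap_subgroup[OF cap] and Sc = cap_carrier[OF cap]
  have t4: "t^2 \<noteq> 4" using t(1) four[OF two] by simp
  have t2: "t + 2 = t" using two by simp
  \<comment> \<open>Since t + 2 = t here, this k gives both traces the value 1, as
    \<open>trace_one_factor\<close> demands. The condition t other than 1 keeps the constant of the
    conic nonzero.\<close>
  define k where "k = 1 / t"
  have k: "k \<noteq> 0" "k * t = 1" using t(1) by (simp_all add: k_def)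
  have m: "k^2 * (t + 2) - 1 \<noteq> 0"
  proof -
    have "t * (k^2 * t - 1) = (k * t)^2 - t" by Groebner_Basis.algebra
    then have "t * (k^2 * t - 1) = 1 - t" unfolding k(2) by simp
    then show ?thesis using t(2) unfolding t2 by auto
  qed
  let ?C = "conic t (k^2 * (t + 2) - 1)"
  have "conic_matrix k t u \<in> ?S" if u: "u \<in> ?C" for u
  proof (rule trace_one_factor[OF g Y])
    show "conic_matrix k t u \<in> carrier SL2" by (rule conic_matrix_carrier[OF u])
    show "trace (conic_matrix k t u) = 1" using trace_conic_matrix(1)[of k t u] k(2) t2 by simp
    have "trace (conic_matrix k t u ** companion t) = trace (companion t ** conic_matrix k t u)"
      by (rule trace_mul_sym)
    then show "trace (conic_matrix k t u ** companion t) = 1"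
      using trace_conic_matrix(2)[of t k u] k(2) t2 by simp
  qed (use t in simp_all)
  then have sub: "conic_matrix k t ` ?C \<subseteq> ?S" by blast
  have "CARD('k) + 1 \<le> card ?C + card {v. v^2 + t * v + 1 = 0}" by (rule card_conic[OF t4 m])
  then have e: "CARD('k) + 1 \<le> card ?C" unfolding no_root by simp
  have "card ?C * (card ?C - 1) + 1 \<le> card ?S"
    by (rule card_subgroup_conic[OF t4 k(1) m Ss sub refl])
  moreover have "(CARD('k) + 1) * CARD('k) \<le> card ?C * (card ?C - 1)" using e by (intro mult_mono) auto
  ultimately have lb: "CARD('k)^2 < card ?S" by (simp add: power2_eq_square)
  have "?S \<inter> range upper = {\<one>\<^bsub>SL2\<^esub>}"
  proof
    show "{\<one>\<^bsub>SL2\<^esub>} \<subseteq> ?S \<inter> range upper"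
      using subgroup.one_closed[OF Ss] subgroup.one_closed[OF subgroup_range_upper] by blast
    show "?S \<inter> range upper \<subseteq> {\<one>\<^bsub>SL2\<^esub>}"
      using conj_no_involution[OF g] two by auto
  qed
  then have "card ?S * card (range (upper :: 'k \<Rightarrow> _)) \<le> card (carrier (SL2 :: ('k ^ 2 ^ 2) monoid)) * 1"
    using SL2.card_subgroups_le[OF finite_carrier_SL2 Ss subgroup_range_upper] by simp
  then have "card ?S * CARD('k) \<le> (CARD('k)^2 - 1) * CARD('k)"
    unfolding card_range_upper card_SL2 by (simp add: mult.commute)
  then have "card ?S \<le> CARD('k)^2 - 1" using q4 by simp
  then show False using lb by simp
qed

text \<open>A trace t other than 0 and 1 is impossible: according to whether v^2 + t v + 1 has a
  root, a conjugate of \<open>H\<close> contains a diagonal matrix or \<open>companion t\<close> as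
  in the two preceding lemmas. So all nontrivial traces in \<open>H\<close> are 1.\<close>

lemma order_three_case:
  shows "(\<forall>w::'k. w^2 + w + 1 \<noteq> 0) \<and> (\<exists>g\<in>carrier SL2. conjg SL2 g H = ord3)"
proof (cases "\<exists>y\<in>H. trace y \<noteq> 0 \<and> trace y \<noteq> 1")
  case True
  then obtain y where y: "y \<in> H" "trace y \<noteq> 0" "trace y \<noteq> 1" by blast
  define t where "t = trace y"
  have yc: "y \<in> carrier SL2" using y(1) H_carrier by blast
  have t4: "t^2 \<noteq> 4" using y(2) four[OF two] by (simp add: t_def)
  have rep: "\<exists>g\<in>carrier SL2. Y \<in> conjg SL2 g H" if "Y \<in> carrier SL2" "trace Y = t" for Y
    by (rule sl2_conj_conjg[OF that(1) H_carrier same_trace_conj[OF that(1) yc] y(1)])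
      (use that t4 in \<open>simp_all add: t_def\<close>)
  have False
  proof (cases "{v. v^2 + t * v + 1 = 0} = {}")
    case True
    obtain g where "g \<in> carrier SL2" "companion t \<in> conjg SL2 g H"
      using rep[OF companion_carrier trace_companion] by blast
    then show False using nonsplit_case[OF _ _ _ _ True] y(2,3) by (simp add: t_def)
  next
    case False
    then obtain v where v: "v^2 + t * v + 1 = 0" by blast
    then have v0: "v \<noteq> 0" by auto
    define v' where "v' = 1 / v"
    have vv': "v * v' = 1" using v0 by (simp add: v'_def)
    have "v * (v + v' - t) = v^2 + t * v + 1 + (v * v' - 1) - 2 * (t * v)" by Groebner_Basis.algebra
    then have "v + v' = t" using v vv' two v0 by simp
    moreover obtain g where "g \<in> carrier SL2" "m2 v 0 0 v' \<in> conjg SL2 g H"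
      using rep[of "m2 v 0 0 v'"] vv' \<open>v + v' = t\<close> by (auto simp: m2_carrier)
    ultimately show False using split_case[OF _ _ vv'] y(2,3) by (simp add: t_def)
  qed
  then show ?thesis ..
next
  case False
  have tr: "A = \<one>\<^bsub>SL2\<^esub> \<or> trace A = 1" if "A \<in> H" for A
    using that False no_involution by blast
  obtain A where A: "A \<in> H" "trace A = 1" using all_minimal_ord3(3) by blast
  have Ac: "A \<in> carrier SL2" using A(1) H_carrier by blast
  have "\<exists>g\<in>carrier SL2. companion 1 \<in> conjg SL2 g H"
    by (rule sl2_conj_conjg[OF companion_carrier H_carrier same_trace_conj[OF companion_carrier Ac] A(1)])
      (use A(2) not_four in simp_all)
  then obtain g where g: "g \<in> carrier SL2" "companion 1 \<in> conjg SL2 g H" by blast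
  have "conjg SL2 g H = ord3"
  proof (rule subgroup_eq_ord3[OF two _ cap_subgroup[OF conj_cap[OF g(1)]] g(2)])
    fix B assume "B \<in> conjg SL2 g H"
    then obtain C where C: "C \<in> H" "B = g \<otimes>\<^bsub>SL2\<^esub> C \<otimes>\<^bsub>SL2\<^esub> inv\<^bsub>SL2\<^esub> g" unfolding conjg_def by blast
    then have "C \<in> carrier SL2" using H_carrier by blast
    then show "B = \<one>\<^bsub>SL2\<^esub> \<or> trace B = 1"
      using tr[OF C(1)] trace_conj[OF g(1)] g(1) unfolding C(2) by (auto simp del: mult_SL2)
  qed (use all_minimal_ord3(1) in blast)
  then show ?thesis using all_minimal_ord3(1) g(1) by blast
qed

end

lemma helly_subgroup_cases:
  shows "H = center SL2 \<or>
    ((2::'k) = 0 \<and> (\<exists>g\<in>carrier SL2. conjg SL2 g H = range upper)) \<or>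
    ((2::'k) = 0 \<and> (\<forall>w::'k. w^2 + w + 1 \<noteq> 0) \<and> (\<exists>g\<in>carrier SL2. conjg SL2 g H = ord3))"
proof (cases "(2::'k) = 0")
  case True
  show ?thesis
  proof (cases "\<exists>u\<in>H. u \<noteq> \<one>\<^bsub>SL2\<^esub> \<and> trace u = 0")
    case True
    then show ?thesis using involution_case[OF \<open>2 = 0\<close>] \<open>2 = 0\<close> by blast
  next
    case False
    then show ?thesis using order_three_case[OF \<open>2 = 0\<close>] \<open>2 = 0\<close> by blast
  qed
qed (use odd_char_trivial in blast)

end

section \<open>Cube roots of unity in fields with \<open>2\<^sup>a\<close> elements\<close>

lemma four_power_mod_3: "\<exists>n. (4::nat) ^ b = 3 * n + 1"
proof (induction b)
  case (Suc b)
  then obtain n where "(4::nat) ^ b = 3 * n + 1" by blast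
  then show ?case by (intro exI[of _ "4 * n + 1"]) simp
qed simp

text \<open>For even a, q - 1 = 3 m; at most m elements satisfy x^m = 1, so some x^m is a nontrivial
  cube root of unity. For odd a, q - 1 is 1 modulo 3, so w^3 = 1 forces w = 1, which is no root in
  characteristic two.\<close>

lemma no_cube_root_iff_odd:
  assumes q: "CARD('k::{field,finite}) = 2 ^ a"
  shows "(\<forall>w::'k. w^2 + w + 1 \<noteq> 0) \<longleftrightarrow> odd a"
proof
  assume no: "\<forall>w::'k. w^2 + w + 1 \<noteq> 0"
  show "odd a"
  proof
    assume "even a"
    then obtain b where b: "a = 2 * b" by blast
    have q4: "CARD('k) = 4 ^ b" by (simp add: q b power_mult)
    then obtain m where m: "CARD('k) - 1 = 3 * m" using four_power_mod_3[of b] by auto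
    have q1: "CARD('k) > 1"
      using card_mono[of UNIV "{0, 1::'k}"] by simp
    then have m0: "m > 0" using m by (cases m) auto
    let ?p = "Polynomial.monom 1 m - 1 :: 'k poly"
    have deg: "Polynomial.degree ?p = m"
      using m0 degree_add_eq_left[of "- 1" "Polynomial.monom (1::'k) m"]
      by (simp add: degree_monom_eq)
    then have "?p \<noteq> 0" using m0 by auto
    then have "card {x. poly ?p x = 0} \<le> m" using card_poly_roots_bound[of ?p] deg by simp
    moreover have "card (UNIV - {0::'k}) = 3 * m" using m by simp
    ultimately have "\<not> UNIV - {0::'k} \<subseteq> {x. poly ?p x = 0}"
      using m0 card_mono[of "{x. poly ?p x = 0}" "UNIV - {0::'k}"] by auto
    then obtain x :: 'k where x: "x \<noteq> 0" "x ^ m \<noteq> 1" by (auto simp: poly_monom)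
    have "(x ^ m)^3 = 1" using fermat_finite_field[OF x(1)] m by (simp add: power_mult[symmetric] mult.commute)
    moreover have "(x ^ m)^3 - 1 = (x ^ m - 1) * ((x ^ m)^2 + x ^ m + 1)" by Groebner_Basis.algebra
    ultimately show False using no x(2) by auto
  qed
next
  assume a: "odd a"
  show "\<forall>w::'k. w^2 + w + 1 \<noteq> 0"
  proof (intro allI notI)
    fix w :: 'k assume w: "w^2 + w + 1 = 0"
    then have w0: "w \<noteq> 0" by auto
    have "w^3 - 1 = (w - 1) * (w^2 + w + 1)" by Groebner_Basis.algebra
    then have w3: "w^3 = 1" using w by simp
    obtain b where b: "a = 2 * b + 1" using a by (rule oddE)
    obtain n where n: "(4::nat) ^ b = 3 * n + 1" using four_power_mod_3 by blast
    have "CARD('k) - 1 = 3 * (2 * n) + 1" by (simp add: q b power_mult n)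
    then have "w ^ (3 * (2 * n) + 1) = 1" using fermat_finite_field[OF w0] by simp
    then have "w = 1" unfolding power_add power_mult w3 by simp
    then have "(1::'k) + 2 = 0" using w by simp
    then show False using char2_if_even_card[OF q] by simp
  qed
qed

section \<open>The Helly subgroups\<close>

context group
begin

lemma translates_conjg:
  assumes "H \<subseteq> carrier G" "g \<in> carrier G"
  shows "translates G (conjg G g H) \<subseteq> translates G H"
proof
  fix A assume "A \<in> translates G (conjg G g H)"
  then obtain a b where ab: "a \<in> carrier G" "b \<in> carrier G" "A = (\<lambda>h. a \<otimes> h \<otimes> b) ` conjg G g H"
    by (rule translatesE)
  have "A = (\<lambda>h. (a \<otimes> g) \<otimes> h \<otimes> (inv g \<otimes> b)) ` H"
    unfolding ab(3) conjg_def image_image using ab assms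
    by (intro image_cong) (auto simp: m_assoc subsetD)
  then show "A \<in> translates G H" using translatesI ab assms(2) by (metis inv_closed m_closed)
qed

lemma helly_conjg:
  assumes "H \<subseteq> carrier G" "g \<in> carrier G"
  shows "helly G (conjg G g H) \<longleftrightarrow> helly G H"
proof -
  have c: "conjg G g H \<subseteq> carrier G" using assms by (auto simp: conjg_def)
  have "translates G H \<subseteq> translates G (conjg G g H)"
    using translates_conjg[OF c inv_closed[OF assms(2)]] conjg_inv_cancel(1)[OF assms] by simp
  then have "translates G (conjg G g H) = translates G H" using translates_conjg[OF assms] by blast
  then show ?thesis unfolding helly_def by simp
qed

lemma helly_one: "helly G {\<one>}"
proof (rule hellyI[OF triv_subgroup])
  fix g1 g2 assume g: "g1 \<in> carrier G" "g2 \<in> carrier G" "conjg G g1 {\<one>} \<noteq> conjg G g2 {\<one>}"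
  then have "conjg G g1 {\<one>} = conjg G g2 {\<one>}" by (simp add: conjg_def)
  then show "a = \<one> \<or> b = \<one>" for a b using g(3) by blast
qed

lemma regular_trivial:
  "regular_action G (rcosets {\<one>}) (\<lambda>C g. C #> g)"
proof -
  have r: "{\<one>} #> x = {x}" if "x \<in> carrier G" for x using that by (simp add: r_coset_def)
  have m: "{x} #> g = {x \<otimes> g}" for x g by (simp add: r_coset_def)
  have "rcosets {\<one>} = (\<lambda>x. {x}) ` carrier G" unfolding RCOSETS_def using r by auto
  moreover have "\<exists>!g. g \<in> carrier G \<and> {x \<otimes> g} = {y}" if "x \<in> carrier G" "y \<in> carrier G" for x y
  proof (rule ex1I)
    show "inv x \<otimes> y \<in> carrier G \<and> {x \<otimes> (inv x \<otimes> y)} = {y}"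
      using that by (simp add: group_norm)
    fix g assume "g \<in> carrier G \<and> {x \<otimes> g} = {y}"
    then show "g = inv x \<otimes> y" using that by (auto simp: group_norm)
  qed
  ultimately show ?thesis unfolding regular_action_def by (auto simp: m)
qed

lemma pow_card_subgroup:
  assumes "subgroup H G" "x \<in> H" "finite H"
  shows "x [^] card H = \<one>"
proof -
  interpret K: group "G\<lparr>carrier := H\<rparr>" by (rule subgroup.subgroup_is_group[OF assms(1) is_group])
  have "x [^]\<^bsub>G\<lparr>carrier := H\<rparr>\<^esub> order (G\<lparr>carrier := H\<rparr>) = \<one>\<^bsub>G\<lparr>carrier := H\<rparr>\<^esub>"
    by (rule K.pow_order_eq_1) (use assms in simp_all)
  then show ?thesis using nat_pow_consistent[of x "card H" H] by (simp add: order_def)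
qed

end

section \<open>Helly property of the unipotent group and of the group of order three\<close>

lemma trace_conjg_all:
  assumes "S \<subseteq> carrier SL2" "g \<in> carrier SL2" "B \<in> conjg SL2 g S"
  shows "\<exists>A\<in>S. trace A = trace B \<and> (B = \<one>\<^bsub>SL2\<^esub> \<longleftrightarrow> A = \<one>\<^bsub>SL2\<^esub>)"
proof -
  obtain A where A: "A \<in> S" "B = g \<otimes>\<^bsub>SL2\<^esub> A \<otimes>\<^bsub>SL2\<^esub> inv\<^bsub>SL2\<^esub> g" using assms(3) unfolding conjg_def by blast
  have Ac: "A \<in> carrier SL2" using A(1) assms(1) by blast
  have "A = \<one>\<^bsub>SL2\<^esub>" if "B = \<one>\<^bsub>SL2\<^esub>"
  proof -
    have "inv\<^bsub>SL2\<^esub> g \<otimes>\<^bsub>SL2\<^esub> B \<otimes>\<^bsub>SL2\<^esub> g = A"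
      using A(2) Ac assms(2) by (simp add: SL2.group_norm del: mult_SL2)
    then show ?thesis using that assms(2) by (simp del: mult_SL2)
  qed
  moreover have "B = \<one>\<^bsub>SL2\<^esub>" if "A = \<one>\<^bsub>SL2\<^esub>" using A(2) that assms(2) by (simp del: mult_SL2)
  ultimately show ?thesis using A trace_conj[OF assms(2) Ac] by metis
qed

text \<open>The trace of \<open>upper s ** B\<close> exceeds that of \<open>B\<close> by s times the
  lower left entry, which therefore vanishes; trace 0 and determinant 1 then force both diagonal
  entries to be 1.\<close>

lemma unipotent_product_upper:
  assumes two: "(2::'k::field) = 0" and s: "s \<noteq> (0::'k)"
    and B: "B \<in> carrier SL2" "trace B = 0" "trace (upper s ** B) = 0"
  shows "B \<in> range upper"
proof -
  obtain x y z w where xyzw: "B = m2 x y z w" "x * w - y * z = 1" by (rule m2_exhaust_SL2[OF B(1)])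
  have xw: "x + w = 0" using B(2) xyzw(1) by simp
  have "s * z + (x + w) = 0" using B(3) by (simp add: xyzw(1) upper_def algebra_simps)
  then have z: "z = 0" using xw s by simp
  have wx: "w = x" using xw char2_uminus[OF two, of w] by (metis add_eq_0_iff2)
  then have "x^2 = 1" using xyzw(2) z by (simp add: power2_eq_square)
  then have "x = 1 \<or> x = - 1" by (simp add: power2_eq_1_iff)
  then have "x = 1" using char2_uminus[OF two, of 1] by simp
  then show ?thesis using xyzw(1) wx z by (simp add: upper_def)
qed

lemma conj_upper_triangular:
  assumes "a \<noteq> (0::'k::{field,finite})"
  shows "conjg SL2 (m2 a b 0 (1 / a)) (range upper) = range upper"
proof (rule card_subset_eq)
  let ?g = "m2 a b 0 (1 / a)"
  have g: "?g \<in> carrier SL2" using assms by (simp add: m2_carrier)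
  have i: "inv\<^bsub>SL2\<^esub> ?g = m2 (1 / a) (- b) 0 a" using assms by (subst inv_SL2) simp_all
  have "?g ** upper s ** m2 (1 / a) (- b) 0 a = upper (a^2 * s)" for s
    using assms by (simp add: upper_def power2_eq_square field_simps)
  then show "conjg SL2 ?g (range upper) \<subseteq> range upper" unfolding conjg_def i by auto
  show "card (conjg SL2 ?g (range upper)) = card (range (upper :: 'k \<Rightarrow> _))"
    by (rule SL2.card_conjg[OF subgroup.subset[OF subgroup_range_upper] g])
qed simp

text \<open>Comparing first columns in \<open>upper y\<close> h = h \<open>upper r\<close> shows
  that h is upper triangular, hence normalises \<open>range upper\<close>.\<close>

lemma conjg_upper_TI:
  fixes h :: "'k::{field,finite} ^ 2 ^ 2"
  assumes h: "h \<in> carrier SL2" and y: "upper y \<in> conjg SL2 h (range upper)" "y \<noteq> 0"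
  shows "conjg SL2 h (range upper) = range upper"
proof -
  obtain a b c d where abcd: "h = m2 a b c d" "a * d - b * c = 1" by (rule m2_exhaust_SL2[OF h])
  obtain r where r: "upper y = h \<otimes>\<^bsub>SL2\<^esub> upper r \<otimes>\<^bsub>SL2\<^esub> inv\<^bsub>SL2\<^esub> h" using y(1) unfolding conjg_def by blast
  have "upper y \<otimes>\<^bsub>SL2\<^esub> h = h \<otimes>\<^bsub>SL2\<^esub> upper r"
    unfolding r using h by (simp add: SL2.group_norm del: mult_SL2)
  then have "a + y * c = a" by (simp add: upper_def abcd(1))
  then have c: "c = 0" using y(2) by simp
  then have "a * d = 1" using abcd(2) by simp
  then have a: "a \<noteq> 0" "d = 1 / a" by (auto simp: eq_divide_eq mult.commute)
  show ?thesis unfolding abcd(1) c a(2) by (rule conj_upper_triangular[OF a(1)])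
qed

text \<open>After a is conjugated to \<open>upper s\<close>, the product with b having trace 0
  forces b to be upper unipotent too. Both conjugates then coincide, as distinct ones meet
  trivially.\<close>

lemma helly_range_upper:
  assumes two: "(2::'k::{field,finite}) = 0"
  shows "helly SL2 (range (upper :: 'k \<Rightarrow> _))"
proof (rule SL2.hellyI[OF subgroup_range_upper])
  let ?U = "range (upper :: 'k \<Rightarrow> _)"
  note Uc = subgroup.subset[OF subgroup_range_upper]
  fix g1 g2 g3 a b :: "'k ^ 2 ^ 2"
  assume g: "g1 \<in> carrier SL2" "g2 \<in> carrier SL2" "g3 \<in> carrier SL2"
    and ne: "conjg SL2 g1 ?U \<noteq> conjg SL2 g2 ?U"
    and a: "a \<in> conjg SL2 g1 ?U" and b: "b \<in> conjg SL2 g2 ?U" and ab: "a \<otimes>\<^bsub>SL2\<^esub> b \<in> conjg SL2 g3 ?U"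
  show "a = \<one>\<^bsub>SL2\<^esub> \<or> b = \<one>\<^bsub>SL2\<^esub>"
  proof (rule ccontr)
    assume n: "\<not> (a = \<one>\<^bsub>SL2\<^esub> \<or> b = \<one>\<^bsub>SL2\<^esub>)"
    have tr0: "trace B = 0" if "B \<in> conjg SL2 g ?U" "g \<in> carrier SL2" for B g
      using trace_conjg_all[OF Uc that(2,1)] two by auto
    have ac: "a \<in> carrier SL2" and bc: "b \<in> carrier SL2"
      using a b SL2.subgroup_conjg[OF subgroup_range_upper] g subgroup.mem_carrier by metis+
    obtain s where s: "a = g1 \<otimes>\<^bsub>SL2\<^esub> upper s \<otimes>\<^bsub>SL2\<^esub> inv\<^bsub>SL2\<^esub> g1" using a unfolding conjg_def by blast
    have s0: "s \<noteq> 0"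
    proof
      assume "s = 0"
      then show False using n s g(1) by (simp add: upper_0 del: mult_SL2)
    qed
    define b' where "b' = inv\<^bsub>SL2\<^esub> g1 \<otimes>\<^bsub>SL2\<^esub> b \<otimes>\<^bsub>SL2\<^esub> g1"
    have b'c: "b' \<in> carrier SL2" using bc g(1) by (simp add: b'_def del: mult_SL2)
    have bb': "b = g1 \<otimes>\<^bsub>SL2\<^esub> b' \<otimes>\<^bsub>SL2\<^esub> inv\<^bsub>SL2\<^esub> g1"
      using bc g(1) by (simp add: b'_def SL2.group_norm del: mult_SL2)
    have "trace b' = 0" using tr0[OF b g(2)] trace_conj[OF g(1) b'c] bb' by simp
    moreover have "a \<otimes>\<^bsub>SL2\<^esub> b = g1 \<otimes>\<^bsub>SL2\<^esub> (upper s \<otimes>\<^bsub>SL2\<^esub> b') \<otimes>\<^bsub>SL2\<^esub> inv\<^bsub>SL2\<^esub> g1"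
      unfolding s bb' using b'c g(1) by (simp add: SL2.group_norm del: mult_SL2)
    then have "trace (upper s \<otimes>\<^bsub>SL2\<^esub> b') = 0"
      using tr0[OF ab g(3)] trace_conj[OF g(1) SL2.m_closed[OF upper_carrier b'c]] by simp
    ultimately have "b' \<in> ?U" using unipotent_product_upper[OF two s0 b'c] by simp
    then obtain y where y: "b' = upper y" by blast
    have y0: "y \<noteq> 0"
    proof
      assume "y = 0"
      then show False using n bb' y g(1) by (simp add: upper_0 del: mult_SL2)
    qed
    let ?h = "inv\<^bsub>SL2\<^esub> g1 \<otimes>\<^bsub>SL2\<^esub> g2"
    have h: "?h \<in> carrier SL2" by (rule SL2.m_closed[OF SL2.inv_closed[OF g(1)] g(2)])
    have cm: "conjg SL2 ?h ?U = conjg SL2 (inv\<^bsub>SL2\<^esub> g1) (conjg SL2 g2 ?U)"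
      by (rule SL2.conjg_mult[OF Uc SL2.inv_closed[OF g(1)] g(2), symmetric])
    have "inv\<^bsub>SL2\<^esub> g1 \<otimes>\<^bsub>SL2\<^esub> b \<otimes>\<^bsub>SL2\<^esub> inv\<^bsub>SL2\<^esub> (inv\<^bsub>SL2\<^esub> g1) \<in> conjg SL2 ?h ?U"
      unfolding cm conjg_def[of SL2 "inv\<^bsub>SL2\<^esub> g1"] using b by blast
    then have "upper y \<in> conjg SL2 ?h ?U" using y g(1) by (simp add: b'_def)
    then have "conjg SL2 ?h ?U = ?U" by (rule conjg_upper_TI[OF h _ y0])
    then have "conjg SL2 g1 (conjg SL2 (inv\<^bsub>SL2\<^esub> g1) (conjg SL2 g2 ?U)) = conjg SL2 g1 ?U"
      unfolding cm by simp
    then show False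
      using ne SL2.conjg_inv_cancel(2)[OF subgroup.subset[OF SL2.subgroup_conjg[OF subgroup_range_upper g(2)]] g(1)]
      by simp
  qed
qed

lemma companion_one_square:
  assumes two: "(2::'k::field) = 0"
  shows "companion (1::'k) ** companion 1 = m2 1 1 1 0" "companion (1::'k) = m2 0 1 1 1"
  using char2_uminus[OF two, of 1] by (simp_all add: companion_def)

lemma ord3_char2:
  assumes two: "(2::'k::field) = 0"
  shows "(ord3 :: ('k ^ 2 ^ 2) set) = {m2 1 0 0 1, m2 0 1 1 1, m2 1 1 1 0}"
  unfolding ord3_def companion_one_square(1)[OF two]
  unfolding companion_one_square(2)[OF two] one_SL2 ..

lemma trace_ord3:
  assumes two: "(2::'k::field) = 0" and "A \<in> (ord3 :: ('k ^ 2 ^ 2) set)"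
  shows "A = \<one>\<^bsub>SL2\<^esub> \<or> trace A = 1"
  using assms(2) unfolding ord3_char2[OF two] one_SL2 by auto

lemma subgroup_ord3:
  assumes two: "(2::'k::field) = 0"
  shows "subgroup (ord3 :: ('k ^ 2 ^ 2) set) SL2"
proof (rule SL2.subgroupI)
  note m = char2_uminus[OF two, of 1] and o = ord3_char2[OF two]
  show "(ord3 :: ('k ^ 2 ^ 2) set) \<subseteq> carrier SL2" unfolding o using m by (auto simp: m2_carrier)
  show "(ord3 :: ('k ^ 2 ^ 2) set) \<noteq> {}" unfolding o by simp
  fix A B :: "'k ^ 2 ^ 2"
  assume A: "A \<in> ord3"
  have "inv\<^bsub>SL2\<^esub> (m2 1 0 0 (1::'k)) = m2 1 0 0 1" "inv\<^bsub>SL2\<^esub> (m2 0 1 1 (1::'k)) = m2 1 1 1 0"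
      "inv\<^bsub>SL2\<^esub> (m2 1 1 1 (0::'k)) = m2 0 1 1 1"
    using m by (simp_all add: inv_SL2)
  then show "inv\<^bsub>SL2\<^esub> A \<in> ord3" using A unfolding o by auto
  assume B: "B \<in> ord3"
  have "(1::'k) + 1 = 0" using two by simp
  then show "A \<otimes>\<^bsub>SL2\<^esub> B \<in> ord3" using A B unfolding o by auto
qed

lemma card_ord3:
  assumes two: "(2::'k::field) = 0"
  shows "card (ord3 :: ('k ^ 2 ^ 2) set) = 3"
  unfolding ord3_char2[OF two] by simp

lemma conjg_ord3_unique:
  assumes two: "(2::'k::{field,finite}) = 0" and no: "\<forall>w::'k. w^2 + w + 1 \<noteq> 0"
    and g: "g \<in> carrier SL2" and c: "companion 1 \<in> conjg SL2 g (ord3 :: ('k ^ 2 ^ 2) set)"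
  shows "conjg SL2 g (ord3 :: ('k ^ 2 ^ 2) set) = ord3"
proof (rule subgroup_eq_ord3[OF two _ SL2.subgroup_conjg[OF subgroup_ord3[OF two] g] c])
  fix B assume "B \<in> conjg SL2 g (ord3 :: ('k ^ 2 ^ 2) set)"
  then show "B = \<one>\<^bsub>SL2\<^esub> \<or> trace B = 1"
    using trace_conjg_all[OF subgroup.subset[OF subgroup_ord3[OF two]] g] trace_ord3[OF two] by metis
qed (use no in blast)

text \<open>After a is conjugated to \<open>companion 1\<close>, the product with b is either the
  identity or of trace 1. Either way the conjugate containing b also contains
  \<open>companion 1\<close>, which determines it.\<close>

lemma helly_ord3:
  assumes two: "(2::'k::{field,finite}) = 0" and no: "\<forall>w::'k. w^2 + w + 1 \<noteq> 0"
  shows "helly SL2 (ord3 :: ('k ^ 2 ^ 2) set)"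
proof (rule SL2.hellyI[OF subgroup_ord3[OF two]])
  let ?S = "ord3 :: ('k ^ 2 ^ 2) set"
  note Ss = subgroup_ord3[OF two]
  note Sc = subgroup.subset[OF Ss]
  fix g1 g2 g3 a b :: "'k ^ 2 ^ 2"
  assume g: "g1 \<in> carrier SL2" "g2 \<in> carrier SL2" "g3 \<in> carrier SL2"
    and ne: "conjg SL2 g1 ?S \<noteq> conjg SL2 g2 ?S"
    and a: "a \<in> conjg SL2 g1 ?S" and b: "b \<in> conjg SL2 g2 ?S" and ab: "a \<otimes>\<^bsub>SL2\<^esub> b \<in> conjg SL2 g3 ?S"
  show "a = \<one>\<^bsub>SL2\<^esub> \<or> b = \<one>\<^bsub>SL2\<^esub>"
  proof (rule ccontr)
    assume n: "\<not> (a = \<one>\<^bsub>SL2\<^esub> \<or> b = \<one>\<^bsub>SL2\<^esub>)"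
    have tr: "B = \<one>\<^bsub>SL2\<^esub> \<or> trace B = 1" if "B \<in> conjg SL2 g ?S" "g \<in> carrier SL2" for B g
      using trace_conjg_all[OF Sc that(2,1)] trace_ord3[OF two] by metis
    have ac: "a \<in> carrier SL2" and bc: "b \<in> carrier SL2"
      using a b SL2.subgroup_conjg[OF Ss] g subgroup.mem_carrier by metis+
    have "(1::'k)^2 \<noteq> 4"
    proof -
      have "(4::'k) = 2 * 2" by simp
      then show ?thesis using two by simp
    qed
    then have "sl2_conj a (companion 1)"
      using same_trace_conj[OF ac companion_carrier[of 1]] tr[OF a g(1)] n by simp
    then obtain h where h: "h \<in> carrier SL2" "a = h \<otimes>\<^bsub>SL2\<^esub> companion 1 \<otimes>\<^bsub>SL2\<^esub> inv\<^bsub>SL2\<^esub> h"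
      using sl2_conj_iff[OF ac companion_carrier] by blast
    let ?i = "inv\<^bsub>SL2\<^esub> h"
    have i: "?i \<in> carrier SL2" using h(1) by simp
    define b' where "b' = ?i \<otimes>\<^bsub>SL2\<^esub> b \<otimes>\<^bsub>SL2\<^esub> h"
    have b'c: "b' \<in> carrier SL2" using bc h(1) by (simp add: b'_def del: mult_SL2)
    have bb': "b = h \<otimes>\<^bsub>SL2\<^esub> b' \<otimes>\<^bsub>SL2\<^esub> ?i"
      using bc h(1) by (simp add: b'_def SL2.group_norm del: mult_SL2)
    have tb: "trace b' = 1" using tr[OF b g(2)] n trace_conj[OF h(1) b'c] bb' by simp
    have cb: "companion 1 \<otimes>\<^bsub>SL2\<^esub> b' \<in> carrier SL2" by (rule SL2.m_closed[OF companion_carrier b'c])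
    have ab': "a \<otimes>\<^bsub>SL2\<^esub> b = h \<otimes>\<^bsub>SL2\<^esub> (companion 1 \<otimes>\<^bsub>SL2\<^esub> b') \<otimes>\<^bsub>SL2\<^esub> ?i"
      unfolding h(2) bb' using b'c h(1) by (simp add: SL2.group_norm del: mult_SL2)
    have eq: "conjg SL2 (?i \<otimes>\<^bsub>SL2\<^esub> g') ?S = ?S"
      if g': "g' \<in> carrier SL2" and c: "companion 1 \<in> conjg SL2 (?i \<otimes>\<^bsub>SL2\<^esub> g') ?S" for g'
      by (rule conjg_ord3_unique[OF two no SL2.m_closed[OF i g'] c])
    have mem: "?i \<otimes>\<^bsub>SL2\<^esub> B \<otimes>\<^bsub>SL2\<^esub> h \<in> conjg SL2 (?i \<otimes>\<^bsub>SL2\<^esub> g') ?S"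
      if g': "g' \<in> carrier SL2" and B: "B \<in> conjg SL2 g' ?S" for g' B
    proof -
      have "?i \<otimes>\<^bsub>SL2\<^esub> B \<otimes>\<^bsub>SL2\<^esub> inv\<^bsub>SL2\<^esub> ?i \<in> conjg SL2 ?i (conjg SL2 g' ?S)"
        unfolding conjg_def[of SL2 ?i] using B by blast
      then show ?thesis using SL2.conjg_mult[OF Sc i g'] h(1) by simp
    qed
    have "?i \<otimes>\<^bsub>SL2\<^esub> a \<otimes>\<^bsub>SL2\<^esub> h = companion 1"
      unfolding h(2) using h(1) by (simp add: SL2.group_norm del: mult_SL2)
    then have e1: "conjg SL2 (?i \<otimes>\<^bsub>SL2\<^esub> g1) ?S = ?S" using eq[OF g(1)] mem[OF g(1) a] by simp
    have b'2: "b' \<in> conjg SL2 (?i \<otimes>\<^bsub>SL2\<^esub> g2) ?S" using mem[OF g(2) b] by (simp add: b'_def)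
    have s2: "subgroup (conjg SL2 (?i \<otimes>\<^bsub>SL2\<^esub> g2) ?S) SL2"
      by (rule SL2.subgroup_conjg[OF Ss SL2.m_closed[OF i g(2)]])
    have "companion 1 \<in> conjg SL2 (?i \<otimes>\<^bsub>SL2\<^esub> g2) ?S"
    proof (cases "a \<otimes>\<^bsub>SL2\<^esub> b = \<one>\<^bsub>SL2\<^esub>")
      case True
      have "companion 1 \<otimes>\<^bsub>SL2\<^esub> b' = ?i \<otimes>\<^bsub>SL2\<^esub> (a \<otimes>\<^bsub>SL2\<^esub> b) \<otimes>\<^bsub>SL2\<^esub> h"
        unfolding ab' using cb h(1) by (simp add: SL2.group_norm del: mult_SL2)
      then have "companion 1 \<otimes>\<^bsub>SL2\<^esub> b' = \<one>\<^bsub>SL2\<^esub>" unfolding True using h(1) by (simp del: mult_SL2)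
      then have "inv\<^bsub>SL2\<^esub> b' = companion 1" by (rule SL2.inv_equality[OF _ b'c companion_carrier])
      then show ?thesis using subgroup.m_inv_closed[OF s2 b'2] by simp
    next
      case False
      then have "trace (a \<otimes>\<^bsub>SL2\<^esub> b) = 1" using tr[OF ab g(3)] by blast
      then have "trace (companion 1 \<otimes>\<^bsub>SL2\<^esub> b') = 1" unfolding ab' trace_conj[OF h(1) cb] .
      then have "b' = companion 1" using trace_one_unique[OF two _ b'c tb] no by simp
      then show ?thesis using b'2 by simp
    qed
    then have e2: "conjg SL2 (?i \<otimes>\<^bsub>SL2\<^esub> g2) ?S = ?S" by (rule eq[OF g(2)])
    have conj_h: "conjg SL2 g' ?S = conjg SL2 h ?S"
      if g': "g' \<in> carrier SL2" "conjg SL2 (?i \<otimes>\<^bsub>SL2\<^esub> g') ?S = ?S" for g'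
    proof -
      have "conjg SL2 h (conjg SL2 (?i \<otimes>\<^bsub>SL2\<^esub> g') ?S) = conjg SL2 (h \<otimes>\<^bsub>SL2\<^esub> (?i \<otimes>\<^bsub>SL2\<^esub> g')) ?S"
        by (rule SL2.conjg_mult[OF Sc h(1) SL2.m_closed[OF i g'(1)]])
      also have "h \<otimes>\<^bsub>SL2\<^esub> (?i \<otimes>\<^bsub>SL2\<^esub> g') = g'" by (rule SL2.inv_cancel_assoc(2)[OF h(1) g'(1)])
      finally show ?thesis unfolding g'(2) by simp
    qed
    show False using ne conj_h[OF g(1) e1] conj_h[OF g(2) e2] by simp
  qed
qed

text \<open>The point is that nontrivial elements have trace 1: B^-1 = B^2 by Lagrange, and its
  off-diagonal entries read (tr B + 1) y = 0 and (tr B + 1) z = 0. If the trace is not 1,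
  \<open>B\<close> is diagonal and its entry is a cube root of unity, hence 1.\<close>

lemma card_three_conj_ord3:
  fixes H :: "('k::{field,finite} ^ 2 ^ 2) set"
  assumes two: "(2::'k) = 0" and no: "\<forall>w::'k. w^2 + w + 1 \<noteq> 0"
    and H: "subgroup H SL2" "card H = 3"
  shows "\<exists>g\<in>carrier SL2. conjg SL2 g H = ord3"
proof -
  note Hc = subgroup.subset[OF H(1)]
  have tr: "B = \<one>\<^bsub>SL2\<^esub> \<or> trace B = 1" if B: "B \<in> H" for B
  proof -
    have Bc: "B \<in> carrier SL2" using B Hc by blast
    obtain x y z w where xyzw: "B = m2 x y z w" "x * w - y * z = 1" by (rule m2_exhaust_SL2[OF Bc])
    have "B [^]\<^bsub>SL2\<^esub> card H = \<one>\<^bsub>SL2\<^esub>" by (rule SL2.pow_card_subgroup[OF H(1) B]) simp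
    then have "B \<otimes>\<^bsub>SL2\<^esub> B \<otimes>\<^bsub>SL2\<^esub> B = \<one>\<^bsub>SL2\<^esub>"
      using Bc by (simp add: H(2) numeral_3_eq_3 del: mult_SL2)
    then have "inv\<^bsub>SL2\<^esub> B = B \<otimes>\<^bsub>SL2\<^esub> B"
      using Bc by (intro SL2.inv_equality SL2.m_closed) 
    then have "m2 w (- y) (- z) x = m2 x y z w ** m2 x y z w"
      unfolding xyzw(1) inv_SL2[OF xyzw(2)] mult_SL2 .
    then have e: "w = x * x + y * z" "- y = x * y + y * w" "- z = z * x + w * z" "x = z * y + w * w"
      unfolding m2_mult m2_eq_iff by blast+
    show ?thesis
    proof (cases "x + w = 1")
      case False
      have "(x + w + 1) * y = (x * y + y * w) + y" "(x + w + 1) * z = (z * x + w * z) + z"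
        by (simp_all add: algebra_simps)
      then have "(x + w + 1) * y = 0" "(x + w + 1) * z = 0" unfolding e(2,3)[symmetric] by simp_all
      moreover have "x + w + 1 \<noteq> 0"
        using False char2_uminus[OF two, of 1] by (metis eq_neg_iff_add_eq_0)
      ultimately have yz: "y = 0" "z = 0" by simp_all
      then have w: "w = x * x" and "x * w = 1" using e(1) xyzw(2) by simp_all
      then have "x^3 = 1" by (simp add: power3_eq_cube mult.assoc)
      moreover have "x^3 - 1 = (x - 1) * (x^2 + x + 1)" by Groebner_Basis.algebra
      ultimately have "x = 1" using no by auto
      then show ?thesis using yz w by (simp add: xyzw(1) one_SL2)
    qed (simp add: xyzw(1))
  qed
  have "\<not> H \<subseteq> {\<one>\<^bsub>SL2\<^esub>}"
  proof
    assume "H \<subseteq> {\<one>\<^bsub>SL2\<^esub>}"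
    then have "card H \<le> card {\<one>\<^bsub>SL2 :: ('k ^ 2 ^ 2) monoid\<^esub>}" by (intro card_mono) auto
    then show False using H(2) by simp
  qed
  then obtain A where A: "A \<in> H" "A \<noteq> \<one>\<^bsub>SL2\<^esub>" by blast
  then have tA: "trace A = 1" and Ac: "A \<in> carrier SL2" using tr Hc by blast+
  have "(4::'k) = 2 * 2" by simp
  then have n4: "(1::'k)^2 \<noteq> 4" using two by simp
  have "\<exists>g\<in>carrier SL2. companion 1 \<in> conjg SL2 g H"
    by (rule sl2_conj_conjg[OF companion_carrier Hc same_trace_conj[OF companion_carrier Ac] A(1)])
      (use tA n4 in simp_all)
  then obtain g where g: "g \<in> carrier SL2" "companion 1 \<in> conjg SL2 g H" by blast
  have "conjg SL2 g H = ord3"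
  proof (rule subgroup_eq_ord3[OF two _ SL2.subgroup_conjg[OF H(1) g(1)] g(2)])
    fix B assume "B \<in> conjg SL2 g H"
    then show "B = \<one>\<^bsub>SL2\<^esub> \<or> trace B = 1" using trace_conjg_all[OF Hc g(1)] tr by metis
  qed (use no in blast)
  then show ?thesis using g(1) by blast
qed

text \<open>Iterates tr (B^2) = (tr B)^2 - 2 det B. It shows that elements of order a power of two
  have trace 0.\<close>

lemma trace_pow_char2:
  assumes two: "(2::'k::field) = 0" and A: "A \<in> carrier (SL2 :: ('k ^ 2 ^ 2) monoid)"
  shows "trace (A [^]\<^bsub>SL2\<^esub> (2 ^ n :: nat)) = trace A ^ 2 ^ n"
proof (induction n)
  case (Suc n)
  have sq: "trace (B ** B) = (trace B)^2" if B: "B \<in> carrier SL2" for B :: "'k ^ 2 ^ 2"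
  proof -
    obtain x y z w where xyzw: "B = m2 x y z w" "x * w - y * z = 1" by (rule m2_exhaust_SL2[OF B])
    have "trace (B ** B) = (trace B)^2 - 2 * (x * w - y * z)"
      by (simp add: xyzw(1) power2_eq_square algebra_simps)
    then show ?thesis using two by simp
  qed
  have "A [^]\<^bsub>SL2\<^esub> (2 ^ Suc n :: nat) = A [^]\<^bsub>SL2\<^esub> (2 ^ n + 2 ^ n :: nat)" by (simp add: mult_2)
  also have "\<dots> = A [^]\<^bsub>SL2\<^esub> (2 ^ n :: nat) ** A [^]\<^bsub>SL2\<^esub> (2 ^ n :: nat)"
    using SL2.nat_pow_mult[OF A, of "2 ^ n" "2 ^ n"] by simp
  finally show ?case using sq[OF SL2.nat_pow_closed[OF A]] Suc.IH
    by (simp add: power_mult[symmetric] mult.commute)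
qed (use A in \<open>simp del: mult_SL2\<close>)

text \<open>All traces are 0. Once a conjugate contains some nontrivial \<open>upper s\<close>,
  \<open>unipotent_product_upper\<close> puts it inside \<open>range upper\<close>, and the orders
  agree.\<close>

lemma card_q_conj_upper:
  fixes H :: "('k::{field,finite} ^ 2 ^ 2) set"
  assumes q: "CARD('k) = 2 ^ a" and q1: "CARD('k) > 1"
    and H: "subgroup H SL2" "card H = CARD('k)"
  shows "\<exists>g\<in>carrier SL2. conjg SL2 g H = range upper"
proof -
  have two: "(2::'k) = 0" by (rule char2_if_even_card[OF q])
  note Hc = subgroup.subset[OF H(1)]
  have tr: "trace A = 0" if A: "A \<in> H" for A
  proof -
    have Ac: "A \<in> carrier SL2" using A Hc by blast
    have "A [^]\<^bsub>SL2\<^esub> card H = \<one>\<^bsub>SL2\<^esub>" by (rule SL2.pow_card_subgroup[OF H(1) A]) simp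
    then have "trace A ^ 2 ^ a = trace (\<one>\<^bsub>SL2\<^esub> :: 'k ^ 2 ^ 2)"
      using trace_pow_char2[OF two Ac, of a] by (simp add: H(2) q)
    then show ?thesis using two by (simp add: one_SL2)
  qed
  have "\<not> H \<subseteq> {\<one>\<^bsub>SL2\<^esub>}"
  proof
    assume "H \<subseteq> {\<one>\<^bsub>SL2\<^esub>}"
    then have "card H \<le> card {\<one>\<^bsub>SL2 :: ('k ^ 2 ^ 2) monoid\<^esub>}" by (intro card_mono) auto
    then show False using H(2) q1 by simp
  qed
  then obtain u where u: "u \<in> H" "u \<noteq> \<one>\<^bsub>SL2\<^esub>" by blast
  have uc: "u \<in> carrier SL2" using u(1) Hc by blast
  obtain s where s: "s \<noteq> 0" "sl2_conj u (upper s)"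
    using conj_upper[OF uc _ u(2)] tr[OF u(1)] two by auto
  obtain g where g: "g \<in> carrier SL2" "upper s \<in> conjg SL2 g H"
    using sl2_conj_conjg[OF upper_carrier Hc sl2_conj_sym[OF uc upper_carrier s(2)] u(1)] by blast
  let ?S = "conjg SL2 g H"
  have S: "subgroup ?S SL2" by (rule SL2.subgroup_conjg[OF H(1) g(1)])
  have trS: "trace B = 0" if "B \<in> ?S" for B using trace_conjg_all[OF Hc g(1) that] tr by metis
  have "?S \<subseteq> range upper"
  proof
    fix B assume B: "B \<in> ?S"
    have "upper s ** B \<in> ?S" using subgroup.m_closed[OF S g(2) B] by simp
    then show "B \<in> range upper"
      using unipotent_product_upper[OF two s(1) subgroup.mem_carrier[OF S B]] trS B by blast
  qed
  moreover have "card ?S = card (range (upper :: 'k \<Rightarrow> _))"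
    using SL2.card_conjg[OF Hc g(1)] H(2) card_range_upper[where 'k = 'k] by simp
  ultimately have "?S = range upper" by (intro card_subset_eq) auto
  then show ?thesis using g(1) by blast
qed

section \<open>Passing from \<open>PSL\<^sub>2\<close> to \<open>SL\<^sub>2\<close>\<close>

abbreviation proj :: "'k::field ^ 2 ^ 2 \<Rightarrow> ('k ^ 2 ^ 2) set" where
  "proj g \<equiv> center SL2 #>\<^bsub>SL2\<^esub> g"

definition lift_SL2 :: "('k::field ^ 2 ^ 2) set set \<Rightarrow> ('k ^ 2 ^ 2) set" where
  "lift_SL2 H = {g \<in> carrier SL2. proj g \<in> H}"

interpretation PSL2: group "PSL2 :: ('k::field ^ 2 ^ 2) set monoid"
  by (rule group_PSL2)

interpretation Z: normal "center SL2" "SL2 :: ('k::field ^ 2 ^ 2) monoid"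
  by (rule SL2.center_normal)

lemma proj_hom: "proj \<in> hom SL2 PSL2"
  unfolding PSL2_def by (rule Z.r_coset_hom_Mod)

interpretation proj: group_hom "SL2 :: ('k::field ^ 2 ^ 2) monoid" PSL2 proj
  by unfold_locales (rule proj_hom)

lemma proj_image: "proj ` carrier SL2 = carrier PSL2"
  unfolding PSL2_def by (rule carrier_FactGroup[symmetric])

lemma one_PSL2: "\<one>\<^bsub>PSL2\<^esub> = center SL2"
  by (simp add: PSL2_def)

lemma proj_center:
  assumes "z \<in> center SL2"
  shows "proj z = center SL2"
  by (rule SL2.coset_join2[OF Z.mem_carrier[OF assms] Z.subgroup_axioms assms])

context
  fixes H :: "('k::{field,finite} ^ 2 ^ 2) set set"
  assumes H: "subgroup H PSL2"
begin

lemma subgroup_lift: "subgroup (lift_SL2 H) SL2"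
proof (rule SL2.subgroupI)
  show "lift_SL2 H \<subseteq> carrier SL2" by (auto simp: lift_SL2_def)
  have "\<one>\<^bsub>SL2\<^esub> \<in> lift_SL2 H"
    using subgroup.one_closed[OF H] proj.hom_one by (simp add: lift_SL2_def)
  then show "lift_SL2 H \<noteq> {}" by blast
next
  fix a assume "a \<in> lift_SL2 H"
  then show "inv\<^bsub>SL2\<^esub> a \<in> lift_SL2 H"
    using subgroup.m_inv_closed[OF H] by (auto simp: lift_SL2_def)
next
  fix a b assume "a \<in> lift_SL2 H" "b \<in> lift_SL2 H"
  then show "a \<otimes>\<^bsub>SL2\<^esub> b \<in> lift_SL2 H"
    using subgroup.m_closed[OF H] SL2.m_closed[of a b] proj.hom_mult[of a b]
    by (auto simp: lift_SL2_def simp del: mult_SL2)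
qed

lemma proj_lift: "proj ` lift_SL2 H = H"
proof -
  have "H \<subseteq> proj ` carrier SL2" unfolding proj_image by (rule subgroup.subset[OF H])
  then show ?thesis unfolding lift_SL2_def by (auto simp: image_iff subset_iff)
qed

lemma center_lift: "center SL2 \<subseteq> lift_SL2 H"
proof
  fix z :: "'k ^ 2 ^ 2" assume z: "z \<in> center SL2"
  have "center SL2 \<in> H" using subgroup.one_closed[OF H] unfolding one_PSL2 .
  then show "z \<in> lift_SL2 H"
    unfolding lift_SL2_def using Z.mem_carrier[OF z] by (simp add: proj_center[OF z])
qed

lemma lift_eq_center_iff: "lift_SL2 H = center SL2 \<longleftrightarrow> H = {\<one>\<^bsub>PSL2\<^esub>}"
proof
  assume "lift_SL2 H = center SL2"
  then have "H = proj ` center SL2" using proj_lift by simp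
  also have "\<dots> = {\<one>\<^bsub>PSL2\<^esub>}"
    unfolding one_PSL2 by (auto simp: proj_center image_iff intro: Z.one_closed)
  finally show "H = {\<one>\<^bsub>PSL2\<^esub>}" .
next
  assume "H = {\<one>\<^bsub>PSL2\<^esub>}"
  then have "z \<in> center SL2" if "z \<in> lift_SL2 H" for z
    using that SL2.rcos_self[OF _ Z.subgroup_axioms, of z]
    by (simp add: lift_SL2_def one_PSL2)
  then show "lift_SL2 H = center SL2" using center_lift by blast
qed

lemma lift_proper:
  assumes "H \<noteq> carrier PSL2"
  shows "lift_SL2 H \<noteq> carrier SL2"
  using proj_lift proj_image assms by metis

lemma binary_iff_helly_lift:
  "binary_action PSL2 (rcosets\<^bsub>PSL2\<^esub> H) (\<lambda>C g. C #>\<^bsub>PSL2\<^esub> g) \<longleftrightarrow> helly SL2 (lift_SL2 H)"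
proof -
  have "binary_action PSL2 (rcosets\<^bsub>PSL2\<^esub> H) (\<lambda>C g. C #>\<^bsub>PSL2\<^esub> g) \<longleftrightarrow> helly PSL2 H"
    by (rule PSL2.binary_iff_helly[OF finite H])
  also have "\<dots> \<longleftrightarrow> helly SL2 (lift_SL2 H)"
    unfolding lift_SL2_def
    by (rule helly_hom_iff[OF group_SL2 group_PSL2 proj_hom proj_image subgroup.subset[OF H], symmetric])
  finally show ?thesis .
qed

text \<open>In characteristic two the centre is trivial, so \<open>proj\<close> is
  injective.\<close>

lemma card_lift:
  assumes "(2::'k) = 0"
  shows "card (lift_SL2 H) = card H"
proof -
  have "proj g = {g}" if "g \<in> carrier SL2" for g :: "'k ^ 2 ^ 2"
    using that SL2.l_one[of g] unfolding center_SL2_char2[OF assms] r_coset_def by simp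
  then have "inj_on proj (lift_SL2 H)" by (intro inj_onI) (auto simp: lift_SL2_def)
  then show ?thesis using card_image proj_lift by metis
qed

end

text \<open>The order is q (q^2 - 1) with odd second factor, so the Sylow 2-subgroups are exactly
  the subgroups of order q.\<close>

lemma sylow_2_PSL2:
  assumes q: "CARD('k::{field,finite}) = 2 ^ a"
  shows "multiplicity 2 (order (PSL2 :: ('k ^ 2 ^ 2) set monoid)) = a"
proof -
  have two: "(2::'k) = 0" by (rule char2_if_even_card[OF q])
  have a: "a > 0"
    using q card_mono[of UNIV "{0, 1::'k}"] by (cases a) auto
  have "lift_SL2 (carrier (PSL2 :: ('k ^ 2 ^ 2) set monoid)) = carrier SL2"
    using proj_image by (auto simp: lift_SL2_def)
  then have "order (PSL2 :: ('k ^ 2 ^ 2) set monoid) = card (carrier (SL2 :: ('k ^ 2 ^ 2) monoid))"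
    using card_lift[OF PSL2.subgroup_self two] by (simp add: order_def)
  also have "\<dots> = 2 ^ a * ((2 ^ a)^2 - 1)" by (simp add: card_SL2 q)
  finally have o: "order (PSL2 :: ('k ^ 2 ^ 2) set monoid) = 2 ^ a * ((2 ^ a)^2 - 1)" .
  have "(2::nat) ^ a \<ge> 2" using a by (cases a) auto
  then have ge: "((2::nat) ^ a)^2 \<ge> 2" using power_mono[of 2 "(2::nat) ^ a" 2] by simp
  have ev: "even (((2::nat) ^ a)^2)" using a by simp
  then have "odd (((2::nat) ^ a)^2 - 1)" using ge by simp
  then have "multiplicity 2 (((2::nat) ^ a)^2 - 1) = 0" by (rule not_dvd_imp_multiplicity_0)
  moreover have "((2::nat) ^ a)^2 - 1 \<noteq> 0" using ge by simp
  ultimately show ?thesis unfolding o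
    by (subst prime_elem_multiplicity_mult_distrib) simp_all
qed

theorem theorem1p2:
  fixes q :: nat and H :: "('k::{field,finite} ^ 2 ^ 2) set set"
  assumes "primepow q" and "q \<ge> 4" and "q \<noteq> 5"
    and "CARD('k) = q"
    and "subgroup H PSL2" and "H \<noteq> carrier PSL2"
  shows "binary_action PSL2 (rcosets\<^bsub>PSL2\<^esub> H) (\<lambda>C g. C #>\<^bsub>PSL2\<^esub> g) \<longleftrightarrow>
      (H = {\<one>\<^bsub>PSL2\<^esub>} \<and>
         regular_action PSL2 (rcosets\<^bsub>PSL2\<^esub> H) (\<lambda>C g. C #>\<^bsub>PSL2\<^esub> g)) \<or>
      ((\<exists>a. q = 2 ^ a) \<and> sylow_subgroup 2 PSL2 H) \<or>
      ((\<exists>a. odd a \<and> q = 2 ^ a) \<and> card H = 3)"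
    (is "?bin \<longleftrightarrow> ?triv \<or> ?syl \<or> ?three")
proof -
  note Ls = subgroup_lift[OF assms(5)]
  note Lc = subgroup.subset[OF Ls]
  let ?L = "lift_SL2 H"
  have q: "CARD('k) = q" by (rule assms(4))
  show ?thesis unfolding binary_iff_helly_lift[OF assms(5)]
  proof
    assume hel: "helly SL2 ?L"
    interpret helly_subgroup ?L
      by (rule helly_subgroup.intro[OF _ _ Ls center_lift[OF assms(5)] hel lift_proper[OF assms(5,6)]])
        (use assms(2,3) q in simp_all)
    have pow2: "\<exists>a. q = 2 ^ a" if two: "(2::'k) = 0"
    proof -
      have "even q" using not_char2_if_odd_card[where 'k = 'k] two q by blast
      moreover obtain p k where pk: "Factorial_Ring.prime p" "q = p ^ k" using assms(1) unfolding primepow_def by blast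
      ultimately have "2 dvd p" using prime_dvd_power[OF two_is_prime_nat] by blast
      then have "p = 2" using pk(1) primes_dvd_imp_eq[OF two_is_prime_nat] by simp
      then show ?thesis using pk(2) by blast
    qed
    show "?triv \<or> ?syl \<or> ?three"
      using helly_subgroup_cases
    proof (elim disjE conjE bexE)
      assume "?L = center SL2"
      then have "H = {\<one>\<^bsub>PSL2\<^esub>}" using lift_eq_center_iff[OF assms(5)] by simp
      then show ?thesis using PSL2.regular_trivial by blast
    next
      fix g :: "'k ^ 2 ^ 2"
      assume two: "(2::'k) = 0" and g: "g \<in> carrier SL2" "conjg SL2 g ?L = range upper"
      obtain a where a: "q = 2 ^ a" using pow2[OF two] by blast
      have "card H = q"
        using SL2.card_conjg[OF Lc g(1)] g(2) card_range_upper[where 'k = 'k] q card_lift[OF assms(5) two]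
        by simp
      then have "sylow_subgroup 2 PSL2 H"
        using assms(5) sylow_2_PSL2[where 'k = 'k, of a] q a by (simp add: sylow_subgroup_def)
      then show ?thesis using a by blast
    next
      fix g :: "'k ^ 2 ^ 2"
      assume two: "(2::'k) = 0" and no: "\<forall>w::'k. w^2 + w + 1 \<noteq> 0"
        and g: "g \<in> carrier SL2" "conjg SL2 g ?L = ord3"
      obtain a where a: "q = 2 ^ a" using pow2[OF two] by blast
      have "odd a" using no_cube_root_iff_odd[where 'k = 'k, of a] q a no by simp
      moreover have "card H = 3"
        using SL2.card_conjg[OF Lc g(1)] g(2) card_ord3[OF two] card_lift[OF assms(5) two] by simp
      ultimately show ?thesis using a by blast
    qed
  next
    assume "?triv \<or> ?syl \<or> ?three"
    then show "helly SL2 ?L"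
    proof (elim disjE conjE exE)
      assume "H = {\<one>\<^bsub>PSL2\<^esub>}"
      then have "helly PSL2 H" using PSL2.helly_one by simp
      then show ?thesis
        using PSL2.binary_iff_helly[OF finite assms(5)] binary_iff_helly_lift[OF assms(5)] by blast
    next
      fix a assume a: "q = 2 ^ a" and syl: "sylow_subgroup 2 PSL2 H"
      have two: "(2::'k) = 0" by (rule char2_if_even_card) (use q a in simp)
      have "card ?L = CARD('k)"
        using syl sylow_2_PSL2[where 'k = 'k, of a] q a card_lift[OF assms(5) two]
        by (simp add: sylow_subgroup_def)
      then obtain g where g: "g \<in> carrier SL2" "conjg SL2 g ?L = range upper"
        using card_q_conj_upper[of a ?L] q a assms(2) Ls by auto
      show ?thesis using SL2.helly_conjg[OF Lc g(1)] g(2) helly_range_upper[OF two] by simp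
    next
      fix a assume a: "odd a" "q = 2 ^ a" and three: "card H = 3"
      have two: "(2::'k) = 0" by (rule char2_if_even_card) (use q a in simp)
      have no: "\<forall>w::'k. w^2 + w + 1 \<noteq> 0"
        using no_cube_root_iff_odd[where 'k = 'k, of a] q a by simp
      have "card ?L = 3" using three card_lift[OF assms(5) two] by simp
      then obtain g where g: "g \<in> carrier SL2" "conjg SL2 g ?L = ord3"
        using card_three_conj_ord3[OF two no Ls] by blast
      show ?thesis using SL2.helly_conjg[OF Lc g(1)] g(2) helly_ord3[OF two no] by simp
    qed
  qed
qed

end
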